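(* There exist a randomized algorithm with the following guarantee and a polynomial $p$ bounding its cost. Let $d,k\ge 1$ be integers, $R,B>0$, $\epsilon>0$, $\delta\in(0,1)$, and let $F:\mathbb{R}^d\to\mathbb{R}$ be any function of the form $$F(x)=\sum_{i=1}^{k}s_i\,\sigma(\langle w_i,x\rangle-b_i),$$ where $s_i\in\{\pm1\}$, $w_i\in\mathbb{R}^d$ with $\|w_i\|_2\le R$, $b_i\in\mathbb{R}$ with $|b_i|\le B$, and $\sigma(z)=\max(z,0)$. Given black-box query access to $F$ (and the parameters $d,k,R,B,\epsilon,\delta$), the algorithm outputs, with probability at least $1-\delta$ over its internal randomness, a one hidden layer ReLU network $F':\mathbb{R}^d\to\mathbb{R}$ such that $$\mathbb{E}_{x\sim\mathcal{N}(0,\mathrm{Id})}\big[(F(x)-F'(x))^2\big]\le\epsilon.$$ The number of queries made and the running time are at most $p(d,B,R,k,1/\epsilon,\log(1/\delta))$.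
   Context: Black-box (query) access to $F$ means that the algorithm may choose any $x\in\mathbb{R}^d$ and receives the exact value $F(x)$; the algorithm does not know the $s_i,w_i,b_i$. A one hidden layer ReLU network is a function of the form $x\mapsto\sum_j a_j\,\sigma(\langle u_j,x\rangle-c_j)$ (finite sum) with $a_j,c_j\in\mathbb{R}$, $u_j\in\mathbb{R}^d$; affine functions are of this form since $z=\sigma(z)-\sigma(-z)$. Arithmetic operations on real numbers and sampling from Gaussian distributions are counted at unit cost. *)

theory Defs
  imports "HOL-Probability.Probability"
begin

section \<open>Vectors and one hidden layer ReLU networks\<close>

text \<open>The dimension is a run-time parameter of the algorithm, so a vector of $R^d$ is an extensional
  function on the index set \<open>{..<d}\<close>, i.e.\ an element of \<open>{..<d} \<rightarrow>\<^sub>E UNIV\<close>.  This is also the space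
  of the product measure below.\<close>

type_synonym vec = "nat \<Rightarrow> real"

definition relu :: "real \<Rightarrow> real" where
  "relu z = max z 0"

definition dot :: "nat \<Rightarrow> vec \<Rightarrow> vec \<Rightarrow> real" where
  "dot d u x = (\<Sum>j<d. u j * x j)"

text \<open>A neuron \<open>(a, u, c)\<close> contributes \<open>a * relu (dot d u x - c)\<close>.\<close>

type_synonym neuron = "real \<times> vec \<times> real"

definition relu_network :: "nat \<Rightarrow> neuron list \<Rightarrow> vec \<Rightarrow> real" where
  "relu_network d ns x = (\<Sum>(a, u, c) \<leftarrow> ns. a * relu (dot d u x - c))"

definition signed_relu_sum :: "nat \<Rightarrow> nat \<Rightarrow> real \<Rightarrow> real \<Rightarrow> (vec \<Rightarrow> real) \<Rightarrow> bool" where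
  "signed_relu_sum d k R B F \<longleftrightarrow>
     (\<exists>s w b. (\<forall>i<k. s i \<in> {-1, 1} \<and> L2_set (w i) {..<d} \<le> R \<and> \<bar>b i\<bar> \<le> B) \<and>
        (\<forall>x \<in> {..<d} \<rightarrow>\<^sub>E UNIV. F x = (\<Sum>i<k. s i * relu (dot d (w i) x - b i))))"

definition std_normal_vec :: "nat \<Rightarrow> vec measure" where
  "std_normal_vec d = (\<Pi>\<^sub>M j\<in>{..<d}. std_normal_distribution)"

definition expected_sq_error :: "nat \<Rightarrow> (vec \<Rightarrow> real) \<Rightarrow> (vec \<Rightarrow> real) \<Rightarrow> ennreal" where
  "expected_sq_error d F G = (\<integral>\<^sup>+x. ennreal ((F x - G x)\<^sup>2) \<partial>std_normal_vec d)"


section \<open>Randomized real RAM with query access\<close>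

text \<open>
  Programs are finite texts with integer constants only, operating on named one-dimensional arrays
  of natural numbers (usable as indices) and of real numbers.  Real operations are the four field
  operations and comparison; in particular there is no rounding of reals to naturals, no root and
  no logarithm.  Division by \<open>0\<close> yields \<open>0\<close>.

  Every operation, memory access, test and Gaussian sample takes one time step; a query and the
  output of a neuron additionally take \<open>d\<close> steps, for the \<open>d\<close> coordinates involved.

  The internal randomness is an infinite sequence \<open>\<omega>\<close> of independent standard Gaussians, of which
  every sampling instruction consumes the next unused entry.
\<close>

type_synonym vname = string

datatype nexp =
    NConst nat
  | NLoad vname nexp
  | NAdd nexp nexp
  | NSub nexp nexp
  | NMul nexp nexp

datatype rexp =
    RConst int
  | RLoad vname nexp
  | ROfNat nexp
  | RAdd rexp rexp
  | RSub rexp rexp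
  | RMul rexp rexp
  | RDiv rexp rexp

datatype bexp =
    NLess nexp nexp
  | RLess rexp rexp
  | BNot bexp
  | BAnd bexp bexp

datatype com =
    Skip
  | NStore vname nexp nexp
  | RStore vname nexp rexp
  | Sample vname nexp
  | Query vname nexp vname
  | Emit rexp vname rexp
  | Seq com com
  | Cond bexp com com
  | While bexp com

text \<open>\<open>drawn\<close>, \<open>queries\<close> and \<open>steps\<close> count the samples consumed, the queries made and the
  elapsed time; \<open>out\<close> is the write-only output.\<close>

record state =
  nmem :: "vname \<Rightarrow> nat \<Rightarrow> nat"
  rmem :: "vname \<Rightarrow> nat \<Rightarrow> real"
  drawn :: nat
  queries :: nat
  steps :: nat
  out :: "neuron list"

primrec nval :: "state \<Rightarrow> nexp \<Rightarrow> nat" where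
  "nval s (NConst n) = n"
| "nval s (NLoad x e) = nmem s x (nval s e)"
| "nval s (NAdd e f) = nval s e + nval s f"
| "nval s (NSub e f) = nval s e - nval s f"
| "nval s (NMul e f) = nval s e * nval s f"

primrec rval :: "state \<Rightarrow> rexp \<Rightarrow> real" where
  "rval s (RConst z) = of_int z"
| "rval s (RLoad x e) = rmem s x (nval s e)"
| "rval s (ROfNat e) = of_nat (nval s e)"
| "rval s (RAdd e f) = rval s e + rval s f"
| "rval s (RSub e f) = rval s e - rval s f"
| "rval s (RMul e f) = rval s e * rval s f"
| "rval s (RDiv e f) = rval s e / rval s f"

primrec bval :: "state \<Rightarrow> bexp \<Rightarrow> bool" where
  "bval s (NLess e f) \<longleftrightarrow> nval s e < nval s f"
| "bval s (RLess e f) \<longleftrightarrow> rval s e < rval s f"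
| "bval s (BNot b) \<longleftrightarrow> \<not> bval s b"
| "bval s (BAnd b c) \<longleftrightarrow> bval s b \<and> bval s c"

primrec ncost :: "nexp \<Rightarrow> nat" where
  "ncost (NConst n) = 1"
| "ncost (NLoad x e) = ncost e + 1"
| "ncost (NAdd e f) = ncost e + ncost f + 1"
| "ncost (NSub e f) = ncost e + ncost f + 1"
| "ncost (NMul e f) = ncost e + ncost f + 1"

primrec rcost :: "rexp \<Rightarrow> nat" where
  "rcost (RConst z) = 1"
| "rcost (RLoad x e) = ncost e + 1"
| "rcost (ROfNat e) = ncost e + 1"
| "rcost (RAdd e f) = rcost e + rcost f + 1"
| "rcost (RSub e f) = rcost e + rcost f + 1"
| "rcost (RMul e f) = rcost e + rcost f + 1"
| "rcost (RDiv e f) = rcost e + rcost f + 1"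

primrec bcost :: "bexp \<Rightarrow> nat" where
  "bcost (NLess e f) = ncost e + ncost f + 1"
| "bcost (RLess e f) = rcost e + rcost f + 1"
| "bcost (BNot b) = bcost b + 1"
| "bcost (BAnd b c) = bcost b + bcost c + 1"

definition tick :: "nat \<Rightarrow> state \<Rightarrow> state" where
  "tick n s = s\<lparr>steps := steps s + n\<rparr>"

definition nwrite :: "vname \<Rightarrow> nat \<Rightarrow> nat \<Rightarrow> state \<Rightarrow> state" where
  "nwrite x i n s = s\<lparr>nmem := (nmem s)(x := (nmem s x)(i := n))\<rparr>"

definition rwrite :: "vname \<Rightarrow> nat \<Rightarrow> real \<Rightarrow> state \<Rightarrow> state" where
  "rwrite x i r s = s\<lparr>rmem := (rmem s)(x := (rmem s x)(i := r))\<rparr>"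

definition vec_at :: "nat \<Rightarrow> state \<Rightarrow> vname \<Rightarrow> vec" where
  "vec_at d s y = restrict (rmem s y) {..<d}"

text \<open>\<open>exec d F \<omega> c s t\<close>: with oracle \<open>F\<close> on $R^d$ and random sequence \<open>\<omega>\<close>, the program \<open>c\<close>
  started in \<open>s\<close> terminates in \<open>t\<close>.  \<open>Query x e y\<close> stores in \<open>x[e]\<close> the value of \<open>F\<close> at the vector
  held in the first \<open>d\<close> cells of \<open>y\<close>; the program has no other access to \<open>F\<close>.\<close>

inductive exec ::
  "nat \<Rightarrow> (vec \<Rightarrow> real) \<Rightarrow> (nat \<Rightarrow> real) \<Rightarrow> com \<Rightarrow> state \<Rightarrow> state \<Rightarrow> bool"
  for d :: nat and F :: "vec \<Rightarrow> real" and \<omega> :: "nat \<Rightarrow> real" where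
  Skip: "exec d F \<omega> Skip s (tick 1 s)"
| NStore: "exec d F \<omega> (NStore x e f) s
    (tick (ncost e + ncost f + 1) (nwrite x (nval s e) (nval s f) s))"
| RStore: "exec d F \<omega> (RStore x e f) s
    (tick (ncost e + rcost f + 1) (rwrite x (nval s e) (rval s f) s))"
| Sample: "exec d F \<omega> (Sample x e) s
    (tick (ncost e + 1) (rwrite x (nval s e) (\<omega> (drawn s)) (s\<lparr>drawn := drawn s + 1\<rparr>)))"
| Query: "exec d F \<omega> (Query x e y) s
    (tick (ncost e + d + 1)
      (rwrite x (nval s e) (F (vec_at d s y)) (s\<lparr>queries := queries s + 1\<rparr>)))"
| Emit: "exec d F \<omega> (Emit a y c) s
    (tick (rcost a + rcost c + d + 1)
      (s\<lparr>out := out s @ [(rval s a, vec_at d s y, rval s c)]\<rparr>))"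
| Seq: "exec d F \<omega> c1 s t \<Longrightarrow> exec d F \<omega> c2 t u \<Longrightarrow> exec d F \<omega> (Seq c1 c2) s u"
| CondTrue: "bval s b \<Longrightarrow> exec d F \<omega> c1 (tick (bcost b + 1) s) t \<Longrightarrow>
    exec d F \<omega> (Cond b c1 c2) s t"
| CondFalse: "\<not> bval s b \<Longrightarrow> exec d F \<omega> c2 (tick (bcost b + 1) s) t \<Longrightarrow>
    exec d F \<omega> (Cond b c1 c2) s t"
| WhileFalse: "\<not> bval s b \<Longrightarrow> exec d F \<omega> (While b c) s (tick (bcost b + 1) s)"
| WhileTrue: "bval s b \<Longrightarrow> exec d F \<omega> c (tick (bcost b + 1) s) t \<Longrightarrow>
    exec d F \<omega> (While b c) t u \<Longrightarrow> exec d F \<omega> (While b c) s u"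

inductive_cases SkipE: "exec d F \<omega> Skip s t"
inductive_cases NStoreE: "exec d F \<omega> (NStore x e f) s t"
inductive_cases RStoreE: "exec d F \<omega> (RStore x e f) s t"
inductive_cases SampleE: "exec d F \<omega> (Sample x e) s t"
inductive_cases QueryE: "exec d F \<omega> (Query x e y) s t"
inductive_cases EmitE: "exec d F \<omega> (Emit a y c) s t"
inductive_cases SeqE: "exec d F \<omega> (Seq c1 c2) s t"
inductive_cases CondE: "exec d F \<omega> (Cond b c1 c2) s t"
inductive_cases WhileE: "exec d F \<omega> (While b c) s t"

lemma exec_deterministic:
  "exec d F \<omega> c s t \<Longrightarrow> exec d F \<omega> c s t' \<Longrightarrow> t' = t"
proof (induction arbitrary: t' rule: exec.induct)
  case (Skip s) then show ?case by (auto elim: SkipE)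
next
  case (NStore x e f s) then show ?case by (auto elim: NStoreE)
next
  case (RStore x e f s) then show ?case by (auto elim: RStoreE)
next
  case (Sample x e s) then show ?case by (auto elim: SampleE)
next
  case (Query x e y s) then show ?case by (auto elim: QueryE)
next
  case (Emit a y c s) then show ?case by (auto elim: EmitE)
next
  case (Seq c1 s t c2 u)
  from Seq.prems obtain r where r: "exec d F \<omega> c1 s r" "exec d F \<omega> c2 r t'"
    by (rule SeqE)
  from Seq.IH(1)[OF r(1)] r(2) have "exec d F \<omega> c2 t t'"
    by (rule subst)
  then show ?case
    by (rule Seq.IH(2))
next
  case (CondTrue s b c1 t c2)
  from CondTrue.prems show ?case
  proof (rule CondE)
    assume "exec d F \<omega> c1 (tick (Suc (bcost b)) s) t'"
    with CondTrue.IH[of t'] show ?case by simp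
  next
    assume "\<not> bval s b"
    from this CondTrue.hyps(1) show ?case by (rule notE)
  qed
next
  case (CondFalse s b c2 t c1)
  from CondFalse.prems show ?case
  proof (rule CondE)
    assume "bval s b"
    from CondFalse.hyps(1) this show ?case by (rule notE)
  next
    assume "exec d F \<omega> c2 (tick (Suc (bcost b)) s) t'"
    with CondFalse.IH[of t'] show ?case by simp
  qed
next
  case (WhileFalse s b c)
  from WhileFalse.prems show ?case
  proof (rule WhileE)
    assume "t' = tick (Suc (bcost b)) s"
    then show ?case by simp
  next
    assume "bval s b"
    from WhileFalse.hyps(1) this show ?case by (rule notE)
  qed
next
  case (WhileTrue s b c t u)
  from WhileTrue.prems show ?case
  proof (rule WhileE)
    assume "\<not> bval s b"
    from this WhileTrue.hyps(1) show ?case by (rule notE)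
  next
    fix r
    assume r: "exec d F \<omega> c (tick (Suc (bcost b)) s) r" "exec d F \<omega> (While b c) r t'"
    have "r = t"
      using WhileTrue.IH(1)[of r] r(1) by simp
    from this r(2) have "exec d F \<omega> (While b c) t t'"
      by (rule subst)
    then show ?case
      by (rule WhileTrue.IH(2))
  qed
qed

text \<open>All memory not holding a parameter is initially \<open>0\<close>.\<close>

definition init_state :: "nat \<Rightarrow> nat \<Rightarrow> real \<Rightarrow> real \<Rightarrow> real \<Rightarrow> real \<Rightarrow> state" where
  "init_state d k R B \<epsilon> \<delta> =
     \<lparr>nmem = (\<lambda>_ _. 0)(''d'' := (\<lambda>_. 0)(0 := d), ''k'' := (\<lambda>_. 0)(0 := k)),
      rmem = (\<lambda>_ _. 0)(''R'' := (\<lambda>_. 0)(0 := R), ''B'' := (\<lambda>_. 0)(0 := B),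
                       ''eps'' := (\<lambda>_. 0)(0 := \<epsilon>), ''delta'' := (\<lambda>_. 0)(0 := \<delta>)),
      drawn = 0, queries = 0, steps = 0, out = []\<rparr>"

definition gaussian_sequence :: "(nat \<Rightarrow> real) measure" where
  "gaussian_sequence = (\<Pi>\<^sub>M i\<in>UNIV. std_normal_distribution)"

end

theory Submission
  imports Defs
begin

text \<open>
  Up to an affine function a neuron is a kink along a hyperplane, so \<open>F\<close> restricted to a random line
  \<open>p + t v\<close> is piecewise linear, and across a short cell of the line the gradient of \<open>F\<close> jumps by the
  sum of the (oriented) weight vectors of the neurons crossing in that cell.  With high probability
  two neurons crossing in the same cell have almost proportional weights, so one neuron with the
  observed jump replaces all of them, with an error bounded pointwise by a small multiple of
  \<open>1 + |x|\<close>; neurons that do not cross in the scanned range have tiny weights and act affinely.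

  The resolution that makes one line good with probability \<open>1 / 2\<close> is polynomial and independent
  of \<open>\<delta>\<close>.  The candidates of logarithmically many lines are tested on fresh Gaussian points: because the
  error of a good line is bounded pointwise, its candidate passes every test, while a candidate that
  fails on a non-negligible set is rejected except with exponentially small probability.
\<close>

section \<open>Finite-dimensional preliminaries and the scan of a line\<close>

text \<open>No separation of the neurons is assumed: weights may be tiny or nearly coincide, so
  neurons cannot be identified individually and the resolution cannot rest on a gap. It rests on
  anti-concentration. For fixed \<open>v\<close> the positions at which two neurons cross the line
  differ by an affine function of \<open>p\<close> whose gradient is, up to sign,
  \<open>w i / \<alpha> i - w j / \<alpha> j\<close> with \<open>\<alpha> i = dot d (w i) v\<close>.
  If that gradient is longer than \<open>\<rho>\<close>, the positions are within \<open>r\<close>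
  of each other with probability at most \<open>r * d / \<rho>\<close>; hence \<open>r\<close> only
  has to be polynomially smaller than \<open>\<rho>\<close>. These bounds decay linearly in the
  resolution, and the norms of \<open>p\<close> and \<open>v\<close> are bounded by Markov's
  inequality, so aiming at failure probability \<open>\<delta>\<close> with a single line would cost
  a power of \<open>1 / \<delta>\<close>; repetition and testing avoid this. A test bounds only the
  measure of the set where a candidate fails. The error on that set is bounded by a crude polynomial
  estimate valid for every short line together with a fourth moment, which is where the large number
  of tests comes from.\<close>

abbreviation vnorm :: "nat \<Rightarrow> vec \<Rightarrow> real" where
  "vnorm d x \<equiv> L2_set x {..<d}"

lemma dot_add_right: "dot d u (\<lambda>j. x j + y j) = dot d u x + dot d u y"
  by (simp add: dot_def algebra_simps sum.distrib)

lemma dot_diff_right: "dot d u (\<lambda>j. x j - y j) = dot d u x - dot d u y"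
  by (simp add: dot_def algebra_simps sum_subtractf)

lemma dot_scale_right: "dot d u (\<lambda>j. c * x j) = c * dot d u x"
  by (simp add: dot_def sum_distrib_left algebra_simps)

lemma dot_diff_left: "dot d (\<lambda>j. u j - w j) x = dot d u x - dot d w x"
  by (simp add: dot_def algebra_simps sum_subtractf)

lemma dot_divide_left: "dot d (\<lambda>j. u j / c) x = dot d u x / c"
  by (simp add: dot_def sum_divide_distrib)

lemma dot_sum_left: "dot d (\<lambda>j. \<Sum>i\<in>I. c i * u i j) x = (\<Sum>i\<in>I. c i * dot d (u i) x)"
  unfolding dot_def sum_distrib_right sum_distrib_left
  by (subst sum.swap) (simp add: algebra_simps)

lemma dot_cong: "(\<And>j. j < d \<Longrightarrow> u j = u' j) \<Longrightarrow> (\<And>j. j < d \<Longrightarrow> x j = x' j) \<Longrightarrow> dot d u x = dot d u' x'"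
  by (simp add: dot_def)

lemma dot_upd:
  assumes "j < d"
  shows "dot d u (x(j := y)) = dot d u x + u j * (y - x j)"
proof -
  have "dot d u (x(j := y)) - dot d u x = (\<Sum>i<d. if i = j then u j * (y - x j) else 0)"
    unfolding dot_def sum_subtractf[symmetric] by (rule sum.cong) (auto simp: algebra_simps)
  also have "\<dots> = u j * (y - x j)" using assms by simp
  finally show ?thesis by simp
qed

lemma abs_dot_le: "\<bar>dot d u x\<bar> \<le> vnorm d u * vnorm d x"
proof -
  have "\<bar>dot d u x\<bar> \<le> (\<Sum>j<d. \<bar>u j\<bar> * \<bar>x j\<bar>)"
    unfolding dot_def by (rule order_trans[OF sum_abs]) (simp add: abs_mult)
  also have "\<dots> \<le> vnorm d u * vnorm d x" by (rule L2_set_mult_ineq)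
  finally show ?thesis .
qed

lemma abs_component_le: "j < d \<Longrightarrow> \<bar>u j\<bar> \<le> vnorm d u"
proof -
  assume "j < d"
  then have "\<bar>u j\<bar> \<le> L2_set (\<lambda>j. \<bar>u j\<bar>) {..<d}"
    by (intro member_le_L2_set) auto
  then show ?thesis by (simp add: L2_set_def)
qed

lemma vnorm_nonneg: "0 \<le> vnorm d u"
  by (rule L2_set_nonneg)

lemma vnorm_diff_le: "vnorm d (\<lambda>j. u j - w j) \<le> vnorm d u + vnorm d w"
proof -
  have "vnorm d (\<lambda>j. u j + - w j) \<le> vnorm d u + vnorm d (\<lambda>j. - w j)"
    by (rule L2_set_triangle_ineq)
  also have "vnorm d (\<lambda>j. - w j) = vnorm d w" by (simp add: L2_set_def)
  finally show ?thesis by simp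
qed

lemma vnorm_scale: "vnorm d (\<lambda>j. c * u j) = \<bar>c\<bar> * vnorm d u"
  by (simp add: L2_set_def power_mult_distrib sum_distrib_left[symmetric] real_sqrt_mult)

lemma vnorm_cong: "(\<And>j. j < d \<Longrightarrow> u j = u' j) \<Longrightarrow> vnorm d u = vnorm d u'"
  by (rule L2_set_cong) auto

lemma vnorm_power2: "(vnorm d u)\<^sup>2 = (\<Sum>j<d. (u j)\<^sup>2)"
  by (simp add: L2_set_def sum_nonneg)

lemma relu_diff_le: "\<bar>relu a - relu b\<bar> \<le> \<bar>a - b\<bar>"
  by (auto simp: relu_def max_def)

lemma relu_le_abs: "\<bar>relu a\<bar> \<le> \<bar>a\<bar>"
  by (auto simp: relu_def max_def)

lemma relu_scale: "c \<ge> 0 \<Longrightarrow> relu (c * a) = c * relu a"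
  by (auto simp: relu_def max_def mult_le_0_iff)

section \<open>Reading a network off a line\<close>

text \<open>The oracle is known to have this form only on extensional vectors. The analysis works
  with this total function, and the result is transferred to the oracle at the very end.\<close>

definition neuron_sum :: "nat \<Rightarrow> nat \<Rightarrow> (nat \<Rightarrow> real) \<Rightarrow> (nat \<Rightarrow> vec) \<Rightarrow> (nat \<Rightarrow> real) \<Rightarrow> vec \<Rightarrow> real" where
  "neuron_sum d k s w b x = (\<Sum>i<k. s i * relu (dot d (w i) x - b i))"

text \<open>Restricted to \<open>{..<d}\<close>, here and in \<open>grid_grad\<close> and
  \<open>kink_dir\<close>, because this is the form in which the machine hands vectors to the oracle
  and to the output.\<close>

definition grid_point :: "nat \<Rightarrow> real \<Rightarrow> real \<Rightarrow> vec \<Rightarrow> vec \<Rightarrow> nat \<Rightarrow> vec" where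
  "grid_point d T r p v n = (\<lambda>j\<in>{..<d}. p j + (real n * r - T) * v j)"

definition diff_quot :: "(vec \<Rightarrow> real) \<Rightarrow> real \<Rightarrow> vec \<Rightarrow> vec" where
  "diff_quot F h x j = (F (x(j := x j + h)) - F x) / h"

definition grid_grad ::
    "nat \<Rightarrow> (vec \<Rightarrow> real) \<Rightarrow> real \<Rightarrow> real \<Rightarrow> real \<Rightarrow> vec \<Rightarrow> vec \<Rightarrow> nat \<Rightarrow> vec" where
  "grid_grad d F T r h p v n = (\<lambda>j\<in>{..<d}. diff_quot F h (grid_point d T r p v n) j)"

definition grad_jump ::
    "nat \<Rightarrow> (vec \<Rightarrow> real) \<Rightarrow> real \<Rightarrow> real \<Rightarrow> real \<Rightarrow> vec \<Rightarrow> vec \<Rightarrow> nat \<Rightarrow> vec" where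
  "grad_jump d F T r h p v n j = grid_grad d F T r h p v (Suc n) j - grid_grad d F T r h p v n j"

definition jump_slope ::
    "nat \<Rightarrow> (vec \<Rightarrow> real) \<Rightarrow> real \<Rightarrow> real \<Rightarrow> real \<Rightarrow> vec \<Rightarrow> vec \<Rightarrow> nat \<Rightarrow> real" where
  "jump_slope d F T r h p v n = dot d (grad_jump d F T r h p v n) v"

text \<open>When the jumps in a cell cancel, the slope is \<open>0\<close> and division by \<open>0\<close> turns the neuron of that cell into
  the zero function, as it should be.\<close>

definition kink_dir ::
    "nat \<Rightarrow> (vec \<Rightarrow> real) \<Rightarrow> real \<Rightarrow> real \<Rightarrow> real \<Rightarrow> vec \<Rightarrow> vec \<Rightarrow> nat \<Rightarrow> vec" where
  "kink_dir d F T r h p v n =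
     (\<lambda>j\<in>{..<d}. grad_jump d F T r h p v n j / jump_slope d F T r h p v n)"

definition base_offset ::
    "nat \<Rightarrow> (vec \<Rightarrow> real) \<Rightarrow> real \<Rightarrow> real \<Rightarrow> real \<Rightarrow> vec \<Rightarrow> vec \<Rightarrow> real" where
  "base_offset d F T r h p v =
     dot d (grid_grad d F T r h p v 0) (grid_point d T r p v 0) - F (grid_point d T r p v 0)"

text \<open>A kink is anchored at the left grid point of its cell; the crossing itself is not
  located, which costs at most \<open>r\<close> in its position. The last two neurons add up to the
  tangent of \<open>F\<close> at the leftmost grid point, by
  \<open>z = relu z - relu (- z)\<close>.\<close>

definition scan_neuron ::
    "nat \<Rightarrow> (vec \<Rightarrow> real) \<Rightarrow> nat \<Rightarrow> real \<Rightarrow> real \<Rightarrow> real \<Rightarrow> vec \<Rightarrow> vec \<Rightarrow> nat \<Rightarrow> neuron" where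
  "scan_neuron d F N T r h p v n =
     (if n < N then
        (jump_slope d F T r h p v n, kink_dir d F T r h p v n,
         dot d (kink_dir d F T r h p v n) (grid_point d T r p v n))
      else if n = N then
        (1, grid_grad d F T r h p v 0, base_offset d F T r h p v)
      else
        (-1, (\<lambda>j\<in>{..<d}. - grid_grad d F T r h p v 0 j), - base_offset d F T r h p v))"

definition scan_net ::
    "nat \<Rightarrow> (vec \<Rightarrow> real) \<Rightarrow> nat \<Rightarrow> real \<Rightarrow> real \<Rightarrow> real \<Rightarrow> vec \<Rightarrow> vec \<Rightarrow> neuron list" where
  "scan_net d F N T r h p v = map (scan_neuron d F N T r h p v) [0..<N + 2]"

lemma grid_point_ext: "grid_point d T r p v n \<in> {..<d} \<rightarrow>\<^sub>E UNIV"
  by (simp add: grid_point_def)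

lemma dot_grid_point:
  "dot d u (grid_point d T r p v n) = dot d u p + (real n * r - T) * dot d u v"
proof -
  have "dot d u (grid_point d T r p v n) = dot d u (\<lambda>j. p j + (real n * r - T) * v j)"
    by (rule dot_cong) (simp_all add: grid_point_def)
  then show ?thesis by (simp only: dot_add_right dot_scale_right)
qed

lemma relu_minus_relu: "relu z - relu (- z) = z"
  by (auto simp: relu_def max_def)

text \<open>Both error bounds start from this form, in which the offsets have been absorbed into
  displacements from grid points.\<close>

lemma relu_network_scan_net:
  "relu_network d (scan_net d F N T r h p v) x =
     F (grid_point d T r p v 0)
     + dot d (grid_grad d F T r h p v 0) (\<lambda>j. x j - grid_point d T r p v 0 j)
     + (\<Sum>n<N. jump_slope d F T r h p v n *
          relu (dot d (grad_jump d F T r h p v n) (\<lambda>j. x j - grid_point d T r p v n j)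
                / jump_slope d F T r h p v n))"
proof -
  let ?f = "\<lambda>(a, u, c). a * relu (dot d u x - c)"
  have kd: "dot d (kink_dir d F T r h p v n) y
      = dot d (grad_jump d F T r h p v n) y / jump_slope d F T r h p v n" for n y
    unfolding dot_divide_left[symmetric] by (rule dot_cong) (simp_all add: kink_dir_def)
  have ng: "dot d (\<lambda>j\<in>{..<d}. - grid_grad d F T r h p v 0 j) x = - dot d (grid_grad d F T r h p v 0) x"
    by (simp add: dot_def sum_negf)
  have "relu_network d (scan_net d F N T r h p v) x
      = (\<Sum>n<N. ?f (scan_neuron d F N T r h p v n))
        + ?f (scan_neuron d F N T r h p v N) + ?f (scan_neuron d F N T r h p v (Suc N))"
    by (simp add: relu_network_def scan_net_def comp_def interv_sum_list_conv_sum_set_nat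
          atLeast0LessThan)
  moreover have "(\<Sum>n<N. ?f (scan_neuron d F N T r h p v n)) =
      (\<Sum>n<N. jump_slope d F T r h p v n *
          relu (dot d (grad_jump d F T r h p v n) (\<lambda>j. x j - grid_point d T r p v n j)
                / jump_slope d F T r h p v n))"
    by (rule sum.cong) (simp_all add: scan_neuron_def kd dot_diff_right diff_divide_distrib)
  moreover have "?f (scan_neuron d F N T r h p v N) + ?f (scan_neuron d F N T r h p v (Suc N))
     = dot d (grid_grad d F T r h p v 0) x - base_offset d F T r h p v"
    using relu_minus_relu[of "dot d (grid_grad d F T r h p v 0) x - base_offset d F T r h p v"]
    by (simp add: scan_neuron_def ng)
  ultimately show ?thesis
    by (simp add: base_offset_def dot_diff_right)
qed

section \<open>Pointwise error of the network on a good line\<close>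

text \<open>All directions of nonzero weight lie within \<open>\<rho>\<close> of one fixed
  \<open>z j\<close>, so both expressions are compared with
  \<open>(\<Sum>i\<in>I. c i) * relu (dot d (z j) y)\<close>. Each comparison costs
  \<open>\<rho>\<close> times the total absolute weight, whatever the signs of the weights.\<close>

lemma merge_kinks:
  fixes c :: "nat \<Rightarrow> real"
  assumes close: "\<And>i j. i \<in> I \<Longrightarrow> j \<in> I \<Longrightarrow> c i \<noteq> 0 \<Longrightarrow> c j \<noteq> 0 \<Longrightarrow>
      vnorm d (\<lambda>l. z i l - z j l) \<le> \<rho>"
    and "0 \<le> \<rho>"
  shows "\<bar>(\<Sum>i\<in>I. c i * relu (dot d (z i) y))
      - (\<Sum>i\<in>I. c i) * relu (dot d (\<lambda>l. \<Sum>i\<in>I. c i * z i l) y / (\<Sum>i\<in>I. c i))\<bar>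
    \<le> 2 * \<rho> * vnorm d y * (\<Sum>i\<in>I. \<bar>c i\<bar>)"
proof (cases "\<exists>j\<in>I. c j \<noteq> 0")
  case False
  then have "\<And>i. i \<in> I \<Longrightarrow> c i = 0" by auto
  then show ?thesis by simp
next
  case True
  then obtain j where j: "j \<in> I" "c j \<noteq> 0" by auto
  define S where "S = (\<Sum>i\<in>I. c i)"
  define e where "e i = dot d (z i) y - dot d (z j) y" for i
  have e: "\<bar>c i * e i\<bar> \<le> \<bar>c i\<bar> * (\<rho> * vnorm d y)" if "i \<in> I" for i
  proof (cases "c i = 0")
    case False
    have "\<bar>e i\<bar> \<le> vnorm d (\<lambda>l. z i l - z j l) * vnorm d y"
      unfolding e_def dot_diff_left[symmetric] by (rule abs_dot_le)
    also have "\<dots> \<le> \<rho> * vnorm d y"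
      using close[OF that j(1) False j(2)] by (intro mult_right_mono vnorm_nonneg)
    finally show ?thesis by (simp add: abs_mult mult_left_mono)
  qed simp
  have "\<bar>(\<Sum>i\<in>I. c i * relu (dot d (z i) y)) - S * relu (dot d (z j) y)\<bar>
      = \<bar>\<Sum>i\<in>I. c i * (relu (dot d (z i) y) - relu (dot d (z j) y))\<bar>"
    by (simp add: S_def sum_distrib_right sum_subtractf right_diff_distrib)
  also have "\<dots> \<le> (\<Sum>i\<in>I. \<bar>c i\<bar> * (\<rho> * vnorm d y))"
  proof (rule order_trans[OF sum_abs], rule sum_mono)
    fix i assume i: "i \<in> I"
    have "\<bar>c i * (relu (dot d (z i) y) - relu (dot d (z j) y))\<bar> \<le> \<bar>c i * e i\<bar>"
      unfolding abs_mult e_def by (intro mult_left_mono relu_diff_le) simp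
    with e[OF i] show "\<bar>c i * (relu (dot d (z i) y) - relu (dot d (z j) y))\<bar>
        \<le> \<bar>c i\<bar> * (\<rho> * vnorm d y)" by linarith
  qed
  finally have 1: "\<bar>(\<Sum>i\<in>I. c i * relu (dot d (z i) y)) - S * relu (dot d (z j) y)\<bar>
      \<le> \<rho> * vnorm d y * (\<Sum>i\<in>I. \<bar>c i\<bar>)"
    by (simp add: sum_distrib_left mult_ac)
  have 2: "\<bar>S * relu (dot d (z j) y) - S * relu (dot d (\<lambda>l. \<Sum>i\<in>I. c i * z i l) y / S)\<bar>
      \<le> \<rho> * vnorm d y * (\<Sum>i\<in>I. \<bar>c i\<bar>)"
  \<comment> \<open>If the weights cancel, both terms carry the factor \<open>S = 0\<close>.
    Otherwise the outer \<open>S\<close> cancels the division by it, so that no lower bound on its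
    absolute value enters.\<close>
  proof (cases "S = 0")
    case True
    then show ?thesis using assms(2) by (simp add: sum_nonneg vnorm_nonneg)
  next
    case False
    have "\<bar>S * relu (dot d (z j) y) - S * relu (dot d (\<lambda>l. \<Sum>i\<in>I. c i * z i l) y / S)\<bar>
       \<le> \<bar>S\<bar> * \<bar>dot d (z j) y - dot d (\<lambda>l. \<Sum>i\<in>I. c i * z i l) y / S\<bar>"
      unfolding right_diff_distrib[symmetric] abs_mult by (intro mult_left_mono relu_diff_le) simp
    also have "\<dots> = \<bar>S * dot d (z j) y - dot d (\<lambda>l. \<Sum>i\<in>I. c i * z i l) y\<bar>"
      unfolding abs_mult[symmetric] using False by (simp add: right_diff_distrib)
    also have "\<dots> = \<bar>\<Sum>i\<in>I. c i * e i\<bar>"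
      unfolding dot_sum_left S_def e_def
      by (simp add: right_diff_distrib sum_subtractf sum_distrib_right abs_minus_commute)
    also have "\<dots> \<le> (\<Sum>i\<in>I. \<bar>c i\<bar> * (\<rho> * vnorm d y))"
      by (rule order_trans[OF sum_abs], rule sum_mono, rule e)
    finally show ?thesis
      by (simp add: sum_distrib_left mult_ac)
  qed
  show ?thesis using 1 2 unfolding S_def by linarith
qed


text \<open>Moving one coordinate by \<open>h\<close> changes the argument of neuron
  \<open>i\<close> by at most \<open>h * vnorm d (w i)\<close>, so every neuron stays on its linear
  piece and the quotient is the exact partial derivative. As queries are exact, \<open>h\<close> can
  be taken as small as this condition demands.\<close>

lemma neuron_sum_diff_quot_exact:
  assumes "0 < h" and j: "j < d"
    and away: "\<And>i. i < k \<Longrightarrow> vnorm d (w i) > 0 \<Longrightarrow> \<bar>dot d (w i) x - b i\<bar> > h * vnorm d (w i)"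
  shows "diff_quot (neuron_sum d k s w b) h x j
    = (\<Sum>i<k. s i * of_bool (dot d (w i) x > b i) * w i j)"
proof -
  have "relu (dot d (w i) (x(j := x j + h)) - b i) - relu (dot d (w i) x - b i)
      = h * (of_bool (dot d (w i) x > b i) * w i j)" if i: "i < k" for i
  proof -
    have c: "\<bar>w i j\<bar> \<le> vnorm d (w i)" by (rule abs_component_le[OF j])
    have u: "dot d (w i) (x(j := x j + h)) = dot d (w i) x + w i j * h"
      using j by (simp add: dot_upd)
    show ?thesis
    proof (cases "vnorm d (w i) > 0")
      case True
      have "\<bar>w i j * h\<bar> \<le> h * vnorm d (w i)"
        using c \<open>0 < h\<close> by (simp add: abs_mult mult.commute)
      with away[OF i True] show ?thesis
        unfolding u by (auto simp: relu_def max_def abs_if mult.commute split: if_splits)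
    next
      case False
      with c have "w i j = 0" by simp
      then show ?thesis unfolding u by simp
    qed
  qed
  then have "neuron_sum d k s w b (x(j := x j + h)) - neuron_sum d k s w b x
      = (\<Sum>i<k. s i * (h * (of_bool (dot d (w i) x > b i) * w i j)))"
    unfolding neuron_sum_def sum_subtractf[symmetric]
    by (intro sum.cong) (auto simp: right_diff_distrib[symmetric])
  also have "\<dots> = h * (\<Sum>i<k. s i * of_bool (dot d (w i) x > b i) * w i j)"
    by (simp add: sum_distrib_left mult_ac)
  finally show ?thesis using \<open>0 < h\<close> by (simp add: diff_quot_def)
qed

text \<open>A neuron with slope \<open>\<alpha> = dot d w v \<noteq> 0\<close> is written as \<open>\<bar>\<alpha>\<bar> * relu (dot d (w / \<alpha>) x - b / \<alpha>)\<close>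
  up to an affine function.  All directions \<open>w / \<alpha>\<close> have the same slope \<open>1\<close> along the line, so the
  slope of the summed jump is exactly the total weight of the neurons merged in a cell, however
  much they cancel.\<close>

lemma scan_net_error:
  fixes d k :: nat and s b :: "nat \<Rightarrow> real" and w :: "nat \<Rightarrow> vec" and p v :: vec
  defines "F \<equiv> neuron_sum d k s w b"
  defines "\<alpha> \<equiv> \<lambda>i. dot d (w i) v"
  assumes pos: "0 < h" "0 < r" "0 \<le> R" "0 \<le> \<rho>" "0 \<le> \<kappa>" "0 \<le> V"
    and T: "T = real mid * r" and N: "N = 2 * mid"
    and s: "\<And>i. i < k \<Longrightarrow> \<bar>s i\<bar> \<le> 1" and w: "\<And>i. i < k \<Longrightarrow> vnorm d (w i) \<le> R"
    and exact: "\<And>i n. i < k \<Longrightarrow> n \<le> N \<Longrightarrow> vnorm d (w i) > 0 \<Longrightarrow>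
       \<bar>dot d (w i) (grid_point d T r p v n) - b i\<bar> > h * vnorm d (w i)"
    and collinear: "\<And>i j. i < k \<Longrightarrow> j < k \<Longrightarrow> \<alpha> i \<noteq> 0 \<Longrightarrow> \<alpha> j \<noteq> 0 \<Longrightarrow>
       \<bar>(b i - dot d (w i) p) / \<alpha> i - (b j - dot d (w j) p) / \<alpha> j\<bar> \<le> r \<Longrightarrow>
       vnorm d (\<lambda>l. w i l / \<alpha> i - w j l / \<alpha> j) \<le> \<rho>"
    and crossing: "\<And>i. i < k \<Longrightarrow> vnorm d (w i) \<le> \<kappa> \<or> \<bar>b i - dot d (w i) p\<bar> \<le> T * \<bar>\<alpha> i\<bar>"
    and V: "vnorm d p \<le> V" "vnorm d v \<le> V"
  shows "\<bar>F x - relu_network d (scan_net d F N T r h p v) x\<bar>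
    \<le> real k * (R * V * (r + 2 * \<rho> * (vnorm d x + V + T * V)))
      + real k * (\<kappa> * (vnorm d x + V))"
proof -
  define P where "P = grid_point d T r p v"
  define t where "t n = real n * r - T" for n
  define act where "act i n \<longleftrightarrow> dot d (w i) (P n) > b i" for i n
  \<comment> \<open>The change of activity of neuron \<open>i\<close> across cell \<open>n\<close>.
    Along a line it has the sign of \<open>\<alpha> i\<close> whenever it is nonzero.\<close>
  define cr :: "nat \<Rightarrow> nat \<Rightarrow> real" where "cr i n = of_bool (act i (Suc n)) - of_bool (act i n)" for i n
  define z where "z i l = w i l / \<alpha> i" for i l
  define c where "c n i = s i * (\<bar>cr i n\<bar> * \<bar>\<alpha> i\<bar>)" for i n
  define nx where "nx = vnorm d x + V + T * V"
  have T0: "0 \<le> T" using T pos by simp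
  have alf: "dot d (w i) v = \<alpha> i" for i by (simp add: \<alpha>_def)
  have dP: "dot d u (P n) = dot d u p + t n * dot d u v" for u n
    by (simp add: P_def t_def dot_grid_point)
  have step: "t (Suc n) = t n + r" for n by (simp add: t_def algebra_simps)
  have grad: "grid_grad d F T r h p v n j = (\<Sum>i<k. s i * of_bool (act i n) * w i j)"
    if "n \<le> N" "j < d" for n j
    unfolding grid_grad_def F_def act_def P_def using that pos exact
    by (simp add: neuron_sum_diff_quot_exact)
  have sgn: "cr i n = sgn (\<alpha> i) * \<bar>cr i n\<bar>" for i n
  proof -
    have "dot d (w i) (P (Suc n)) = dot d (w i) (P n) + r * \<alpha> i"
      by (simp add: dP step \<alpha>_def algebra_simps)
    moreover have "r * \<alpha> i > 0 \<longleftrightarrow> \<alpha> i > 0" "r * \<alpha> i < 0 \<longleftrightarrow> \<alpha> i < 0"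
      using pos by (simp_all add: zero_less_mult_iff mult_less_0_iff)
    ultimately show ?thesis
      by (cases "\<alpha> i" "0::real" rule: linorder_cases)
        (auto simp: cr_def act_def sgn_if split: if_splits)
  qed
  have chi01: "\<bar>cr i n\<bar> = 0 \<or> \<bar>cr i n\<bar> = 1" for i n by (auto simp: cr_def)
  \<comment> \<open>For \<open>\<alpha> i = 0\<close> the neuron never changes activity, so both
    sides are \<open>0\<close> despite the division in \<open>z\<close>.\<close>
  have alpha_z: "cr i n * w i l = \<bar>cr i n\<bar> * \<bar>\<alpha> i\<bar> * z i l" for i n l
  proof (cases "\<alpha> i = 0")
    case True
    then show ?thesis using sgn[of i n] by simp
  next
    case False
    have "\<bar>\<alpha> i\<bar> * z i l = sgn (\<alpha> i) * w i l"
      using False by (auto simp: z_def sgn_if)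
    then show ?thesis using sgn[of i n] by (metis mult.assoc mult.commute)
  qed
  have jump: "grad_jump d F T r h p v n j = (\<Sum>i<k. c n i * z i j)" if "n < N" "j < d" for n j
  proof -
    have "grad_jump d F T r h p v n j = (\<Sum>i<k. s i * (cr i n * w i j))"
      using that by (simp add: grad_jump_def grad sum_subtractf[symmetric] cr_def algebra_simps)
    then show ?thesis by (simp add: alpha_z c_def mult.assoc)
  qed
  have zdot: "dot d (z i) y = dot d (w i) y / \<alpha> i" for i y
    unfolding z_def[abs_def] by (rule dot_divide_left)
  have zv: "c n i * dot d (z i) v = c n i" for n i
    by (cases "\<alpha> i = 0") (simp_all add: c_def zdot \<alpha>_def)
  have slope: "jump_slope d F T r h p v n = (\<Sum>i<k. c n i)" if "n < N" for n
  proof -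
    have "jump_slope d F T r h p v n = dot d (\<lambda>l. \<Sum>i<k. c n i * z i l) v"
      unfolding jump_slope_def by (rule dot_cong) (simp_all add: jump that)
    then show ?thesis by (simp add: dot_sum_left zv)
  qed
  have kink: "jump_slope d F T r h p v n *
          relu (dot d (grad_jump d F T r h p v n) (\<lambda>j. x j - grid_point d T r p v n j)
                / jump_slope d F T r h p v n)
      = (\<Sum>i<k. c n i) * relu (dot d (\<lambda>l. \<Sum>i<k. c n i * z i l) (\<lambda>j. x j - P n j) / (\<Sum>i<k. c n i))"
    if "n < N" for n
  proof -
    have "dot d (grad_jump d F T r h p v n) y = dot d (\<lambda>l. \<Sum>i<k. c n i * z i l) y" for y
      by (rule dot_cong) (simp_all add: jump that)
    then show ?thesis by (simp add: slope that P_def)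
  qed
  have between: "t n \<le> (b i - dot d (w i) p) / \<alpha> i" "(b i - dot d (w i) p) / \<alpha> i \<le> t n + r"
      "\<alpha> i \<noteq> 0" if "cr i n \<noteq> 0" for i n
  proof -
    have act: "act i (Suc n) \<noteq> act i n" using that by (auto simp: cr_def)
    then show a: "\<alpha> i \<noteq> 0" by (auto simp: act_def dP \<alpha>_def)
    from sgn[of i n] have "\<alpha> i > 0 \<Longrightarrow> cr i n \<ge> 0" "\<alpha> i < 0 \<Longrightarrow> cr i n \<le> 0"
      by (simp_all add: sgn_if)
    then have "t n \<le> (b i - dot d (w i) p) / \<alpha> i \<and> (b i - dot d (w i) p) / \<alpha> i \<le> t n + r"
      using act a unfolding cr_def act_def dP alf step
      by (cases "\<alpha> i > 0") (auto simp: field_simps split: if_splits)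
    then show "t n \<le> (b i - dot d (w i) p) / \<alpha> i" "(b i - dot d (w i) p) / \<alpha> i \<le> t n + r"
      by auto
  qed
  have tT: "\<bar>t n\<bar> \<le> T" if "n \<le> N" for n
  proof -
    have "real n * r \<le> real N * r" using that pos by simp
    then show ?thesis using pos by (simp add: t_def T N abs_le_iff)
  qed
  have dist: "vnorm d (\<lambda>j. x j - P n j) \<le> nx" if "n \<le> N" for n
  proof -
    have "vnorm d (\<lambda>j. x j - P n j) \<le> vnorm d x + vnorm d (P n)" by (rule vnorm_diff_le)
    also have "vnorm d (P n) = vnorm d (\<lambda>j. p j - (- t n) * v j)"
      by (rule vnorm_cong) (simp add: P_def grid_point_def t_def algebra_simps)
    also have "\<dots> \<le> vnorm d p + \<bar>t n\<bar> * vnorm d v"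
      using vnorm_diff_le[of p "\<lambda>j. (- t n) * v j" d] by (simp only: vnorm_scale abs_minus_cancel)
    also have "\<dots> \<le> V + T * V" using V tT[OF that] T0
      by (intro add_mono mult_mono) (auto simp: vnorm_nonneg)
    finally show ?thesis by (simp add: nx_def)
  qed
  have nx0: "0 \<le> nx" using T0 pos by (simp add: nx_def vnorm_nonneg)
  have merge: "\<bar>(\<Sum>i<k. c n i * relu (dot d (z i) (\<lambda>j. x j - P n j)))
      - (\<Sum>i<k. c n i) * relu (dot d (\<lambda>l. \<Sum>i<k. c n i * z i l) (\<lambda>j. x j - P n j) / (\<Sum>i<k. c n i))\<bar>
      \<le> 2 * \<rho> * nx * (\<Sum>i<k. \<bar>c n i\<bar>)" if "n < N" for n
  proof -
    have "\<bar>(\<Sum>i<k. c n i * relu (dot d (z i) (\<lambda>j. x j - P n j)))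
      - (\<Sum>i<k. c n i) * relu (dot d (\<lambda>l. \<Sum>i<k. c n i * z i l) (\<lambda>j. x j - P n j) / (\<Sum>i<k. c n i))\<bar>
      \<le> 2 * \<rho> * vnorm d (\<lambda>j. x j - P n j) * (\<Sum>i<k. \<bar>c n i\<bar>)"
    proof (rule merge_kinks)
      fix i j assume "i \<in> {..<k}" "j \<in> {..<k}" and "c n i \<noteq> 0" "c n j \<noteq> 0"
      moreover from this have "cr i n \<noteq> 0" "cr j n \<noteq> 0" by (auto simp: c_def)
      ultimately show "vnorm d (\<lambda>l. z i l - z j l) \<le> \<rho>"
        unfolding z_def using between[of i n] between[of j n]
        by (intro collinear) auto
    qed (use pos in simp)
    also have "\<dots> \<le> 2 * \<rho> * nx * (\<Sum>i<k. \<bar>c n i\<bar>)"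
      using dist[of n] that pos by (intro mult_right_mono mult_left_mono) (auto simp: sum_nonneg)
    finally show ?thesis .
  qed
  \<comment> \<open>Neuron \<open>i\<close> minus its linear piece at the leftmost grid point: the
    one-sided part that the kinks have to reproduce.\<close>
  define e where "e i = relu (dot d (w i) x - b i) - of_bool (act i 0) * (dot d (w i) x - b i)" for i
  \<comment> \<open>In the cell where neuron \<open>i\<close> crosses, \<open>e i\<close> is a
    multiple of a ReLU in direction \<open>z i\<close> with its kink at the crossing position.
    Moving the kink to the left end \<open>t n\<close> of the cell changes the argument by at most
    \<open>r\<close>, because \<open>z i\<close> has slope \<open>1\<close> along the line.\<close>
  have shift: "\<bar>\<bar>cr i n\<bar> * e i - \<bar>cr i n\<bar> * (\<bar>\<alpha> i\<bar> * relu (dot d (z i) (\<lambda>j. x j - P n j)))\<bar>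
      \<le> \<bar>cr i n\<bar> * \<bar>\<alpha> i\<bar> * r" if act0: "cr i n \<noteq> 0 \<Longrightarrow> act i 0 \<longleftrightarrow> \<alpha> i < 0" for i n
  proof (cases "cr i n = 0")
    case False
    note bt = between[OF False]
    define B where "B = (b i - dot d (w i) p) / \<alpha> i"
    have b: "b i = dot d (w i) p + \<alpha> i * B" using bt by (simp add: B_def)
    have "e i = relu (sgn (\<alpha> i) * (dot d (w i) x - b i))"
      using act0[OF False] bt(3) by (auto simp: e_def relu_def max_def sgn_if)
    also have "sgn (\<alpha> i) * (dot d (w i) x - b i) = \<bar>\<alpha> i\<bar> * (dot d (z i) x - dot d (z i) p - B)"
      unfolding b zdot using bt(3)
      by (auto simp: sgn_if field_simps)
    finally have ei: "e i = \<bar>\<alpha> i\<bar> * relu (dot d (z i) x - dot d (z i) p - B)"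
      by (simp add: relu_scale)
    have "dot d (z i) v = 1" using bt(3) by (simp add: zdot \<alpha>_def)
    then have y: "dot d (z i) (\<lambda>j. x j - P n j) = dot d (z i) x - dot d (z i) p - t n"
      by (simp add: dot_diff_right dP)
    have "\<bar>relu (dot d (z i) x - dot d (z i) p - B) - relu (dot d (z i) (\<lambda>j. x j - P n j))\<bar> \<le> r"
      unfolding y using bt(1,2) by (intro order_trans[OF relu_diff_le]) (simp add: B_def)
    then have "\<bar>e i - \<bar>\<alpha> i\<bar> * relu (dot d (z i) (\<lambda>j. x j - P n j))\<bar> \<le> \<bar>\<alpha> i\<bar> * r"
      unfolding ei right_diff_distrib[symmetric] abs_mult by (simp add: mult_left_mono)
    then show ?thesis using chi01[of i n] False by auto
  qed simp
  \<comment> \<open>All activity changes of one neuron have the same sign, so their absolute values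
    telescope too: each neuron crosses at most once.\<close>
  have count: "(\<Sum>n<N. \<bar>cr i n\<bar>) = \<bar>of_bool (act i N) - of_bool (act i 0)\<bar>" for i
  proof -
    have tele: "(\<Sum>n<N. cr i n) = of_bool (act i N) - of_bool (act i 0)"
      unfolding cr_def by (rule sum_lessThan_telescope)
    have "(\<Sum>n<N. cr i n) = sgn (\<alpha> i) * (\<Sum>n<N. \<bar>cr i n\<bar>)"
      unfolding sum_distrib_left by (rule sum.cong[OF refl]) (rule sgn)
    moreover have "\<alpha> i = 0 \<Longrightarrow> (\<Sum>n<N. \<bar>cr i n\<bar>) = 0"
    proof -
      assume a: "\<alpha> i = 0"
      have "\<bar>cr i n\<bar> = 0" for n using sgn[of i n] a by simp
      then show ?thesis by simp
    qed
    ultimately have "(\<Sum>n<N. \<bar>cr i n\<bar>) = \<bar>\<Sum>n<N. cr i n\<bar>"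
      by (cases "\<alpha> i = 0") (simp_all add: abs_mult sum_nonneg)
    then show ?thesis by (simp only: tele)
  qed
  have act0: "act i 0 \<longleftrightarrow> \<alpha> i < 0" if "cr i n \<noteq> 0" "n < N" for i n
  proof -
    have "\<bar>cr i n\<bar> \<le> (\<Sum>n<N. \<bar>cr i n\<bar>)" using that by (intro member_le_sum) auto
    then have ne: "act i N \<noteq> act i 0" using that(1) chi01[of i n] unfolding count by (auto simp: of_bool_def split: if_splits)
    have "dot d (w i) (P N) = dot d (w i) (P 0) + (real N * r) * \<alpha> i"
      by (simp add: dP t_def \<alpha>_def algebra_simps)
    moreover have "0 \<le> real N * r" using pos by simp
    moreover have "\<alpha> i \<noteq> 0" using between(3)[OF that(1)] .
    ultimately show ?thesis using ne unfolding act_def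
      by (smt (verit) mult_nonneg_nonneg mult_nonneg_nonpos)
  qed
  \<comment> \<open>A neuron with the same activity at both ends \<open>-T\<close> and
    \<open>T\<close> crosses outside the scanned range, and then \<open>crossing\<close> leaves only
    the alternative of a weight of norm at most \<open>\<kappa>\<close>.\<close>
  have rest: "\<bar>e i - (\<Sum>n<N. \<bar>cr i n\<bar> * e i)\<bar> \<le> \<kappa> * (vnorm d x + V)" if i: "i < k" for i
  proof (cases "act i N = act i 0")
    case False
    then have "(\<Sum>n<N. \<bar>cr i n\<bar>) = 1" by (auto simp: count)
    then have "(\<Sum>n<N. \<bar>cr i n\<bar> * e i) = e i" by (simp add: sum_distrib_right[symmetric])
    then show ?thesis using pos by (simp add: vnorm_nonneg)
  next
    case True
    then have s0: "(\<Sum>n<N. \<bar>cr i n\<bar> * e i) = 0" by (simp add: sum_distrib_right[symmetric] count)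
    have e0: "t 0 = - T" "t N = T" by (simp_all add: t_def T N)
    have small: "vnorm d (w i) \<le> \<kappa>"
    proof (rule ccontr)
      assume "\<not> vnorm d (w i) \<le> \<kappa>"
      with crossing[OF i] pos have cr: "\<bar>b i - dot d (w i) p\<bar> \<le> T * \<bar>\<alpha> i\<bar>"
        and n: "vnorm d (w i) > 0" by auto
      have hn: "h * vnorm d (w i) \<ge> 0" using pos by (simp add: vnorm_nonneg)
      have "\<bar>dot d (w i) p - T * \<alpha> i - b i\<bar> > 0" "\<bar>dot d (w i) p + T * \<alpha> i - b i\<bar> > 0"
        using exact[OF i _ n, of 0] exact[OF i _ n, of N] hn
        unfolding P_def[symmetric] dP alf e0 by auto
      moreover have "T * \<bar>\<alpha> i\<bar> = T * \<alpha> i \<or> T * \<bar>\<alpha> i\<bar> = - (T * \<alpha> i)"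
        by (auto simp: abs_if)
      ultimately show False using True cr
        unfolding act_def dP alf e0 by auto
    qed
    \<comment> \<open>The grid point of index \<open>mid\<close> is \<open>p\<close>. An affine
      function with equal activity at both ends has that activity at the midpoint, so the one-sided
      part vanishes at \<open>p\<close> and is bounded by the variation of the neuron between
      \<open>p\<close> and \<open>x\<close>.\<close>
    have midact: "act i mid = act i 0"
    proof -
      have "dot d (w i) (P mid) = dot d (w i) p" by (simp add: dP t_def T)
      moreover have "T * \<alpha> i \<ge> 0 \<or> T * \<alpha> i \<le> 0" by linarith
      ultimately show ?thesis using True
        unfolding act_def dP alf e0 by auto
    qed
    have "\<bar>e i\<bar> \<le> \<bar>dot d (w i) x - dot d (w i) (P mid)\<bar>"
      using midact unfolding e_def act_def by (auto simp: relu_def max_def)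
    also have "\<dots> = \<bar>dot d (w i) (\<lambda>j. x j - p j)\<bar>"
      by (simp add: dP t_def T dot_diff_right)
    also have "\<dots> \<le> vnorm d (w i) * vnorm d (\<lambda>j. x j - p j)" by (rule abs_dot_le)
    also have "\<dots> \<le> \<kappa> * (vnorm d x + V)"
      using small V(1) vnorm_diff_le[of x p d] pos
      by (intro mult_mono) (auto simp: vnorm_nonneg)
    finally show ?thesis by (simp add: s0)
  qed
  have affine: "F (P 0) + dot d (grid_grad d F T r h p v 0) (\<lambda>j. x j - P 0 j)
      = (\<Sum>i<k. s i * (of_bool (act i 0) * (dot d (w i) x - b i)))"
  proof -
    have "dot d (grid_grad d F T r h p v 0) (\<lambda>j. x j - P 0 j)
        = dot d (\<lambda>j. \<Sum>i<k. (s i * of_bool (act i 0)) * w i j) (\<lambda>j. x j - P 0 j)"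
      by (rule dot_cong) (simp_all add: grad)
    also have "\<dots> = (\<Sum>i<k. (s i * of_bool (act i 0)) * (dot d (w i) x - dot d (w i) (P 0)))"
      by (simp only: dot_sum_left dot_diff_right)
    finally show ?thesis
      unfolding F_def neuron_sum_def act_def
      by (simp add: sum.distrib[symmetric])
        (intro sum.cong, auto simp: relu_def max_def algebra_simps)
  qed
  define A where "A n = (\<Sum>i<k. c n i * relu (dot d (z i) (\<lambda>j. x j - P n j)))" for n
  define K where "K n = (\<Sum>i<k. c n i)
      * relu (dot d (\<lambda>l. \<Sum>i<k. c n i * z i l) (\<lambda>j. x j - P n j) / (\<Sum>i<k. c n i))" for n
  have "F x - relu_network d (scan_net d F N T r h p v) x = (\<Sum>i<k. s i * e i) - (\<Sum>n<N. K n)"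
  proof -
    have "relu_network d (scan_net d F N T r h p v) x
        = (F (P 0) + dot d (grid_grad d F T r h p v 0) (\<lambda>j. x j - P 0 j)) + (\<Sum>n<N. K n)"
      unfolding relu_network_scan_net P_def[symmetric] K_def
      by (intro arg_cong2[where f="(+)"] refl sum.cong) (simp_all add: kink[unfolded P_def[symmetric]])
    moreover have "F x = (\<Sum>i<k. s i * e i) + (\<Sum>i<k. s i * (of_bool (act i 0) * (dot d (w i) x - b i)))"
      unfolding F_def neuron_sum_def sum.distrib[symmetric]
      by (intro sum.cong refl) (simp add: e_def algebra_simps)
    ultimately show ?thesis by (simp add: affine)
  qed
  also have "\<dots> = (\<Sum>i<k. s i * (e i - (\<Sum>n<N. \<bar>cr i n\<bar> * e i)))
      + (\<Sum>n<N. (\<Sum>i<k. s i * (\<bar>cr i n\<bar> * e i)) - A n) + (\<Sum>n<N. A n - K n)"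
  proof -
    have "(\<Sum>i<k. s i * (\<Sum>n<N. \<bar>cr i n\<bar> * e i)) = (\<Sum>n<N. \<Sum>i<k. s i * (\<bar>cr i n\<bar> * e i))"
      unfolding sum_distrib_left by (rule sum.swap)
    then show ?thesis by (simp add: right_diff_distrib sum_subtractf)
  qed
  \<comment> \<open>Three sources of error: neurons that do not cross, kinks moved to a grid point,
    and neurons merged within a cell.\<close>
  finally have split: "F x - relu_network d (scan_net d F N T r h p v) x
    = (\<Sum>i<k. s i * (e i - (\<Sum>n<N. \<bar>cr i n\<bar> * e i)))
      + (\<Sum>n<N. (\<Sum>i<k. s i * (\<bar>cr i n\<bar> * e i)) - A n) + (\<Sum>n<N. A n - K n)" .
  have b1: "\<bar>\<Sum>i<k. s i * (e i - (\<Sum>n<N. \<bar>cr i n\<bar> * e i))\<bar> \<le> real k * (\<kappa> * (vnorm d x + V))"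
  proof -
    have "\<bar>\<Sum>i<k. s i * (e i - (\<Sum>n<N. \<bar>cr i n\<bar> * e i))\<bar>
        \<le> (\<Sum>i<k. 1 * (\<kappa> * (vnorm d x + V)))"
    proof (intro order_trans[OF sum_abs] sum_mono)
      fix i assume "i \<in> {..<k}"
      then show "\<bar>s i * (e i - (\<Sum>n<N. \<bar>cr i n\<bar> * e i))\<bar> \<le> 1 * (\<kappa> * (vnorm d x + V))"
        unfolding abs_mult using s[of i] rest[of i] by (intro mult_mono) auto
    qed
    then show ?thesis by simp
  qed
  have cabs: "\<bar>c n i\<bar> \<le> \<bar>cr i n\<bar> * \<bar>\<alpha> i\<bar>" if "i < k" for n i
    using s[OF that] unfolding c_def abs_mult by (simp add: mult_left_le_one_le)
  have alphaV: "\<bar>\<alpha> i\<bar> \<le> R * V" if "i < k" for i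
    unfolding \<alpha>_def using w[OF that] V pos
    by (intro order_trans[OF abs_dot_le] mult_mono) (auto simp: vnorm_nonneg)
  \<comment> \<open>Since each neuron crosses at most once, the total weight over all cells is
    bounded independently of \<open>N\<close>; refining the grid does not accumulate error.\<close>
  have total: "(\<Sum>n<N. \<Sum>i<k. \<bar>cr i n\<bar> * \<bar>\<alpha> i\<bar>) \<le> real k * (R * V)"
  proof -
    have "(\<Sum>n<N. \<Sum>i<k. \<bar>cr i n\<bar> * \<bar>\<alpha> i\<bar>) = (\<Sum>i<k. (\<Sum>n<N. \<bar>cr i n\<bar>) * \<bar>\<alpha> i\<bar>)"
      unfolding sum_distrib_right by (rule sum.swap)
    also have "\<dots> \<le> (\<Sum>i<k. 1 * (R * V))"
      using alphaV by (intro sum_mono mult_mono) (auto simp: count)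
    finally show ?thesis by simp
  qed
  have b2: "\<bar>\<Sum>n<N. (\<Sum>i<k. s i * (\<bar>cr i n\<bar> * e i)) - A n\<bar> \<le> real k * (R * V) * r"
  proof -
    have "\<bar>(\<Sum>i<k. s i * (\<bar>cr i n\<bar> * e i)) - A n\<bar> \<le> (\<Sum>i<k. \<bar>cr i n\<bar> * \<bar>\<alpha> i\<bar> * r)" if "n < N" for n
    proof -
      have "(\<Sum>i<k. s i * (\<bar>cr i n\<bar> * e i)) - A n = (\<Sum>i<k. s i * (\<bar>cr i n\<bar> * e i
          - \<bar>cr i n\<bar> * (\<bar>\<alpha> i\<bar> * relu (dot d (z i) (\<lambda>j. x j - P n j)))))"
        by (simp add: A_def c_def sum_subtractf right_diff_distrib mult_ac)
      also have "\<bar>\<dots>\<bar> \<le> (\<Sum>i<k. 1 * (\<bar>cr i n\<bar> * \<bar>\<alpha> i\<bar> * r))"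
      proof (intro order_trans[OF sum_abs] sum_mono)
        fix i assume "i \<in> {..<k}"
        then show "\<bar>s i * (\<bar>cr i n\<bar> * e i
            - \<bar>cr i n\<bar> * (\<bar>\<alpha> i\<bar> * relu (dot d (z i) (\<lambda>j. x j - P n j))))\<bar>
            \<le> 1 * (\<bar>cr i n\<bar> * \<bar>\<alpha> i\<bar> * r)"
          unfolding abs_mult[of "s i"] using s[of i] shift[OF act0[OF _ that], of i]
          by (intro mult_mono) auto
      qed
      finally show ?thesis by simp
    qed
    then have "\<bar>\<Sum>n<N. (\<Sum>i<k. s i * (\<bar>cr i n\<bar> * e i)) - A n\<bar>
        \<le> (\<Sum>n<N. \<Sum>i<k. \<bar>cr i n\<bar> * \<bar>\<alpha> i\<bar> * r)"
      by (intro order_trans[OF sum_abs] sum_mono) auto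
    also have "\<dots> = (\<Sum>n<N. \<Sum>i<k. \<bar>cr i n\<bar> * \<bar>\<alpha> i\<bar>) * r" by (simp add: sum_distrib_right)
    also have "\<dots> \<le> real k * (R * V) * r" using total pos by (intro mult_right_mono) auto
    finally show ?thesis .
  qed
  have b3: "\<bar>\<Sum>n<N. A n - K n\<bar> \<le> 2 * \<rho> * nx * (real k * (R * V))"
  proof -
    have "\<bar>\<Sum>n<N. A n - K n\<bar> \<le> (\<Sum>n<N. 2 * \<rho> * nx * (\<Sum>i<k. \<bar>cr i n\<bar> * \<bar>\<alpha> i\<bar>))"
    proof (intro order_trans[OF sum_abs] sum_mono)
      fix n assume "n \<in> {..<N}"
      then have "\<bar>A n - K n\<bar> \<le> 2 * \<rho> * nx * (\<Sum>i<k. \<bar>c n i\<bar>)"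
        unfolding A_def K_def by (intro merge) simp
      also have "\<dots> \<le> 2 * \<rho> * nx * (\<Sum>i<k. \<bar>cr i n\<bar> * \<bar>\<alpha> i\<bar>)"
        using pos nx0 by (intro mult_left_mono sum_mono cabs) auto
      finally show "\<bar>A n - K n\<bar> \<le> 2 * \<rho> * nx * (\<Sum>i<k. \<bar>cr i n\<bar> * \<bar>\<alpha> i\<bar>)" .
    qed
    also have "\<dots> = 2 * \<rho> * nx * (\<Sum>n<N. \<Sum>i<k. \<bar>cr i n\<bar> * \<bar>\<alpha> i\<bar>)"
      by (simp add: sum_distrib_left)
    also have "\<dots> \<le> 2 * \<rho> * nx * (real k * (R * V))"
      using total pos nx0 by (intro mult_left_mono) auto
    finally show ?thesis .
  qed
  have "real k * (R * V * (r + 2 * \<rho> * nx)) = real k * (R * V) * r + 2 * \<rho> * nx * (real k * (R * V))"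
    by (simp add: algebra_simps)
  then show ?thesis unfolding split nx_def[symmetric] using b1 b2 b3 by linarith
qed

section \<open>A crude error bound for every line\<close>

lemma neuron_sum_lipschitz:
  assumes s: "\<And>i. i < k \<Longrightarrow> \<bar>s i\<bar> \<le> 1" and w: "\<And>i. i < k \<Longrightarrow> vnorm d (w i) \<le> R" and "0 \<le> R"
  shows "\<bar>neuron_sum d k s w b x - neuron_sum d k s w b y\<bar> \<le> real k * R * vnorm d (\<lambda>j. x j - y j)"
proof -
  have "\<bar>neuron_sum d k s w b x - neuron_sum d k s w b y\<bar>
      = \<bar>\<Sum>i<k. s i * (relu (dot d (w i) x - b i) - relu (dot d (w i) y - b i))\<bar>"
    by (simp add: neuron_sum_def sum_subtractf right_diff_distrib)
  also have "\<dots> \<le> (\<Sum>i<k. 1 * (R * vnorm d (\<lambda>j. x j - y j)))"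
  proof (rule order_trans[OF sum_abs], rule sum_mono)
    fix i assume "i \<in> {..<k}"
    then have i: "i < k" by simp
    have "\<bar>relu (dot d (w i) x - b i) - relu (dot d (w i) y - b i)\<bar> \<le> \<bar>dot d (w i) (\<lambda>j. x j - y j)\<bar>"
      unfolding dot_diff_right by (rule order_trans[OF relu_diff_le]) simp
    also have "\<dots> \<le> R * vnorm d (\<lambda>j. x j - y j)"
      by (rule order_trans[OF abs_dot_le]) (intro mult_right_mono w i vnorm_nonneg)
    finally show "\<bar>s i * (relu (dot d (w i) x - b i) - relu (dot d (w i) y - b i))\<bar>
        \<le> 1 * (R * vnorm d (\<lambda>j. x j - y j))"
      unfolding abs_mult using s[OF i] by (intro mult_mono) auto
  qed
  finally show ?thesis by simp
qed

text \<open>This holds on good and bad lines alike and controls the points at which an accepted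
  candidate still fails. The Lipschitz constant of \<open>F\<close> bounds every difference
  quotient. In a kink the factor \<open>jump_slope\<close> cancels against the division by it, so a
  slope close to \<open>0\<close> does no harm. The price is the factor \<open>N\<close>.\<close>

lemma scan_net_error_crude:
  fixes d k :: nat and s b :: "nat \<Rightarrow> real" and w :: "nat \<Rightarrow> vec" and p v :: vec
  assumes pos: "0 < h" "0 < r" "0 \<le> R" "0 \<le> V" "T = real mid * r" "N = 2 * mid"
    and s: "\<And>i. i < k \<Longrightarrow> \<bar>s i\<bar> \<le> 1" and w: "\<And>i. i < k \<Longrightarrow> vnorm d (w i) \<le> R"
    and V: "vnorm d p \<le> V" "vnorm d v \<le> V"
  defines "F \<equiv> neuron_sum d k s w b"
  shows "\<bar>F x - relu_network d (scan_net d F N T r h p v) x\<bar>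
    \<le> (real k * R + real d * (real k * R) + real N * (2 * real d * (real k * R)))
        * (vnorm d x + V + T * V)"
proof -
  define P where "P = grid_point d T r p v"
  define nx where "nx = vnorm d x + V + T * V"
  have T0: "0 \<le> T" using pos by simp
  have dist: "vnorm d (\<lambda>j. x j - P n j) \<le> nx" if "n \<le> N" for n
  proof -
    have "real n * r \<le> real N * r" using that pos by simp
    then have tT: "\<bar>real n * r - T\<bar> \<le> T" using pos by (simp add: abs_le_iff)
    have "vnorm d (\<lambda>j. x j - P n j) \<le> vnorm d x + vnorm d (P n)" by (rule vnorm_diff_le)
    also have "vnorm d (P n) = vnorm d (\<lambda>j. p j - (- (real n * r - T)) * v j)"
      by (rule vnorm_cong) (simp add: P_def grid_point_def algebra_simps)
    also have "\<dots> \<le> vnorm d p + \<bar>real n * r - T\<bar> * vnorm d v"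
      using vnorm_diff_le[of p "\<lambda>j. (- (real n * r - T)) * v j" d] by (simp only: vnorm_scale abs_minus_cancel)
    also have "\<dots> \<le> V + T * V" using V tT T0
      by (intro add_mono mult_mono) (auto simp: vnorm_nonneg)
    finally show ?thesis by (simp add: nx_def)
  qed
  have lip: "\<bar>F x - F y\<bar> \<le> real k * R * vnorm d (\<lambda>j. x j - y j)" for x y
    unfolding F_def by (rule neuron_sum_lipschitz[OF s w pos(3)])
  have grad: "\<bar>grid_grad d F T r h p v n j\<bar> \<le> real k * R" if "j < d" for n j
  proof -
    let ?y = "grid_point d T r p v n"
    have "vnorm d (\<lambda>l. (?y(j := ?y j + h)) l - ?y l) = h"
    proof -
      have "(\<Sum>l<d. ((?y(j := ?y j + h)) l - ?y l)\<^sup>2) = (\<Sum>l<d. if l = j then h\<^sup>2 else 0)"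
        by (rule sum.cong) auto
      then show ?thesis using that pos(1) by (simp add: L2_set_def)
    qed
    then have "\<bar>F (?y(j := ?y j + h)) - F ?y\<bar> \<le> real k * R * h" using lip by metis
    then show ?thesis using that pos(1) by (simp add: grid_grad_def diff_quot_def field_simps)
  qed
  have dotb: "\<bar>dot d g (\<lambda>j. x j - P n j)\<bar> \<le> real d * C * nx"
    if g: "\<And>j. j < d \<Longrightarrow> \<bar>g j\<bar> \<le> C" and n: "n \<le> N" for g C n
  proof -
    have "\<bar>dot d g (\<lambda>j. x j - P n j)\<bar> \<le> (\<Sum>j<d. C * nx)"
      unfolding dot_def
    proof (rule order_trans[OF sum_abs], rule sum_mono)
      fix j assume "j \<in> {..<d}"
      then show "\<bar>g j * (x j - P n j)\<bar> \<le> C * nx"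
        unfolding abs_mult using g[of j] dist[OF n] abs_component_le[of j d "\<lambda>j. x j - P n j"]
        by (intro mult_mono) (auto intro: order_trans[OF abs_ge_zero])
    qed
    then show ?thesis by simp
  qed
  define K where "K n = jump_slope d F T r h p v n *
          relu (dot d (grad_jump d F T r h p v n) (\<lambda>j. x j - P n j) / jump_slope d F T r h p v n)" for n
  have K: "\<bar>K n\<bar> \<le> real d * (2 * (real k * R)) * nx" if "n < N" for n
  proof -
    have "\<bar>K n\<bar> \<le> \<bar>jump_slope d F T r h p v n\<bar> *
        \<bar>dot d (grad_jump d F T r h p v n) (\<lambda>j. x j - P n j) / jump_slope d F T r h p v n\<bar>"
      unfolding K_def abs_mult by (intro mult_left_mono relu_le_abs) simp
    also have "\<dots> \<le> \<bar>dot d (grad_jump d F T r h p v n) (\<lambda>j. x j - P n j)\<bar>"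
      by (cases "jump_slope d F T r h p v n = 0") simp_all
    also have "\<dots> \<le> real d * (2 * (real k * R)) * nx"
    proof (rule dotb)
      fix j assume "j < d"
      then show "\<bar>grad_jump d F T r h p v n j\<bar> \<le> 2 * (real k * R)"
        using grad[of j n] grad[of j "Suc n"] by (simp add: grad_jump_def)
    qed (use that in simp)
    finally show ?thesis .
  qed
  have "\<bar>F x - relu_network d (scan_net d F N T r h p v) x\<bar>
      \<le> \<bar>F x - F (P 0)\<bar> + \<bar>dot d (grid_grad d F T r h p v 0) (\<lambda>j. x j - P 0 j)\<bar> + (\<Sum>n<N. \<bar>K n\<bar>)"
    unfolding relu_network_scan_net P_def[symmetric] K_def[symmetric]
    using sum_abs[of K "{..<N}"] by linarith
  also have "\<dots> \<le> real k * R * nx + real d * (real k * R) * nx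
      + (\<Sum>n<N. real d * (2 * (real k * R)) * nx)"
    using lip[of x "P 0"] dist[of 0] dotb[of "grid_grad d F T r h p v 0" "real k * R" 0] grad K pos(3)
    by (intro add_mono sum_mono) (auto intro: order_trans[OF _ mult_left_mono])
  finally show ?thesis by (simp add: nx_def algebra_simps)
qed

section \<open>Gaussian vectors\<close>

text \<open>Fubini with all coordinates but \<open>i\<close> frozen. It is used at two levels: for
  one scalar coordinate of a Gaussian vector, and for one of the two vectors \<open>p\<close> and
  \<open>v\<close> of a round.\<close>

lemma emeasure_PiM_slice_le:
  assumes M: "\<And>j. j \<in> I \<Longrightarrow> prob_space (M j)" and i: "i \<in> I" and A: "A \<in> sets (PiM I M)"
    and slice: "\<And>x. emeasure (M i) {y \<in> space (M i). x(i := y) \<in> A} \<le> c"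
  shows "emeasure (PiM I M) A \<le> c"
proof -
  let ?J = "I - {i}"
  have I: "insert i ?J = I" using i by auto
  interpret J: prob_space "PiM ?J M" using M by (intro prob_space_PiM) auto
  interpret i: prob_space "M i" using M i by auto
  interpret P: pair_sigma_finite "M i" "PiM ?J M" ..
  have D: "distr (M i \<Otimes>\<^sub>M PiM ?J M) (PiM I M) (\<lambda>(x, X). X(i := x)) = PiM I M"
    using distr_pair_PiM_eq_PiM[of ?J M i] M i I by auto
  have meas: "(\<lambda>(x, X). X(i := x)) \<in> measurable (M i \<Otimes>\<^sub>M PiM ?J M) (PiM I M)"
    using measurable_add_dim[of i ?J M] I
    by (simp add: measurable_pair_swap_iff[of _ "M i"] split_beta')
  let ?B = "(\<lambda>(x, X). X(i := x)) -` A \<inter> space (M i \<Otimes>\<^sub>M PiM ?J M)"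
  have B: "?B \<in> sets (M i \<Otimes>\<^sub>M PiM ?J M)" using meas A by (rule measurable_sets)
  have "emeasure (PiM I M) A = emeasure (M i \<Otimes>\<^sub>M PiM ?J M) ?B"
    using emeasure_distr[OF meas A] unfolding D .
  also have "\<dots> = (\<integral>\<^sup>+y. emeasure (M i) ((\<lambda>x. (x, y)) -` ?B) \<partial>PiM ?J M)"
    by (rule P.emeasure_pair_measure_alt2[OF B])
  also have "\<dots> \<le> (\<integral>\<^sup>+y. c \<partial>PiM ?J M)"
  proof (rule nn_integral_mono)
    fix y assume "y \<in> space (PiM ?J M)"
    then have "(\<lambda>x. (x, y)) -` ?B = {z \<in> space (M i). y(i := z) \<in> A}"
      by (auto simp: space_pair_measure)
    then show "emeasure (M i) ((\<lambda>x. (x, y)) -` ?B) \<le> c" using slice[of y] by simp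
  qed
  also have "\<dots> = c" by (simp add: J.emeasure_space_1)
  finally show ?thesis .
qed

text \<open>The value \<open>1 / 2\<close> cancels the factor \<open>2\<close> in the length of the
  interval of the small ball bound below.\<close>

lemma std_normal_density_le_half: "std_normal_density x \<le> 1 / 2"
proof -
  have "2 \<le> sqrt (2 * pi)" using pi_gt3 by (intro real_le_rsqrt) auto
  then have "1 / sqrt (2 * pi) \<le> 1 / 2" by (intro divide_left_mono) auto
  moreover have "exp (- x\<^sup>2 / 2) \<le> 1" by simp
  ultimately have "1 / sqrt (2 * pi) * exp (- x\<^sup>2 / 2) \<le> 1 / 2 * 1"
    by (intro mult_mono) auto
  then show ?thesis by (simp add: std_normal_density_def)
qed

lemma std_normal_small_ball:
  assumes "a \<noteq> 0" "0 \<le> r"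
  shows "emeasure std_normal_distribution {y. \<bar>a * y + c\<bar> \<le> r} \<le> ennreal (r / \<bar>a\<bar>)"
proof -
  let ?I = "{- c / a - r / \<bar>a\<bar> .. - c / a + r / \<bar>a\<bar>}"
  have eq: "{y. \<bar>a * y + c\<bar> \<le> r} \<subseteq> ?I"
  proof
    fix y assume "y \<in> {y. \<bar>a * y + c\<bar> \<le> r}"
    moreover have "\<bar>a * y + c\<bar> = \<bar>a\<bar> * \<bar>y + c / a\<bar>"
      using assms by (simp add: abs_mult[symmetric] distrib_left)
    ultimately have "\<bar>y + c / a\<bar> \<le> r / \<bar>a\<bar>" using assms by (simp add: field_simps)
    then show "y \<in> ?I" by auto
  qed
  have "emeasure std_normal_distribution {y. \<bar>a * y + c\<bar> \<le> r} \<le> emeasure std_normal_distribution ?I"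
    by (rule emeasure_mono[OF eq]) simp
  also have "\<dots> = (\<integral>\<^sup>+x. ennreal (std_normal_density x) * indicator ?I x \<partial>lborel)"
    by (simp add: emeasure_density)
  also have "\<dots> \<le> (\<integral>\<^sup>+x. ennreal (1/2) * indicator ?I x \<partial>lborel)"
    by (intro nn_integral_mono mult_right_mono ennreal_leI std_normal_density_le_half) simp
  also have "\<dots> = ennreal (1/2) * ennreal (2 * (r / \<bar>a\<bar>))"
    using assms by (simp add: nn_integral_cmult_indicator emeasure_lborel_Icc)
  also have "\<dots> = ennreal (r / \<bar>a\<bar>)"
    using assms by (subst ennreal_mult[symmetric]) auto
  finally show ?thesis .
qed

lemma prob_space_std_normal: "prob_space std_normal_distribution"
  by (rule prob_space_normal_density) simp

lemma prob_space_std_normal_vec: "prob_space (std_normal_vec d)"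
  unfolding std_normal_vec_def by (intro prob_space_PiM prob_space_std_normal)

lemma space_std_normal_vec: "space (std_normal_vec d) = {..<d} \<rightarrow>\<^sub>E UNIV"
  by (simp add: std_normal_vec_def space_PiM)

lemma measurable_std_normal_vec_component:
  "j < d \<Longrightarrow> (\<lambda>x. x j) \<in> borel_measurable (std_normal_vec d)"
  unfolding std_normal_vec_def
  using measurable_component_singleton[of j "{..<d}" "\<lambda>_. std_normal_distribution"] by simp

lemma measurable_dot:
  assumes "\<And>j. j < d \<Longrightarrow> (\<lambda>\<omega>. u \<omega> j) \<in> borel_measurable M" "\<And>j. j < d \<Longrightarrow> (\<lambda>\<omega>. x \<omega> j) \<in> borel_measurable M"
  shows "(\<lambda>\<omega>. dot d (u \<omega>) (x \<omega>)) \<in> borel_measurable M"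
  unfolding dot_def using assms by (intro borel_measurable_sum borel_measurable_times) auto

lemma measurable_vnorm:
  assumes "\<And>j. j < d \<Longrightarrow> (\<lambda>\<omega>. x \<omega> j) \<in> borel_measurable M"
  shows "(\<lambda>\<omega>. vnorm d (x \<omega>)) \<in> borel_measurable M"
  unfolding L2_set_def using assms
  by (intro borel_measurable_sqrt[THEN measurable_compose_rev] borel_measurable_sum borel_measurable_power) auto

lemma vnorm_le_component:
  assumes "vnorm d a > 0"
  shows "\<exists>j<d. vnorm d a \<le> real d * \<bar>a j\<bar>"
proof (rule ccontr)
  assume "\<not> ?thesis"
  then have lt: "\<And>j. j < d \<Longrightarrow> real d * \<bar>a j\<bar> < vnorm d a" by (auto simp: not_le)
  have "0 < d" using assms by (cases d) auto
  have "vnorm d a \<le> (\<Sum>j<d. \<bar>a j\<bar>)"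
    using L2_set_le_sum_abs by blast
  also have "real d * (\<Sum>j<d. \<bar>a j\<bar>) < (\<Sum>j<d. vnorm d a)"
    unfolding sum_distrib_left using lt \<open>0 < d\<close> by (intro sum_strict_mono) auto
  ultimately show False using \<open>0 < d\<close> by (simp add: mult_left_mono[THEN leD])
qed

text \<open>The randomness of a single coordinate is exploited, one whose coefficient has at least
  the share \<open>1 / d\<close> of the norm. Rotation invariance would give the bound without the
  factor \<open>d\<close>, but a polynomial loss is affordable.\<close>

lemma std_normal_vec_small_ball:
  assumes a: "vnorm d a > 0" and r: "0 \<le> r"
  shows "emeasure (std_normal_vec d) {x \<in> space (std_normal_vec d). \<bar>dot d a x + c\<bar> \<le> r}
    \<le> ennreal (r * real d / vnorm d a)"
proof -
  obtain j where j: "j < d" and le: "vnorm d a \<le> real d * \<bar>a j\<bar>"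
    using vnorm_le_component[OF a] by auto
  have aj: "a j \<noteq> 0" using a le by auto
  have d: "0 < real d" using j by simp
  have bound: "r / \<bar>a j\<bar> \<le> r * real d / vnorm d a"
  proof -
    have "r * vnorm d a \<le> r * (real d * \<bar>a j\<bar>)" by (intro mult_left_mono le r)
    then show ?thesis using a aj by (simp add: field_simps)
  qed
  let ?A = "{x \<in> space (std_normal_vec d). \<bar>dot d a x + c\<bar> \<le> r}"
  have meas: "?A \<in> sets (std_normal_vec d)"
  proof -
    have [measurable]: "(\<lambda>x. dot d a x) \<in> borel_measurable (std_normal_vec d)"
      by (rule measurable_dot) (auto intro: measurable_std_normal_vec_component)
    show ?thesis by measurable
  qed
  have "emeasure (std_normal_vec d) ?A \<le> ennreal (r / \<bar>a j\<bar>)"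
    unfolding std_normal_vec_def
  proof (rule emeasure_PiM_slice_le[where i=j])
    fix x :: vec
    have "emeasure std_normal_distribution
        {y \<in> space std_normal_distribution. x(j := y) \<in> {x \<in> space (\<Pi>\<^sub>M j\<in>{..<d}. std_normal_distribution). \<bar>dot d a x + c\<bar> \<le> r}}
      \<le> emeasure std_normal_distribution {y. \<bar>a j * y + (dot d a x - a j * x j + c)\<bar> \<le> r}"
      by (rule emeasure_mono) (auto simp: dot_upd[OF j] algebra_simps)
    also have "\<dots> \<le> ennreal (r / \<bar>a j\<bar>)" by (rule std_normal_small_ball[OF aj r])
    finally show "emeasure std_normal_distribution
        {y \<in> space std_normal_distribution. x(j := y) \<in> {x \<in> space (\<Pi>\<^sub>M j\<in>{..<d}. std_normal_distribution). \<bar>dot d a x + c\<bar> \<le> r}}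
      \<le> ennreal (r / \<bar>a j\<bar>)" .
  qed (use j meas in \<open>auto simp: prob_space_std_normal std_normal_vec_def\<close>)
  also have "\<dots> \<le> ennreal (r * real d / vnorm d a)" using bound by (rule ennreal_leI)
  finally show ?thesis .
qed

section \<open>Gaussian moments\<close>

lemma nn_integral_std_normal_vec_component:
  assumes "j < d" "f \<in> borel_measurable borel"
  shows "(\<integral>\<^sup>+x. f (x j) \<partial>std_normal_vec d) = (\<integral>\<^sup>+y. f y \<partial>std_normal_distribution)"
proof -
  interpret product_prob_space "\<lambda>_. std_normal_distribution" "{..<d}"
    using prob_space_std_normal
    by (simp add: product_prob_space_def product_prob_space_axioms_def product_sigma_finite_def prob_space_imp_sigma_finite)
  have "(\<integral>\<^sup>+y. f y \<partial>distr (PiM {..<d} (\<lambda>_. std_normal_distribution)) std_normal_distribution (\<lambda>\<omega>. \<omega> j))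
    = (\<integral>\<^sup>+x. f (x j) \<partial>std_normal_vec d)"
    unfolding std_normal_vec_def using assms
    by (intro nn_integral_distr measurable_component_singleton) auto
  then show ?thesis using PiM_component[of j] assms(1) by simp
qed

lemma std_normal_even_moment:
  "(\<integral>\<^sup>+y. ennreal (y ^ (2 * n)) \<partial>std_normal_distribution) = ennreal (fact (2 * n) / (2 ^ n * fact n))"
  by (subst nn_integral_eq_integral)
    (auto simp: integrable_std_normal_distribution_moment std_normal_distribution_even_moments zero_le_even_power)

lemma std_normal_vec_second_moment:
  "(\<integral>\<^sup>+x. ennreal (\<Sum>j<d. (x j)\<^sup>2) \<partial>std_normal_vec d) = of_nat d"
proof -
  have [measurable]: "(\<lambda>x. x j) \<in> borel_measurable (std_normal_vec d)" if "j \<in> {..<d}" for j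
    using that by (intro measurable_std_normal_vec_component) simp
  have "(\<integral>\<^sup>+x. ennreal (\<Sum>j<d. (x j)\<^sup>2) \<partial>std_normal_vec d)
      = (\<Sum>j<d. \<integral>\<^sup>+x. ennreal ((x j)\<^sup>2) \<partial>std_normal_vec d)"
    by (subst nn_integral_sum[symmetric]) auto
  also have "\<dots> = (\<Sum>j<d. 1)"
  proof (rule sum.cong[OF refl])
    fix j assume "j \<in> {..<d}"
    then show "(\<integral>\<^sup>+x. ennreal ((x j)\<^sup>2) \<partial>std_normal_vec d) = 1"
      using std_normal_even_moment[of 1] nn_integral_std_normal_vec_component[of j d "\<lambda>y. ennreal (y\<^sup>2)"]
      by (simp add: fact_2)
  qed
  finally show ?thesis by simp
qed

text \<open>The square of the sum of the \<open>d\<close> squares is at most \<open>d\<close> times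
  the sum of fourth powers, which reduces the claim to the fourth moment \<open>3\<close> of one
  coordinate: \<open>2 + 6 * d^2\<close> is at most \<open>8 * d^2\<close>.\<close>

lemma std_normal_vec_fourth_moment_le:
  assumes "1 \<le> d"
  shows "(\<integral>\<^sup>+x. ennreal ((1 + (\<Sum>j<d. (x j)\<^sup>2))\<^sup>2) \<partial>std_normal_vec d) \<le> ennreal (8 * (real d)\<^sup>2)"
proof -
  interpret prob_space "std_normal_vec d" by (rule prob_space_std_normal_vec)
  have [measurable]: "(\<lambda>x. x j) \<in> borel_measurable (std_normal_vec d)" if "j \<in> {..<d}" for j
    using that by (intro measurable_std_normal_vec_component) simp
  have le: "(1 + (\<Sum>j<d. (x j)\<^sup>2))\<^sup>2 \<le> 2 + 2 * (real d * (\<Sum>j<d. (x j) ^ 4))" for x :: vec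
  proof -
    have "(\<Sum>j<d. (x j)\<^sup>2)\<^sup>2 \<le> (\<Sum>j<d. ((x j)\<^sup>2)\<^sup>2) * real (card {..<d})"
      by (rule sum_squared_le_sum_of_squares)
    moreover have "(1 + a)\<^sup>2 \<le> 2 + 2 * a\<^sup>2" for a :: real
      using sum_squares_bound[of 1 a] by (simp add: power2_sum)
    ultimately show ?thesis
      by (smt (verit) card_lessThan mult.commute power_even_eq power_mult numeral_Bit0 mult_2 sum.cong power2_eq_square power4_eq_xxxx mult.assoc)
  qed
  have "(\<integral>\<^sup>+x. ennreal ((1 + (\<Sum>j<d. (x j)\<^sup>2))\<^sup>2) \<partial>std_normal_vec d)
      \<le> (\<integral>\<^sup>+x. ennreal (2 + 2 * (real d * (\<Sum>j<d. (x j) ^ 4))) \<partial>std_normal_vec d)"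
    by (intro nn_integral_mono ennreal_leI le)
  also have "\<dots> = (\<integral>\<^sup>+x. ennreal 2 + ennreal (2 * real d) * (\<Sum>j<d. ennreal ((x j) ^ 4)) \<partial>std_normal_vec d)"
  proof (rule nn_integral_cong)
    fix x :: vec
    show "ennreal (2 + 2 * (real d * (\<Sum>j<d. (x j) ^ 4))) = ennreal 2 + ennreal (2 * real d) * (\<Sum>j<d. ennreal ((x j) ^ 4))"
      by (subst ennreal_plus, simp, simp add: sum_nonneg, subst sum_ennreal, simp, subst ennreal_mult[symmetric])
        (auto simp: sum_nonneg mult.assoc)
  qed
  also have "\<dots> = ennreal 2 + ennreal (2 * real d) * (\<Sum>j<d. \<integral>\<^sup>+x. ennreal ((x j) ^ 4) \<partial>std_normal_vec d)"
    by (simp add: nn_integral_add nn_integral_cmult nn_integral_sum emeasure_space_1 del: sum_ennreal)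
  also have "(\<Sum>j<d. \<integral>\<^sup>+x. ennreal ((x j) ^ 4) \<partial>std_normal_vec d) = (\<Sum>j<d. ennreal 3)"
  proof (rule sum.cong[OF refl])
    fix j assume "j \<in> {..<d}"
    then show "(\<integral>\<^sup>+x. ennreal ((x j) ^ 4) \<partial>std_normal_vec d) = ennreal 3"
      using std_normal_even_moment[of 2] nn_integral_std_normal_vec_component[of j d "\<lambda>y. ennreal (y ^ 4)"]
      by (simp add: fact_numeral)
  qed
  also have "ennreal 2 + ennreal (2 * real d) * (\<Sum>j<d. ennreal 3) = ennreal (2 + 2 * real d * (real d * 3))"
    by (subst sum_ennreal, simp, subst ennreal_mult[symmetric], simp, simp, subst ennreal_plus[symmetric])
      (simp_all add: mult.assoc)
  also have "\<dots> \<le> ennreal (8 * (real d)\<^sup>2)"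
  proof (rule ennreal_leI)
    have "1 \<le> (real d)\<^sup>2" using assms by simp
    then show "2 + 2 * real d * (real d * 3) \<le> 8 * (real d)\<^sup>2" by (simp add: power2_eq_square)
  qed
  finally show ?thesis .
qed

section \<open>Cutting an independent sequence into blocks\<close>

text \<open>Different blocks read disjoint sets of indices and are therefore independent, and each
  one has the product distribution by reindexing. Applied twice: the scalars of the random sequence
  are cut into vectors of length \<open>d\<close>, and these vectors into rounds.\<close>

lemma distr_PiM_blocks:
  fixes N :: "'a measure" and L :: nat
  assumes N: "prob_space N" and L: "0 < L"
  shows "distr (\<Pi>\<^sub>M i\<in>UNIV. N) (\<Pi>\<^sub>M q\<in>UNIV. \<Pi>\<^sub>M l\<in>{..<L}. N) (\<lambda>\<omega> q. \<lambda>l\<in>{..<L}. \<omega> (q * L + l))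
    = (\<Pi>\<^sub>M q\<in>UNIV. \<Pi>\<^sub>M l\<in>{..<L}. N)"
proof -
  let ?P = "\<Pi>\<^sub>M i\<in>(UNIV::nat set). N"
  interpret N: prob_space N by fact
  interpret P: product_prob_space "\<lambda>_::nat. N" UNIV ..
  define K :: "nat \<Rightarrow> nat set" where "K q = {q * L..<q * L + L}" for q
  have indep: "P.indep_vars (\<lambda>_. N) (\<lambda>i \<omega>. \<omega> i) (UNIV::nat set)"
    by (subst P.indep_vars_iff_distr_eq_PiM') (auto simp: P.PiM_component restrict_UNIV intro!: distr_id[unfolded id_def])
  have disj: "disjoint_family_on K UNIV"
    unfolding disjoint_family_on_def
  proof (intro ballI impI)
    fix q q' :: nat assume "q \<noteq> q'"
    then show "K q \<inter> K q' = {}"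
    proof (induction q q' rule: linorder_wlog)
      case (le a b)
      then have "Suc a * L \<le> b * L" by (intro mult_le_mono1) auto
      then show ?case by (auto simp: K_def)
    qed auto
  qed
  define g where "g q x = (\<lambda>l\<in>{..<L}. x (q * L + l))" for q and x :: "nat \<Rightarrow> 'a"
  have K: "q * L + l \<in> K q" if "l < L" for q l using that by (simp add: K_def)
  have g: "g q \<in> measurable (PiM (K q) (\<lambda>_. N)) (\<Pi>\<^sub>M l\<in>{..<L}. N)" for q
    unfolding g_def by (intro measurable_restrict measurable_component_singleton) (auto intro: K)
  have "P.indep_vars (\<lambda>q. PiM (K q) (\<lambda>_. N)) (\<lambda>q \<omega>. restrict (\<lambda>i. \<omega> i) (K q)) UNIV"
    by (rule P.indep_vars_restrict[OF indep _ disj]) auto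
  then have "P.indep_vars (\<lambda>q. \<Pi>\<^sub>M l\<in>{..<L}. N) (\<lambda>q \<omega>. g q (restrict \<omega> (K q))) UNIV"
    by (rule P.indep_vars_compose2) (rule g)
  moreover have gK: "g q (restrict \<omega> (K q)) = (\<lambda>l\<in>{..<L}. \<omega> (q * L + l))" for q \<omega>
    using K by (auto simp: g_def)
  ultimately have ind: "P.indep_vars (\<lambda>q. \<Pi>\<^sub>M l\<in>{..<L}. N) (\<lambda>q \<omega>. \<lambda>l\<in>{..<L}. \<omega> (q * L + l)) (UNIV::nat set)"
    by simp
  have D: "distr ?P (\<Pi>\<^sub>M l\<in>{..<L}. N) (\<lambda>\<omega>. \<lambda>l\<in>{..<L}. \<omega> (q * L + l)) = (\<Pi>\<^sub>M l\<in>{..<L}. N)" for q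
    by (rule distr_PiM_reindex[where f="\<lambda>l. q * L + l"]) (auto simp: N inj_on_def)
  show ?thesis
    using ind D
    by (subst (asm) P.indep_vars_iff_distr_eq_PiM') (auto simp: restrict_UNIV intro!: measurable_restrict)
qed

section \<open>Good lines\<close>

text \<open>The vectors of index \<open>0\<close> and \<open>1\<close> are the base point and the
  direction of a line, the other \<open>m\<close> are the test points.\<close>

abbreviation round_space :: "nat \<Rightarrow> nat \<Rightarrow> (nat \<Rightarrow> vec) measure" where
  "round_space d m \<equiv> \<Pi>\<^sub>M l\<in>{..<m + 2}. std_normal_vec d"

text \<open>The clauses are the hypotheses of \<open>scan_net_error\<close>, written as negated bad
  events so that the complement is visibly a finite union of events with small probability. The last
  one, with \<open>T\<close> large enough, yields the hypothesis \<open>crossing\<close>.\<close>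

definition good_line ::
    "nat \<Rightarrow> nat \<Rightarrow> (nat \<Rightarrow> vec) \<Rightarrow> (nat \<Rightarrow> real) \<Rightarrow> real \<Rightarrow> real \<Rightarrow> real \<Rightarrow> nat \<Rightarrow>
     real \<Rightarrow> real \<Rightarrow> real \<Rightarrow> real \<Rightarrow> vec \<Rightarrow> vec \<Rightarrow> bool" where
  "good_line d k w b T r h N \<rho> \<kappa> a V p v \<longleftrightarrow>
     (\<Sum>j<d. (p j)\<^sup>2) + (\<Sum>j<d. (v j)\<^sup>2) \<le> V\<^sup>2 \<and>
     (\<forall>i<k. \<forall>n\<le>N. vnorm d (w i) > 0 \<longrightarrow>
        \<not> \<bar>dot d (w i) p + ((real n * r - T) * dot d (w i) v - b i)\<bar> \<le> h * vnorm d (w i)) \<and>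
     (\<forall>i<k. \<forall>j<k. \<not> (dot d (w i) v \<noteq> 0 \<and> dot d (w j) v \<noteq> 0 \<and>
        \<bar>(b i - dot d (w i) p) / dot d (w i) v - (b j - dot d (w j) p) / dot d (w j) v\<bar> \<le> r \<and>
        vnorm d (\<lambda>l. w i l / dot d (w i) v - w j l / dot d (w j) v) > \<rho>)) \<and>
     (\<forall>i<k. \<not> (vnorm d (w i) > \<kappa> \<and> \<bar>dot d (w i) v\<bar> \<le> a * vnorm d (w i)))"

lemma measurable_round_component:
  assumes "l < m + 2" "j < d"
  shows "(\<lambda>x. x l j) \<in> borel_measurable (round_space d m)"
  using measurable_compose[OF measurable_component_singleton[of l "{..<m + 2}" "\<lambda>_. std_normal_vec d"]
      measurable_std_normal_vec_component[of j d]] assms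
  by simp

lemma sum_const_ennreal: "0 \<le> c \<Longrightarrow> (\<Sum>x\<in>S. ennreal c) = ennreal (real (card S) * c)"
  by (simp add: ennreal_mult ennreal_of_nat_eq_real_of_nat)

text \<open>A union bound with one summand per clause: Markov's inequality for the squared norms,
  whose expectations are \<open>d\<close> each; a small ball in \<open>p\<close> for each neuron and
  grid point; a small ball in \<open>p\<close> for each pair of neurons; a small ball in
  \<open>v\<close> for each neuron.\<close>

lemma good_line_measure:
  fixes d k :: nat and w :: "nat \<Rightarrow> vec"
  assumes pos: "0 < h" "0 < r" "0 < \<rho>" "0 < \<kappa>" "0 < a" "0 < V"
  shows "{x \<in> space (round_space d m). \<not> good_line d k w b T r h N \<rho> \<kappa> a V (x 0) (x 1)} \<in> sets (round_space d m)" (is ?A)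
    and "emeasure (round_space d m) {x \<in> space (round_space d m). \<not> good_line d k w b T r h N \<rho> \<kappa> a V (x 0) (x 1)}
      \<le> ennreal (2 * real d / V\<^sup>2 + real k * (real N + 1) * (h * real d) + (real k)\<^sup>2 * (r * real d / \<rho>)
          + real k * (a * real d))" (is ?B)
proof -
  let ?M = "round_space d m"
  have Mprob: "prob_space (std_normal_vec d)" by (rule prob_space_std_normal_vec)
  define A0 where "A0 = {x \<in> space ?M. \<not> (\<Sum>j<d. (x 0 j)\<^sup>2) + (\<Sum>j<d. (x 1 j)\<^sup>2) \<le> V\<^sup>2}"
  define A1 where "A1 i n = {x \<in> space ?M. vnorm d (w i) > 0 \<and>
    \<bar>dot d (w i) (x 0) + ((real n * r - T) * dot d (w i) (x 1) - b i)\<bar> \<le> h * vnorm d (w i)}" for i n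
  define A2 where "A2 i j = {x \<in> space ?M. dot d (w i) (x 1) \<noteq> 0 \<and> dot d (w j) (x 1) \<noteq> 0 \<and>
        \<bar>(b i - dot d (w i) (x 0)) / dot d (w i) (x 1) - (b j - dot d (w j) (x 0)) / dot d (w j) (x 1)\<bar> \<le> r \<and>
        vnorm d (\<lambda>l. w i l / dot d (w i) (x 1) - w j l / dot d (w j) (x 1)) > \<rho>}" for i j
  define A3 where "A3 i = {x \<in> space ?M. vnorm d (w i) > \<kappa> \<and> \<bar>dot d (w i) (x 1)\<bar> \<le> a * vnorm d (w i)}" for i
  have c0: "(\<lambda>x. x 0 j) \<in> borel_measurable ?M" and c1: "(\<lambda>x. x 1 j) \<in> borel_measurable ?M" if "j < d" for j
    using measurable_round_component[of 0 m j d] measurable_round_component[of 1 m j d] that by auto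
  have [measurable]: "(\<lambda>x. dot d u (x 0)) \<in> borel_measurable ?M" for u
    by (intro measurable_dot c0 borel_measurable_const)
  have [measurable]: "(\<lambda>x. dot d u (x 1)) \<in> borel_measurable ?M" for u
    by (intro measurable_dot c1 borel_measurable_const)
  have [measurable]: "(\<lambda>x. (\<Sum>j<d. (x 0 j)\<^sup>2)) \<in> borel_measurable ?M" "(\<lambda>x. (\<Sum>j<d. (x 1 j)\<^sup>2)) \<in> borel_measurable ?M"
    using c0 c1 by (auto intro!: borel_measurable_sum borel_measurable_power)
  have [measurable]: "(\<lambda>x. vnorm d (\<lambda>l. w i l / dot d (w i) (x 1) - w j l / dot d (w j) (x 1))) \<in> borel_measurable ?M" for i j
    by (rule measurable_vnorm) measurable
  have m0[measurable]: "A0 \<in> sets ?M" unfolding A0_def by measurable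
  have m1[measurable]: "A1 i n \<in> sets ?M" for i n unfolding A1_def by measurable
  have m2[measurable]: "A2 i j \<in> sets ?M" for i j unfolding A2_def by measurable
  have m3[measurable]: "A3 i \<in> sets ?M" for i unfolding A3_def by measurable
  have eq: "{x \<in> space ?M. \<not> good_line d k w b T r h N \<rho> \<kappa> a V (x 0) (x 1)}
      = A0 \<union> (\<Union>(i, n)\<in>{..<k} \<times> {..N}. A1 i n) \<union> (\<Union>(i, j)\<in>{..<k} \<times> {..<k}. A2 i j) \<union> (\<Union>i\<in>{..<k}. A3 i)"
    (is "_ = _ \<union> ?U1 \<union> ?U2 \<union> ?U3")
    unfolding good_line_def A0_def A1_def A2_def A3_def by auto
  have U: "?U1 \<in> sets ?M" "?U2 \<in> sets ?M" "?U3 \<in> sets ?M"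
    using m1 m2 m3 by (auto intro!: sets.finite_UN)
  show ?A unfolding eq by (intro sets.Un U m0)
  have b0: "emeasure ?M A0 \<le> ennreal (2 * real d / V\<^sup>2)"
  proof -
    have E: "(\<integral>\<^sup>+x. ennreal (\<Sum>j<d. (x l j)\<^sup>2) \<partial>?M) = of_nat d" if "l < m + 2" for l
    proof -
      interpret product_prob_space "\<lambda>_. std_normal_vec d" "{..<m + 2}"
        using Mprob
        by (simp add: product_prob_space_def product_prob_space_axioms_def product_sigma_finite_def prob_space_imp_sigma_finite)
      have "(\<lambda>x. ennreal (\<Sum>j<d. (x j)\<^sup>2)) \<in> borel_measurable (std_normal_vec d)"
        using measurable_std_normal_vec_component[of _ d]
        by (intro measurable_compose[OF _ measurable_ennreal] borel_measurable_sum borel_measurable_power) auto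
      then have "(\<integral>\<^sup>+y. ennreal (\<Sum>j<d. (y j)\<^sup>2) \<partial>distr ?M (std_normal_vec d) (\<lambda>\<omega>. \<omega> l))
          = (\<integral>\<^sup>+x. ennreal (\<Sum>j<d. (x l j)\<^sup>2) \<partial>?M)"
        using that by (intro nn_integral_distr measurable_component_singleton) auto
      then show ?thesis using PiM_component[of l] that by (simp add: std_normal_vec_second_moment)
    qed
    let ?u = "\<lambda>x. ennreal ((\<Sum>j<d. (x 0 j)\<^sup>2) + (\<Sum>j<d. (x 1 j)\<^sup>2))"
    have "A0 \<subseteq> {x\<in>space ?M. 1 \<le> ennreal (1 / V\<^sup>2) * ?u x}"
    proof
      fix x assume x: "x \<in> A0"
      then have "1 \<le> 1 / V\<^sup>2 * ((\<Sum>j<d. (x 0 j)\<^sup>2) + (\<Sum>j<d. (x 1 j)\<^sup>2))"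
        using pos by (simp add: A0_def field_simps)
      then have "ennreal 1 \<le> ennreal (1 / V\<^sup>2) * ?u x"
        by (subst ennreal_mult[symmetric]) (auto simp: sum_nonneg intro!: ennreal_leI simp del: ennreal_1)
      with x show "x \<in> {x\<in>space ?M. 1 \<le> ennreal (1 / V\<^sup>2) * ?u x}" by (simp add: A0_def)
    qed
    then have "emeasure ?M A0 \<le> emeasure ?M {x\<in>space ?M. 1 \<le> ennreal (1 / V\<^sup>2) * ?u x}"
      by (rule emeasure_mono) measurable
    also have "\<dots> \<le> ennreal (1 / V\<^sup>2) * (\<integral>\<^sup>+x. ?u x * indicator (space ?M) x \<partial>?M)"
      by (rule nn_integral_Markov_inequality) measurable
    also have "(\<integral>\<^sup>+x. ?u x * indicator (space ?M) x \<partial>?M) = (\<integral>\<^sup>+x. ennreal (\<Sum>j<d. (x 0 j)\<^sup>2) + ennreal (\<Sum>j<d. (x 1 j)\<^sup>2) \<partial>?M)"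
      by (rule nn_integral_cong) (simp add: sum_nonneg)
    also have "\<dots> = (\<integral>\<^sup>+x. ennreal (\<Sum>j<d. (x 0 j)\<^sup>2) \<partial>?M) + (\<integral>\<^sup>+x. ennreal (\<Sum>j<d. (x 1 j)\<^sup>2) \<partial>?M)"
      by (rule nn_integral_add) measurable
    also have "(\<integral>\<^sup>+x. ennreal (\<Sum>j<d. (x 0 j)\<^sup>2) \<partial>?M) = of_nat d"
      by (rule E) simp
    also have "(\<integral>\<^sup>+x. ennreal (\<Sum>j<d. (x 1 j)\<^sup>2) \<partial>?M) = of_nat d"
      by (rule E) simp
    also have "ennreal (1 / V\<^sup>2) * (of_nat d + of_nat d) = ennreal (1 / V\<^sup>2 * (real d + real d))"
      by (subst ennreal_mult) (auto simp: ennreal_of_nat_eq_real_of_nat ennreal_plus[symmetric] simp del: ennreal_plus)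
    also have "1 / V\<^sup>2 * (real d + real d) = 2 * real d / V\<^sup>2" by simp
    finally show ?thesis .
  qed
  \<comment> \<open>The distance to the hyperplane is measured relative to the norm of the weight,
    which therefore cancels in the small ball bound.\<close>
  have b1: "emeasure ?M (A1 i n) \<le> ennreal (h * real d)" for i n
  proof (cases "vnorm d (w i) > 0")
    case True
    show ?thesis
    proof (rule emeasure_PiM_slice_le[where i=0])
      fix x :: "nat \<Rightarrow> vec"
      have "emeasure (std_normal_vec d) {y \<in> space (std_normal_vec d). x(0 := y) \<in> A1 i n}
        \<le> emeasure (std_normal_vec d) {y \<in> space (std_normal_vec d).
             \<bar>dot d (w i) y + ((real n * r - T) * dot d (w i) (x 1) - b i)\<bar> \<le> h * vnorm d (w i)}"
      proof (rule emeasure_mono)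
        have [measurable]: "(\<lambda>y. dot d (w i) y) \<in> borel_measurable (std_normal_vec d)"
          by (rule measurable_dot) (auto intro: measurable_std_normal_vec_component)
        show "{y \<in> space (std_normal_vec d).
             \<bar>dot d (w i) y + ((real n * r - T) * dot d (w i) (x 1) - b i)\<bar> \<le> h * vnorm d (w i)} \<in> sets (std_normal_vec d)"
          by measurable
      qed (auto simp: A1_def)
      also have "\<dots> \<le> ennreal (h * vnorm d (w i) * real d / vnorm d (w i))"
        using True pos by (intro std_normal_vec_small_ball) auto
      finally show "emeasure (std_normal_vec d) {y \<in> space (std_normal_vec d). x(0 := y) \<in> A1 i n} \<le> ennreal (h * real d)"
        using True by simp
    qed (use m1 in \<open>auto simp: Mprob\<close>)
  qed (simp add: A1_def)
  \<comment> \<open>With \<open>v\<close> frozen, the difference of the two crossing positions is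
    affine in \<open>p\<close> with gradient \<open>- z\<close>. So the slice is empty, or a small
    ball event for a vector \<open>z\<close> longer than \<open>\<rho>\<close>.\<close>
  have b2: "emeasure ?M (A2 i j) \<le> ennreal (r * real d / \<rho>)" for i j
  proof (rule emeasure_PiM_slice_le[where i=0])
    fix x :: "nat \<Rightarrow> vec"
    define \<alpha> where "\<alpha> = dot d (w i) (x 1)"
    define \<beta> where "\<beta> = dot d (w j) (x 1)"
    define z where "z l = w i l / \<alpha> - w j l / \<beta>" for l
    have zd: "dot d z y = dot d (w i) y / \<alpha> - dot d (w j) y / \<beta>" for y
      unfolding z_def[abs_def] dot_diff_left dot_divide_left ..
    show "emeasure (std_normal_vec d) {y \<in> space (std_normal_vec d). x(0 := y) \<in> A2 i j} \<le> ennreal (r * real d / \<rho>)"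
    proof (cases "vnorm d z > \<rho>")
      case False
      then have "{y \<in> space (std_normal_vec d). x(0 := y) \<in> A2 i j} = {}"
        by (auto simp: A2_def z_def[abs_def] \<alpha>_def \<beta>_def)
      then show ?thesis by (simp only: emeasure_empty zero_le)
    next
      case True
      have "emeasure (std_normal_vec d) {y \<in> space (std_normal_vec d). x(0 := y) \<in> A2 i j}
        \<le> emeasure (std_normal_vec d) {y \<in> space (std_normal_vec d). \<bar>dot d z y + (b j / \<beta> - b i / \<alpha>)\<bar> \<le> r}"
      proof (rule emeasure_mono)
        have [measurable]: "(\<lambda>y. dot d z y) \<in> borel_measurable (std_normal_vec d)"
          by (rule measurable_dot) (auto intro: measurable_std_normal_vec_component)
        show "{y \<in> space (std_normal_vec d). \<bar>dot d z y + (b j / \<beta> - b i / \<alpha>)\<bar> \<le> r} \<in> sets (std_normal_vec d)"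
          by measurable
        show "{y \<in> space (std_normal_vec d). x(0 := y) \<in> A2 i j}
          \<subseteq> {y \<in> space (std_normal_vec d). \<bar>dot d z y + (b j / \<beta> - b i / \<alpha>)\<bar> \<le> r}"
        proof
          fix y assume "y \<in> {y \<in> space (std_normal_vec d). x(0 := y) \<in> A2 i j}"
          then have "y \<in> space (std_normal_vec d)"
            and "\<bar>(b i - dot d (w i) y) / \<alpha> - (b j - dot d (w j) y) / \<beta>\<bar> \<le> r"
            by (simp_all add: A2_def \<alpha>_def \<beta>_def)
          moreover have "(b i - dot d (w i) y) / \<alpha> - (b j - dot d (w j) y) / \<beta>
              = - (dot d z y + (b j / \<beta> - b i / \<alpha>))"
            by (simp add: zd diff_divide_distrib)
          ultimately show "y \<in> {y \<in> space (std_normal_vec d). \<bar>dot d z y + (b j / \<beta> - b i / \<alpha>)\<bar> \<le> r}"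
            by simp
        qed
      qed
      also have "\<dots> \<le> ennreal (r * real d / vnorm d z)"
        using True pos by (intro std_normal_vec_small_ball) auto
      also have "\<dots> \<le> ennreal (r * real d / \<rho>)"
        using True pos by (intro ennreal_leI divide_left_mono) auto
      finally show ?thesis .
    qed
  qed (use m2 in \<open>auto simp: Mprob\<close>)
  have b3: "emeasure ?M (A3 i) \<le> ennreal (a * real d)" for i
  proof (cases "vnorm d (w i) > \<kappa>")
    case True
    show ?thesis
    proof (rule emeasure_PiM_slice_le[where i=1])
      fix x :: "nat \<Rightarrow> vec"
      have "emeasure (std_normal_vec d) {y \<in> space (std_normal_vec d). x(1 := y) \<in> A3 i}
        \<le> emeasure (std_normal_vec d) {y \<in> space (std_normal_vec d). \<bar>dot d (w i) y + 0\<bar> \<le> a * vnorm d (w i)}"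
      proof (rule emeasure_mono)
        have [measurable]: "(\<lambda>y. dot d (w i) y) \<in> borel_measurable (std_normal_vec d)"
          by (rule measurable_dot) (auto intro: measurable_std_normal_vec_component)
        show "{y \<in> space (std_normal_vec d). \<bar>dot d (w i) y + 0\<bar> \<le> a * vnorm d (w i)} \<in> sets (std_normal_vec d)"
          by measurable
      qed (auto simp: A3_def)
      also have "\<dots> \<le> ennreal (a * vnorm d (w i) * real d / vnorm d (w i))"
        using True pos by (intro std_normal_vec_small_ball) auto
      finally show "emeasure (std_normal_vec d) {y \<in> space (std_normal_vec d). x(1 := y) \<in> A3 i} \<le> ennreal (a * real d)"
        using True pos by simp
    qed (use m3 in \<open>auto simp: Mprob\<close>)
  qed (simp add: A3_def)
  have U1: "emeasure ?M ?U1 \<le> ennreal (real k * (real N + 1) * (h * real d))"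
  proof -
    have "emeasure ?M ?U1 \<le> (\<Sum>(i, n)\<in>{..<k} \<times> {..N}. emeasure ?M (A1 i n))"
      using emeasure_subadditive_finite[of "{..<k} \<times> {..N}" "\<lambda>(i, n). A1 i n" ?M] m1
      by (auto simp: split_beta')
    also have "\<dots> \<le> (\<Sum>(i, n)\<in>{..<k} \<times> {..N}. ennreal (h * real d))"
      unfolding split_beta' by (intro sum_mono b1)
    also have "\<dots> = ennreal (real k * (real N + 1) * (h * real d))"
      unfolding split_beta' using pos by (subst sum_const_ennreal) (simp_all add: algebra_simps)
    finally show ?thesis .
  qed
  have U2: "emeasure ?M ?U2 \<le> ennreal ((real k)\<^sup>2 * (r * real d / \<rho>))"
  proof -
    have "emeasure ?M ?U2 \<le> (\<Sum>(i, n)\<in>{..<k} \<times> {..<k}. emeasure ?M (A2 i n))"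
      using emeasure_subadditive_finite[of "{..<k} \<times> {..<k}" "\<lambda>(i, n). A2 i n" ?M] m2
      by (auto simp: split_beta')
    also have "\<dots> \<le> (\<Sum>(i, n)\<in>{..<k} \<times> {..<k}. ennreal (r * real d / \<rho>))"
      unfolding split_beta' by (intro sum_mono b2)
    also have "\<dots> = ennreal ((real k)\<^sup>2 * (r * real d / \<rho>))"
      unfolding split_beta' using pos by (subst sum_const_ennreal) (simp_all add: power2_eq_square)
    finally show ?thesis .
  qed
  have U3: "emeasure ?M ?U3 \<le> ennreal (real k * (a * real d))"
  proof -
    have "emeasure ?M ?U3 \<le> (\<Sum>i\<in>{..<k}. emeasure ?M (A3 i))"
      using m3 by (intro emeasure_subadditive_finite) auto
    also have "\<dots> \<le> (\<Sum>i\<in>{..<k}. ennreal (a * real d))"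
      by (intro sum_mono b3)
    also have "\<dots> = ennreal (real k * (a * real d))"
      using pos by (subst sum_const_ennreal) simp_all
    finally show ?thesis .
  qed
  have "emeasure ?M (A0 \<union> ?U1 \<union> ?U2 \<union> ?U3) \<le> emeasure ?M A0 + emeasure ?M ?U1 + emeasure ?M ?U2 + emeasure ?M ?U3"
    using U m0 by (intro order_trans[OF emeasure_subadditive] add_mono order_refl sets.Un)
  also have "\<dots> \<le> ennreal (2 * real d / V\<^sup>2) + ennreal (real k * (real N + 1) * (h * real d))
     + ennreal ((real k)\<^sup>2 * (r * real d / \<rho>)) + ennreal (real k * (a * real d))"
    by (intro add_mono b0 U1 U2 U3)
  also have "\<dots> = ennreal (2 * real d / V\<^sup>2 + real k * (real N + 1) * (h * real d) + (real k)\<^sup>2 * (r * real d / \<rho>)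
          + real k * (a * real d))"
    using pos by simp
  finally show ?B unfolding eq .
qed

section \<open>Testing a candidate on fresh points\<close>

text \<open>The candidate depends on the coordinates \<open>0\<close> and \<open>1\<close> only.
  Once these are frozen by Fubini, the \<open>m\<close> test points are independent of the candidate
  and of each other, and a bad candidate passes each test with probability at most
  \<open>c\<close>.\<close>

lemma all_pass_measure_le:
  fixes d :: nat and Ps :: "vec \<Rightarrow> vec \<Rightarrow> vec \<Rightarrow> bool" and Bd :: "vec \<Rightarrow> vec \<Rightarrow> bool"
  assumes meas: "{x \<in> space (round_space d m). Bd (x 0) (x 1) \<and> (\<forall>i<m. Ps (x 0) (x 1) (x (i + 2)))}
      \<in> sets (round_space d m)"
    and Ps: "\<And>p v. p \<in> space (std_normal_vec d) \<Longrightarrow> v \<in> space (std_normal_vec d) \<Longrightarrow>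
      {y \<in> space (std_normal_vec d). Ps p v y} \<in> sets (std_normal_vec d)"
    and Bd: "\<And>p v. p \<in> space (std_normal_vec d) \<Longrightarrow> v \<in> space (std_normal_vec d) \<Longrightarrow> Bd p v \<Longrightarrow>
      emeasure (std_normal_vec d) {y \<in> space (std_normal_vec d). Ps p v y} \<le> c"
  shows "emeasure (round_space d m)
      {x \<in> space (round_space d m). Bd (x 0) (x 1) \<and> (\<forall>i<m. Ps (x 0) (x 1) (x (i + 2)))} \<le> c ^ m"
proof -
  let ?N = "std_normal_vec d"
  let ?I = "{0, 1::nat}" and ?J = "{2..<m + 2}"
  have IJ: "?I \<union> ?J = {..<m + 2}" by auto
  let ?S = "{x \<in> space (round_space d m). Bd (x 0) (x 1) \<and> (\<forall>i<m. Ps (x 0) (x 1) (x (i + 2)))}"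
  interpret N: prob_space ?N by (rule prob_space_std_normal_vec)
  interpret product_sigma_finite "\<lambda>_::nat. ?N" ..
  interpret I: prob_space "PiM ?I (\<lambda>_. ?N)" by (intro prob_space_PiM) (rule N.prob_space_axioms)
  have "emeasure (round_space d m) ?S = (\<integral>\<^sup>+x. indicator ?S x \<partial>round_space d m)"
    using meas by simp
  also have "\<dots> = (\<integral>\<^sup>+x. (\<integral>\<^sup>+y. indicator ?S (merge ?I ?J (x, y)) \<partial>PiM ?J (\<lambda>_. ?N)) \<partial>PiM ?I (\<lambda>_. ?N))"
    using meas unfolding IJ[symmetric] by (intro product_nn_integral_fold) auto
  also have "\<dots> \<le> (\<integral>\<^sup>+x. c ^ m \<partial>PiM ?I (\<lambda>_. ?N))"
  proof (rule nn_integral_mono)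
    fix x assume "x \<in> space (PiM ?I (\<lambda>_. ?N))"
    then have x: "x 0 \<in> space ?N" "x 1 \<in> space ?N" by (auto simp: space_PiM PiE_iff)
    show "(\<integral>\<^sup>+y. indicator ?S (merge ?I ?J (x, y)) \<partial>PiM ?J (\<lambda>_. ?N)) \<le> c ^ m"
    proof (cases "Bd (x 0) (x 1)")
      case False
      then have "indicator ?S (merge ?I ?J (x, y)) = (0::ennreal)" for y
        by (auto simp: merge_def indicator_def)
      then show ?thesis by simp
    next
      case True
      let ?P = "{y \<in> space ?N. Ps (x 0) (x 1) y}"
      have P: "?P \<in> sets ?N" by (rule Ps[OF x])
      have "(\<integral>\<^sup>+y. indicator ?S (merge ?I ?J (x, y)) \<partial>PiM ?J (\<lambda>_. ?N))
          \<le> (\<integral>\<^sup>+y. indicator (PiE ?J (\<lambda>_. ?P)) y \<partial>PiM ?J (\<lambda>_. ?N))"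
      proof (rule nn_integral_mono)
        fix y assume y: "y \<in> space (PiM ?J (\<lambda>_. ?N))"
        have "y \<in> PiE ?J (\<lambda>_. ?P)" if "merge ?I ?J (x, y) \<in> ?S"
        proof -
          have "Ps (x 0) (x 1) (y l)" if l: "l \<in> ?J" for l
          proof -
            have "l - 2 < m" "l - 2 + 2 = l" using l by auto
            moreover have "\<forall>i<m. Ps (merge ?I ?J (x, y) 0) (merge ?I ?J (x, y) 1) (merge ?I ?J (x, y) (i + 2))"
              using \<open>merge ?I ?J (x, y) \<in> ?S\<close> by blast
            ultimately have "Ps (merge ?I ?J (x, y) 0) (merge ?I ?J (x, y) 1) (merge ?I ?J (x, y) l)"
              by metis
            then show ?thesis using l by (auto simp: merge_def)
          qed
          then show ?thesis using y by (auto simp: space_PiM PiE_iff)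
        qed
        then show "indicator ?S (merge ?I ?J (x, y)) \<le> (indicator (PiE ?J (\<lambda>_. ?P)) y :: ennreal)"
          by (auto simp: indicator_def)
      qed
      also have "\<dots> = emeasure (PiM ?J (\<lambda>_. ?N)) (PiE ?J (\<lambda>_. ?P))"
        using P by (intro nn_integral_indicator sets_PiM_I_finite) auto
      also have "\<dots> = (\<Prod>l\<in>?J. emeasure ?N ?P)"
        using P by (intro emeasure_PiM) auto
      also have "\<dots> \<le> c ^ m" using Bd[OF x True] by (simp add: power_mono)
      finally show ?thesis .
    qed
  qed
  also have "\<dots> = c ^ m" by (simp only: nn_integral_const I.emeasure_space_1 mult_1_right)
  finally show ?thesis .
qed

text \<open>The tolerance grows with \<open>x\<close> because the error of a good line is bounded by
  a multiple of \<open>1 + vnorm d x\<close>; thus a good candidate passes at every point. Comparing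
  squares keeps the test within the field operations of the machine.\<close>

definition passes :: "nat \<Rightarrow> real \<Rightarrow> (vec \<Rightarrow> real) \<Rightarrow> (vec \<Rightarrow> real) \<Rightarrow> vec \<Rightarrow> bool" where
  "passes d C F G x \<longleftrightarrow> C * (F x - G x)\<^sup>2 \<le> 1 + (\<Sum>j<d. (x j)\<^sup>2)"

lemma measurable_neuron_sum:
  assumes "\<And>j. j < d \<Longrightarrow> (\<lambda>\<omega>. x \<omega> j) \<in> borel_measurable M"
  shows "(\<lambda>\<omega>. neuron_sum d k s w b (x \<omega>)) \<in> borel_measurable M"
  unfolding neuron_sum_def relu_def using assms
  by (intro borel_measurable_sum borel_measurable_times borel_measurable_max borel_measurable_diff measurable_dot) auto

text \<open>Joint measurability in the line and in the argument, since the line is itself random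
  when the events of a round are formed.\<close>

lemma measurable_scan_net:
  fixes k :: nat and s b :: "nat \<Rightarrow> real" and w :: "nat \<Rightarrow> vec"
  assumes p: "\<And>j. j < d \<Longrightarrow> (\<lambda>\<omega>. p \<omega> j) \<in> borel_measurable M"
    and v: "\<And>j. j < d \<Longrightarrow> (\<lambda>\<omega>. v \<omega> j) \<in> borel_measurable M"
    and x: "\<And>j. j < d \<Longrightarrow> (\<lambda>\<omega>. x \<omega> j) \<in> borel_measurable M"
  shows "(\<lambda>\<omega>. relu_network d (scan_net d (neuron_sum d k s w b) N T r h (p \<omega>) (v \<omega>)) (x \<omega>)) \<in> borel_measurable M"
proof -
  let ?F = "neuron_sum d k s w b"
  have P: "(\<lambda>\<omega>. grid_point d T r (p \<omega>) (v \<omega>) n j) \<in> borel_measurable M" if "j < d" for n j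
    using that p v by (simp add: grid_point_def)
  have "(\<lambda>\<omega>. ((grid_point d T r (p \<omega>) (v \<omega>) n)(j := grid_point d T r (p \<omega>) (v \<omega>) n j + h)) l) \<in> borel_measurable M"
    if "j < d" "l < d" for n j l
    using P[OF that(1), of n] P[OF that(2), of n] by (cases "l = j") auto
  then have g: "(\<lambda>\<omega>. grid_grad d ?F T r h (p \<omega>) (v \<omega>) n j) \<in> borel_measurable M" if "j < d" for n j
    using that P
    by (simp add: grid_grad_def diff_quot_def)
      (intro borel_measurable_divide borel_measurable_diff measurable_neuron_sum, auto)
  have J: "(\<lambda>\<omega>. grad_jump d ?F T r h (p \<omega>) (v \<omega>) n j) \<in> borel_measurable M" if "j < d" for n j
    unfolding grad_jump_def using g[OF that] by (intro borel_measurable_diff)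
  have S: "(\<lambda>\<omega>. jump_slope d ?F T r h (p \<omega>) (v \<omega>) n) \<in> borel_measurable M" for n
    unfolding jump_slope_def by (intro measurable_dot J v)
  show ?thesis
    unfolding relu_network_scan_net relu_def
    by (intro borel_measurable_add borel_measurable_sum borel_measurable_times borel_measurable_max
        borel_measurable_divide measurable_dot borel_measurable_diff measurable_neuron_sum P g J S x)
      auto
qed

section \<open>Choice of the parameters\<close>

text \<open>The natural number \<open>Q\<close> bounds \<open>d\<close>, \<open>k\<close>, \<open>R\<close>, \<open>B\<close> and \<open>1 / \<epsilon>\<close>.  The range \<open>T = Q^13\<close> suffices for every
  neuron with \<open>|w| > Q^-7\<close> and \<open>|\<langle>w, v\<rangle>| > Q^-4 |w|\<close> to cross; cells of length \<open>r = Q^-29\<close> separate all pairs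
  of directions that differ by more than \<open>\<rho> = Q^-24\<close>; and \<open>h = Q^-47\<close> keeps the difference quotients at
  all \<open>2 Q^42 + 1\<close> grid points away from the hyperplanes.\<close>

definition line_net :: "nat \<Rightarrow> (vec \<Rightarrow> real) \<Rightarrow> nat \<Rightarrow> vec \<Rightarrow> vec \<Rightarrow> neuron list" where
  "line_net d F Q p v =
     scan_net d F (2 * Q ^ 42) (real Q ^ 13) (1 / real Q ^ 29) (1 / real Q ^ 47) p v"

definition line_good :: "nat \<Rightarrow> nat \<Rightarrow> (nat \<Rightarrow> vec) \<Rightarrow> (nat \<Rightarrow> real) \<Rightarrow> nat \<Rightarrow> vec \<Rightarrow> vec \<Rightarrow> bool" where
  "line_good d k w b Q p v =
     good_line d k w b (real Q ^ 13) (1 / real Q ^ 29) (1 / real Q ^ 47) (2 * Q ^ 42)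
       (1 / real Q ^ 24) (1 / real Q ^ 7) (1 / real Q ^ 4) (real Q ^ 2) p v"

text \<open>The first clause of \<open>line_good\<close>, whose \<open>V\<close> is
  \<open>Q^2\<close>, in squared form. The program checks it, because the crude error bound for an
  accepted candidate depends on it.\<close>

abbreviation line_short :: "nat \<Rightarrow> nat \<Rightarrow> vec \<Rightarrow> vec \<Rightarrow> bool" where
  "line_short d Q p v \<equiv> (\<Sum>j<d. (p j)\<^sup>2) + (\<Sum>j<d. (v j)\<^sup>2) \<le> real Q ^ 4"

lemma power_quotient: "(q::real) \<noteq> 0 \<Longrightarrow> q ^ a / q ^ (a + b) = 1 / q ^ b"
  by (simp add: power_add)

lemma one_div_power_le: "1 \<le> (q::real) \<Longrightarrow> a \<le> b \<Longrightarrow> 1 / q ^ b \<le> 1 / q ^ a"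
  by (intro divide_left_mono power_increasing) auto

lemma one_div_power_Suc_le: "4 \<le> (q::real) \<Longrightarrow> 1 / q ^ Suc m \<le> 1 / q ^ m / 4"
proof -
  assume q: "4 \<le> q"
  have "1 / q ^ Suc m = 1 / q ^ m / q" by simp
  also have "\<dots> \<le> 1 / q ^ m / 4" using q by (intro divide_left_mono) auto
  finally show ?thesis .
qed

lemma vnorm_le_of_sum:
  assumes "(\<Sum>j<d. (p j)\<^sup>2) + (\<Sum>j<d. (v j)\<^sup>2) \<le> V\<^sup>2" "0 \<le> V"
  shows "vnorm d p \<le> V" "vnorm d v \<le> V"
proof -
  have "(vnorm d p)\<^sup>2 \<le> V\<^sup>2" "(vnorm d v)\<^sup>2 \<le> V\<^sup>2"
    unfolding vnorm_power2 using assms(1) sum_nonneg[of "{..<d}" "\<lambda>j. (p j)\<^sup>2"] sum_nonneg[of "{..<d}" "\<lambda>j. (v j)\<^sup>2"]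
    by simp_all
  then show "vnorm d p \<le> V" "vnorm d v \<le> V" using assms(2) by (simp_all only: power2_le_imp_le)
qed

text \<open>The parameters make the pointwise error at most
  \<open>3 * (1 + vnorm d x) / Q^4\<close>. Its square times \<open>Q^4\<close> still carries a
  factor \<open>18 / Q^4\<close>, which is below \<open>1\<close>.\<close>

lemma line_good_passes:
  fixes d k Q :: nat and s b :: "nat \<Rightarrow> real" and w :: "nat \<Rightarrow> vec"
  assumes Q: "4 \<le> Q" "k \<le> Q" "0 \<le> R" "R \<le> real Q" "B \<le> real Q"
    and s: "\<And>i. i < k \<Longrightarrow> \<bar>s i\<bar> \<le> 1" and w: "\<And>i. i < k \<Longrightarrow> vnorm d (w i) \<le> R"
    and b: "\<And>i. i < k \<Longrightarrow> \<bar>b i\<bar> \<le> B"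
    and good: "line_good d k w b Q p v"
  defines "F \<equiv> neuron_sum d k s w b"
  shows "passes d (real Q ^ 4) F (relu_network d (line_net d F Q p v)) x"
proof -
  define q where "q = real Q"
  have q: "4 \<le> q" "real k \<le> q" "R \<le> q" "B \<le> q" using Q by (simp_all add: q_def)
  have q0: "0 < q" "q \<noteq> 0" "1 \<le> q" using q by simp_all
  note g = good[unfolded line_good_def good_line_def q_def[symmetric]]
  have V: "vnorm d p \<le> q\<^sup>2" "vnorm d v \<le> q\<^sup>2"
    using vnorm_le_of_sum[OF conjunct1[OF g]] by simp_all
  define X where "X = vnorm d x"
  have X: "0 \<le> X" by (simp add: X_def vnorm_nonneg)
  have "\<bar>F x - relu_network d (line_net d F Q p v) x\<bar>
    \<le> real k * (R * q\<^sup>2 * (1 / q ^ 29 + 2 * (1 / q ^ 24) * (vnorm d x + q\<^sup>2 + q ^ 13 * q\<^sup>2)))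
      + real k * ((1 / q ^ 7) * (vnorm d x + q\<^sup>2))"
    unfolding line_net_def F_def q_def[symmetric]
  proof (rule scan_net_error[where mid="Q ^ 42"])
    \<comment> \<open>Half the number of cells times the cell length:
      \<open>42 - 29 = 13\<close>.\<close>
    show "q ^ 13 = real (Q ^ 42) * (1 / q ^ 29)"
      using power_quotient[OF q0(2), of 29 13] q0 by (simp add: q_def field_simps flip: power_add)
    fix i assume i: "i < k"
    show "\<bar>s i\<bar> \<le> 1" "vnorm d (w i) \<le> R" using s w i by auto
    \<comment> \<open>For a larger weight of norm \<open>n\<close> the slope exceeds
      \<open>n / q^4\<close>, so the line covers at least \<open>q^9 * n\<close> in the argument of
      the neuron. The offset is at most \<open>q\<close>, hence at most \<open>q^8 * n\<close>, and
      the value at \<open>p\<close> is at most \<open>q^2 * n\<close>; together they stay below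
      \<open>2 * q^8 * n\<close>.\<close>
    show "vnorm d (w i) \<le> 1 / q ^ 7 \<or> \<bar>b i - dot d (w i) p\<bar> \<le> q ^ 13 * \<bar>dot d (w i) v\<bar>"
    proof (cases "vnorm d (w i) \<le> 1 / q ^ 7")
      case False
      let ?n = "vnorm d (w i)"
      have n: "1 / q ^ 7 < ?n" using False by simp
      have "\<not> \<bar>dot d (w i) v\<bar> \<le> 1 / q ^ 4 * ?n" using g i n by blast
      then have "q ^ 13 * (1 / q ^ 4 * ?n) \<le> q ^ 13 * \<bar>dot d (w i) v\<bar>"
        using q0 by (intro mult_left_mono) auto
      moreover have "q ^ 13 * (1 / q ^ 4 * ?n) = q ^ 9 * ?n"
        using q0 by (simp add: field_simps)
      moreover have "q \<le> q ^ 8 * ?n"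
      proof -
        have "q ^ 8 * (1 / q ^ 7) = q" using q0 by (simp add: field_simps flip: power_Suc)
        then show ?thesis using mult_strict_left_mono[OF n, of "q ^ 8"] q0 by simp
      qed
      moreover have "\<bar>dot d (w i) p\<bar> \<le> ?n * q\<^sup>2"
        by (intro order_trans[OF abs_dot_le] mult_left_mono V vnorm_nonneg)
      moreover have "?n * q\<^sup>2 \<le> ?n * q ^ 8"
        using q0 by (intro mult_left_mono power_increasing vnorm_nonneg) auto
      moreover have "2 * (q ^ 8 * ?n) \<le> q ^ 9 * ?n"
      proof -
        have "2 * (q ^ 8 * ?n) \<le> q * (q ^ 8 * ?n)"
          using q by (intro mult_right_mono) (auto simp: vnorm_nonneg)
        then show ?thesis by (simp add: power_Suc[symmetric] mult.assoc[symmetric])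
      qed
      moreover have "\<bar>b i\<bar> \<le> q" using b[OF i] q by simp
      ultimately have "\<bar>b i - dot d (w i) p\<bar> \<le> q ^ 13 * \<bar>dot d (w i) v\<bar>"
        by (simp add: mult.commute)
      then show ?thesis by simp
    qed simp
    fix j assume j: "j < k"
    assume a: "dot d (w i) v \<noteq> 0" "dot d (w j) v \<noteq> 0"
       "\<bar>(b i - dot d (w i) p) / dot d (w i) v - (b j - dot d (w j) p) / dot d (w j) v\<bar> \<le> 1 / q ^ 29"
    from g have "\<forall>i<k. \<forall>j<k. \<not> (dot d (w i) v \<noteq> 0 \<and> dot d (w j) v \<noteq> 0 \<and>
        \<bar>(b i - dot d (w i) p) / dot d (w i) v - (b j - dot d (w j) p) / dot d (w j) v\<bar> \<le> 1 / q ^ 29 \<and>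
        vnorm d (\<lambda>l. w i l / dot d (w i) v - w j l / dot d (w j) v) > 1 / q ^ 24)"
      by (elim conjE)
    with i j a have "\<not> vnorm d (\<lambda>l. w i l / dot d (w i) v - w j l / dot d (w j) v) > 1 / q ^ 24"
      by blast
    then show "vnorm d (\<lambda>l. w i l / dot d (w i) v - w j l / dot d (w j) v) \<le> 1 / q ^ 24"
      by (simp only: not_less)
  next
    fix i n assume "i < k" "n \<le> 2 * Q ^ 42" "vnorm d (w i) > 0"
    then have "\<not> \<bar>dot d (w i) p + ((real n * (1 / q ^ 29) - q ^ 13) * dot d (w i) v - b i)\<bar>
        \<le> 1 / q ^ 47 * vnorm d (w i)"
      using g by blast
    then show "1 / q ^ 47 * vnorm d (w i)
        < \<bar>dot d (w i) (grid_point d (q ^ 13) (1 / q ^ 29) p v n) - b i\<bar>"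
      by (simp add: dot_grid_point add_diff_eq)
  qed (use Q V q0 in auto)
  also have "\<dots> \<le> 3 * (1 + X) / q ^ 4"
  proof -
    \<comment> \<open>Besides the term with \<open>X\<close>, the largest one is
      \<open>2 * \<rho> * T * V = 2 / q^9\<close>, which stems from merging kinks at the far ends of
      the scanned range.\<close>
    have i1: "1 / q ^ 29 + 2 * (1 / q ^ 24) * (X + q\<^sup>2 + q ^ 13 * q\<^sup>2) \<le> 2 * (1 + X) * (1 / q ^ 8)"
    proof -
      have e9: "1 / q ^ 9 \<le> 1 / q ^ 8 / 4"
        using one_div_power_Suc_le[OF q(1), of 8] by simp
      have e29: "1 / q ^ 29 \<le> 1 / q ^ 9" "1 / q ^ 22 \<le> 1 / q ^ 9" "1 / q ^ 24 \<le> 1 / q ^ 8"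
        using q0 by (auto intro!: one_div_power_le)
      have "1 / q ^ 24 * q\<^sup>2 = 1 / q ^ 22" "1 / q ^ 24 * (q ^ 13 * q\<^sup>2) = 1 / q ^ 9"
        using power_quotient[OF q0(2), of 2 22] power_quotient[OF q0(2), of 15 9]
        by (simp_all add: power_add[symmetric])
      then have c1: "1 / q ^ 29 + 2 * (1 / q ^ 24) * (X + q\<^sup>2 + q ^ 13 * q\<^sup>2)
          = 1 / q ^ 29 + 2 * (1 / q ^ 24 * X) + 2 * (1 / q ^ 22) + 2 * (1 / q ^ 9)"
        by (simp add: distrib_left mult.assoc)
      have c2: "1 / q ^ 24 * X \<le> 1 / q ^ 8 * X" using e29 X by (intro mult_right_mono) auto
      have c3: "2 * (1 + X) * (1 / q ^ 8) = 2 * (1 / q ^ 8) + 2 * (1 / q ^ 8 * X)"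
        by (simp add: algebra_simps add_divide_distrib)
      have c4: "0 < 1 / q ^ 8" using q0 by simp
      have "L \<le> S"
        if "L = a + 2 * y + 2 * b + 2 * c" "y \<le> z" "S = 2 * e + 2 * z" "0 < e" "c \<le> e / 4" "a \<le> c" "b \<le> c"
        for L S a b c e y z :: real
        using that by linarith
      from this[OF c1 c2 c3 c4 e9 e29(1,2)] show ?thesis .
    qed
    have i1n: "0 \<le> 1 / q ^ 29 + 2 * (1 / q ^ 24) * (X + q\<^sup>2 + q ^ 13 * q\<^sup>2)"
      using X q0 by simp
    have "real k * (R * q\<^sup>2 * (1 / q ^ 29 + 2 * (1 / q ^ 24) * (X + q\<^sup>2 + q ^ 13 * q\<^sup>2)))
        \<le> q * (q * q\<^sup>2 * (2 * (1 + X) * (1 / q ^ 8)))"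
      using Q q q0 i1 i1n X by (intro mult_mono mult_nonneg_nonneg) auto
    also have "\<dots> = 2 * (1 + X) / q ^ 4"
      using power_quotient[OF q0(2), of 4 4] q0 by (simp add: field_simps power2_eq_square power_numeral_reduce)
    finally have a: "real k * (R * q\<^sup>2 * (1 / q ^ 29 + 2 * (1 / q ^ 24) * (X + q\<^sup>2 + q ^ 13 * q\<^sup>2)))
        \<le> 2 * (1 + X) / q ^ 4" .
    have "X \<le> q\<^sup>2 * X" using X q0 mult_right_mono[of 1 "q\<^sup>2" X] by simp
    then have "X + q\<^sup>2 \<le> q\<^sup>2 * (1 + X)" by (simp add: distrib_left)
    then have "real k * (1 / q ^ 7 * (X + q\<^sup>2)) \<le> q * (1 / q ^ 7 * (q\<^sup>2 * (1 + X)))"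
      using q q0 X by (intro mult_mono mult_nonneg_nonneg) auto
    also have "\<dots> = (1 + X) / q ^ 4"
      using power_quotient[OF q0(2), of 3 4] q0 by (simp add: field_simps power2_eq_square power_numeral_reduce)
    finally show ?thesis using a by (simp add: X_def add_divide_distrib)
  qed
  finally have "(F x - relu_network d (line_net d F Q p v) x)\<^sup>2 \<le> (3 * (1 + X) / q ^ 4)\<^sup>2"
    using abs_le_square_iff[of "F x - relu_network d (line_net d F Q p v) x" "3 * (1 + X) / q ^ 4"] X q0 by simp
  also have "\<dots> = 9 * (1 + X)\<^sup>2 / (q ^ 4 * q ^ 4)"
    unfolding power_divide power_mult_distrib power2_eq_square[of "q ^ 4"] by simp
  also have "\<dots> \<le> 9 * (2 * (1 + X\<^sup>2)) / (q ^ 4 * q ^ 4)"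
    using sum_squares_bound[of 1 X] q0 by (intro divide_right_mono mult_left_mono) (auto simp: power2_sum)
  finally have "q ^ 4 * (F x - relu_network d (line_net d F Q p v) x)\<^sup>2
      \<le> q ^ 4 * (9 * (2 * (1 + X\<^sup>2)) / (q ^ 4 * q ^ 4))"
    using q0 by (intro mult_left_mono) auto
  also have "\<dots> = 9 * (2 * (1 + X\<^sup>2)) / q ^ 4"
  proof -
    have "y * (a / (y * y)) = a / y" if "y \<noteq> 0" for a y :: real using that by simp
    then show ?thesis using q0 by (metis power_not_zero)
  qed
  also have "\<dots> = 18 * (1 + X\<^sup>2) / q ^ 4" by simp
  also have "\<dots> \<le> 1 + X\<^sup>2"
  proof -
    have "4 ^ 4 \<le> q ^ 4" using q by (intro power_mono) auto
    then have "18 * (1 + X\<^sup>2) \<le> q ^ 4 * (1 + X\<^sup>2)" by (intro mult_right_mono) auto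
    then show ?thesis using q0 by (simp add: field_simps)
  qed
  finally show ?thesis by (simp add: passes_def q_def X_def vnorm_power2)
qed

text \<open>The crude bound is at most \<open>6 * q^45\<close> times
  \<open>2 * q^15 * (1 + X)\<close>; squaring gives the exponent \<open>120\<close>, and the
  remaining constant \<open>288\<close> is absorbed by \<open>q^5\<close>.\<close>

lemma line_net_crude:
  fixes d k Q :: nat and s b :: "nat \<Rightarrow> real" and w :: "nat \<Rightarrow> vec"
  assumes Q: "4 \<le> Q" "d \<le> Q" "k \<le> Q" "0 \<le> R" "R \<le> real Q"
    and s: "\<And>i. i < k \<Longrightarrow> \<bar>s i\<bar> \<le> 1" and w: "\<And>i. i < k \<Longrightarrow> vnorm d (w i) \<le> R"
    and short: "line_short d Q p v"
  defines "F \<equiv> neuron_sum d k s w b"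
  shows "(F x - relu_network d (line_net d F Q p v) x)\<^sup>2 \<le> real Q ^ 125 * (1 + (\<Sum>j<d. (x j)\<^sup>2))"
proof -
  define q where "q = real Q"
  have q: "4 \<le> q" "real k \<le> q" "real d \<le> q" "R \<le> q" using Q by (simp_all add: q_def)
  have q0: "0 < q" "q \<noteq> 0" "1 \<le> q" using q by simp_all
  have V: "vnorm d p \<le> q\<^sup>2" "vnorm d v \<le> q\<^sup>2"
    using short vnorm_le_of_sum[of p d v "q\<^sup>2"] by (auto simp: q_def power_mult[symmetric])
  define X where "X = vnorm d x"
  have X: "0 \<le> X" by (simp add: X_def vnorm_nonneg)
  have "\<bar>F x - relu_network d (line_net d F Q p v) x\<bar>
    \<le> (real k * R + real d * (real k * R) + real (2 * Q ^ 42) * (2 * real d * (real k * R)))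
        * (vnorm d x + q\<^sup>2 + q ^ 13 * q\<^sup>2)"
    unfolding line_net_def F_def q_def[symmetric]
  proof (rule scan_net_error_crude[where mid="Q ^ 42"])
    show "q ^ 13 = real (Q ^ 42) * (1 / q ^ 29)"
      using power_quotient[OF q0(2), of 29 13] q0 by (simp add: q_def field_simps flip: power_add)
  qed (use s w Q V q0 in auto)
  also have "\<dots> \<le> (6 * q ^ 45) * (2 * q ^ 15 * (1 + X))"
  proof (rule mult_mono)
    have kR: "real k * R \<le> q * q" using q Q by (intro mult_mono) auto
    have dkR: "real d * (real k * R) \<le> q * (q * q)" using q Q kR by (intro mult_mono) auto
    have "real k * R \<le> q ^ 45"
    proof -
      have "q ^ 2 \<le> q ^ 45" using q0 by (intro power_increasing) auto
      then show ?thesis using kR by (simp add: power2_eq_square)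
    qed
    moreover have "real d * (real k * R) \<le> q ^ 45"
    proof -
      have "q ^ 3 \<le> q ^ 45" using q0 by (intro power_increasing) auto
      then show ?thesis using dkR by (simp add: power3_eq_cube mult.assoc)
    qed
    moreover have "real (2 * Q ^ 42) * (2 * real d * (real k * R)) \<le> 4 * q ^ 45"
    proof -
      have "q ^ 42 * (real d * (real k * R)) \<le> q ^ 42 * (q * (q * q))"
        using dkR q0 by (intro mult_left_mono) auto
      also have "\<dots> = q ^ 45" using power_add[of q 42 3] by (simp add: power3_eq_cube mult.assoc)
      finally show ?thesis by (simp add: q_def mult.assoc)
    qed
    ultimately show "real k * R + real d * (real k * R) + real (2 * Q ^ 42) * (2 * real d * (real k * R)) \<le> 6 * q ^ 45"
      by linarith
    have "q ^ 13 * q\<^sup>2 = q ^ 15" by (simp add: power_add[symmetric])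
    moreover have "q\<^sup>2 \<le> q ^ 15" using q0 by (intro power_increasing) auto
    moreover have "X \<le> q ^ 15 * X" using X q0 mult_right_mono[of 1 "q ^ 15" X] by simp
    moreover have "2 * q ^ 15 * (1 + X) = 2 * q ^ 15 + 2 * (q ^ 15 * X)" by (simp add: algebra_simps)
    ultimately show "vnorm d x + q\<^sup>2 + q ^ 13 * q\<^sup>2 \<le> 2 * q ^ 15 * (1 + X)"
      using X unfolding X_def by linarith
  qed (use X q0 in \<open>auto simp: vnorm_nonneg\<close>)
  also have "\<dots> = 12 * q ^ 60 * (1 + X)"
    using power_add[of q 45 15] by simp
  finally have "(F x - relu_network d (line_net d F Q p v) x)\<^sup>2 \<le> (12 * q ^ 60 * (1 + X))\<^sup>2"
    using abs_le_square_iff[of "F x - relu_network d (line_net d F Q p v) x" "12 * q ^ 60 * (1 + X)"] X q0 by simp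
  also have "\<dots> = 144 * q ^ 120 * (1 + X)\<^sup>2"
    by (simp add: power_mult_distrib power_mult[symmetric])
  also have "\<dots> \<le> 144 * q ^ 120 * (2 * (1 + X\<^sup>2))"
    using sum_squares_bound[of 1 X] q0 by (intro mult_left_mono) (auto simp: power2_sum)
  also have "\<dots> = q ^ 120 * (288 * (1 + X\<^sup>2))" by simp
  also have "\<dots> \<le> q ^ 120 * (q ^ 5 * (1 + X\<^sup>2))"
  proof -
    have "4 ^ 5 \<le> q ^ 5" using q by (intro power_mono) auto
    then show ?thesis using q0 by (intro mult_left_mono mult_right_mono) auto
  qed
  also have "\<dots> = q ^ 125 * (1 + X\<^sup>2)" using power_add[of q 120 5] by simp
  finally show ?thesis by (simp add: q_def X_def vnorm_power2)
qed

text \<open>Where the test is passed, the tolerance integrates to about \<open>d / q^4\<close>. On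
  the failure set the error can be of size \<open>q^125 * (1 + n x)\<close>; a fourth moment
  together with the smallness of that set makes its contribution negligible.\<close>

lemma line_net_accepted_error:
  fixes d k Q :: nat and s b :: "nat \<Rightarrow> real" and w :: "nat \<Rightarrow> vec"
  assumes Q: "4 \<le> Q" "1 \<le> d" "d \<le> Q" "k \<le> Q" "0 \<le> R" "R \<le> real Q"
    and s: "\<And>i. i < k \<Longrightarrow> \<bar>s i\<bar> \<le> 1" and w: "\<And>i. i < k \<Longrightarrow> vnorm d (w i) \<le> R"
    and short: "line_short d Q p v"
  defines "F \<equiv> neuron_sum d k s w b"
  assumes fail: "emeasure (std_normal_vec d) {x \<in> space (std_normal_vec d).
      \<not> passes d (real Q ^ 4) F (relu_network d (line_net d F Q p v)) x} \<le> ennreal (1 / real Q ^ 262)"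
  shows "expected_sq_error d F (relu_network d (line_net d F Q p v)) \<le> ennreal (1 / real Q)"
proof -
  let ?N = "std_normal_vec d"
  interpret prob_space ?N by (rule prob_space_std_normal_vec)
  define q where "q = real Q"
  have q: "4 \<le> q" "real d \<le> q" using Q by (simp_all add: q_def)
  have q0: "0 < q" "q \<noteq> 0" "1 \<le> q" using q by simp_all
  define G where "G = relu_network d (line_net d F Q p v)"
  define n where "n x = (\<Sum>j<d. (x j)\<^sup>2)" for x :: vec
  define bad where "bad = {x \<in> space ?N. \<not> passes d (q ^ 4) F G x}"
  have n0: "0 \<le> n x" for x by (simp add: n_def sum_nonneg)
  have c: "(\<lambda>x. x j) \<in> borel_measurable ?N" if "j < d" for j
    using that by (rule measurable_std_normal_vec_component)
  have [measurable]: "n \<in> borel_measurable ?N"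
    unfolding n_def[abs_def] using c by (intro borel_measurable_sum borel_measurable_power) auto
  have [measurable]: "F \<in> borel_measurable ?N"
    unfolding F_def using measurable_neuron_sum[of d "\<lambda>x. x" ?N k s w b] c by simp
  have [measurable]: "G \<in> borel_measurable ?N"
    unfolding G_def line_net_def F_def
    using measurable_scan_net[of d "\<lambda>_. p" ?N "\<lambda>_. v" "\<lambda>x. x" k s w b] c by simp
  have bad[measurable]: "bad \<in> sets ?N"
    unfolding bad_def passes_def n_def[symmetric] not_le
    by (intro borel_measurable_less borel_measurable_times borel_measurable_power borel_measurable_diff
        borel_measurable_add) measurable
  have bad_le: "emeasure ?N bad \<le> ennreal (1 / q ^ 262)"
    using fail by (simp add: bad_def q_def G_def)
  have pw: "(F x - G x)\<^sup>2 \<le> 1 / q ^ 4 * (1 + n x) + 1 / q ^ 6 * (1 + n x)\<^sup>2 + q ^ 256 * indicator bad x"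
    if x: "x \<in> space ?N" for x
  proof (cases "x \<in> bad")
    case False
    then have "q ^ 4 * (F x - G x)\<^sup>2 \<le> 1 + n x" using x by (simp add: bad_def passes_def n_def)
    then have "(F x - G x)\<^sup>2 \<le> 1 / q ^ 4 * (1 + n x)" using q0 by (simp add: field_simps)
    moreover have "0 \<le> 1 / q ^ 6 * (1 + n x)\<^sup>2" using q0 by simp
    moreover have "q ^ 256 * indicator bad x = 0" using False by simp
    ultimately show ?thesis by linarith
  next
    case True
    have "(F x - G x)\<^sup>2 \<le> q ^ 125 * (1 + n x)"
      unfolding F_def G_def q_def n_def
      by (rule line_net_crude[OF Q(1,3-6) s w short])
    \<comment> \<open>A pointwise AM-GM in place of Cauchy-Schwarz. The weight \<open>q^3\<close>
      leaves \<open>1 / q^6\<close> in front of the fourth moment, which is at most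
      \<open>8 * q^2\<close>; the other term is \<open>q^256\<close> on the failure set, and the
      measure \<open>1 / q^262\<close> brings it down to \<open>1 / q^6\<close>.\<close>
    also have "q ^ 125 * (1 + n x) \<le> 1 / q ^ 6 * (1 + n x)\<^sup>2 + q ^ 256"
    proof -
      let ?t = "1 / q ^ 3 * (1 + n x)"
      have "2 * ?t * q ^ 128 \<le> ?t\<^sup>2 + (q ^ 128)\<^sup>2" by (rule sum_squares_bound)
      moreover have "?t * q ^ 128 = q ^ 125 * (1 + n x)" using q0 by (simp add: field_simps)
      moreover have "?t\<^sup>2 = 1 / q ^ 6 * (1 + n x)\<^sup>2"
        by (simp add: power_divide power_mult[symmetric])
      moreover have "(q ^ 128)\<^sup>2 = q ^ 256" by (simp add: power_mult[symmetric])
      moreover have "0 \<le> q ^ 125 * (1 + n x)" using q0 n0[of x] by simp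
      ultimately show ?thesis by linarith
    qed
    moreover have "0 \<le> 1 / q ^ 4 * (1 + n x)" using q0 n0[of x] by simp
    moreover have "q ^ 256 * indicator bad x = q ^ 256" using True by simp
    ultimately show ?thesis by linarith
  qed
  have "expected_sq_error d F G \<le> (\<integral>\<^sup>+x. ennreal (1 / q ^ 4 * (1 + n x) + 1 / q ^ 6 * (1 + n x)\<^sup>2
      + q ^ 256 * indicator bad x) \<partial>?N)"
    unfolding expected_sq_error_def by (intro nn_integral_mono ennreal_leI pw)
  also have "\<dots> = (\<integral>\<^sup>+x. ennreal (1 / q ^ 4) * (1 + ennreal (n x)) + ennreal (1 / q ^ 6) * ennreal ((1 + n x)\<^sup>2)
      + ennreal (q ^ 256) * indicator bad x \<partial>?N)"
  proof (rule nn_integral_cong)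
    fix x
    have "ennreal (1 / q ^ 4 * (1 + n x) + 1 / q ^ 6 * (1 + n x)\<^sup>2 + q ^ 256 * indicator bad x)
      = ennreal (1 / q ^ 4 * (1 + n x)) + ennreal (1 / q ^ 6 * (1 + n x)\<^sup>2) + ennreal (q ^ 256 * indicator bad x)"
      using q0 n0[of x] by (simp add: ennreal_plus)
    also have "ennreal (1 / q ^ 4 * (1 + n x)) = ennreal (1 / q ^ 4) * (1 + ennreal (n x))"
      using q0 n0[of x] by (subst ennreal_mult) auto
    also have "ennreal (1 / q ^ 6 * (1 + n x)\<^sup>2) = ennreal (1 / q ^ 6) * ennreal ((1 + n x)\<^sup>2)"
      using q0 by (intro ennreal_mult) auto
    also have "ennreal (q ^ 256 * indicator bad x) = ennreal (q ^ 256) * indicator bad x"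
      by (simp add: indicator_def)
    finally show "ennreal (1 / q ^ 4 * (1 + n x) + 1 / q ^ 6 * (1 + n x)\<^sup>2 + q ^ 256 * indicator bad x)
      = ennreal (1 / q ^ 4) * (1 + ennreal (n x)) + ennreal (1 / q ^ 6) * ennreal ((1 + n x)\<^sup>2)
      + ennreal (q ^ 256) * indicator bad x" .
  qed
  also have "\<dots> = ennreal (1 / q ^ 4) * (1 + (\<integral>\<^sup>+x. ennreal (n x) \<partial>?N))
      + ennreal (1 / q ^ 6) * (\<integral>\<^sup>+x. ennreal ((1 + n x)\<^sup>2) \<partial>?N) + ennreal (q ^ 256) * emeasure ?N bad"
    by (simp add: nn_integral_add nn_integral_cmult nn_integral_cmult_indicator emeasure_space_1)
  also have "\<dots> \<le> ennreal (1 / q ^ 4) * ennreal (1 + q)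
      + ennreal (1 / q ^ 6) * ennreal (8 * q\<^sup>2) + ennreal (q ^ 256) * ennreal (1 / q ^ 262)"
  proof (intro add_mono mult_left_mono bad_le)
    show "1 + (\<integral>\<^sup>+x. ennreal (n x) \<partial>?N) \<le> ennreal (1 + q)"
      using q q0 unfolding n_def std_normal_vec_second_moment
      by (simp add: ennreal_of_nat_eq_real_of_nat ennreal_plus[symmetric] ennreal_1[symmetric] del: ennreal_plus ennreal_1)
    have "ennreal (8 * (real d)\<^sup>2) \<le> ennreal (8 * q\<^sup>2)"
      using q by (intro ennreal_leI mult_left_mono power_mono) auto
    then show "(\<integral>\<^sup>+x. ennreal ((1 + n x)\<^sup>2) \<partial>?N) \<le> ennreal (8 * q\<^sup>2)"
      unfolding n_def by (rule order_trans[OF std_normal_vec_fourth_moment_le[OF Q(2)]])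
  qed auto
  also have "\<dots> = ennreal (1 / q ^ 4 * (1 + q) + 1 / q ^ 6 * (8 * q\<^sup>2) + q ^ 256 * (1 / q ^ 262))"
    using q0 by (simp add: ennreal_mult[symmetric] ennreal_plus[symmetric] del: ennreal_plus)
  also have "\<dots> \<le> ennreal (1 / q)"
  proof (rule ennreal_leI)
    have arith: "e + c + 8 * e + f \<le> a"
      if "f \<le> e" "e \<le> c / 4" "c \<le> b / 4" "b \<le> a / 4" "0 < a" for a b c e f :: real
      using that by linarith
    have e: "1 / q ^ 4 * (1 + q) = 1 / q ^ 4 + 1 / q ^ 3" "1 / q ^ 6 * (8 * q\<^sup>2) = 8 * (1 / q ^ 4)"
        "q ^ 256 * (1 / q ^ 262) = 1 / q ^ 6"
      using power_quotient[OF q0(2), of 1 3] power_quotient[OF q0(2), of 2 4] power_quotient[OF q0(2), of 256 6] q0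
      by (simp_all add: distrib_left)
    have "1 / q ^ 6 \<le> 1 / q ^ 4" using q0 by (intro one_div_power_le) auto
    moreover have "1 / q ^ 4 \<le> 1 / q ^ 3 / 4" "1 / q ^ 3 \<le> 1 / q ^ 2 / 4" "1 / q ^ 2 \<le> 1 / q / 4"
      using one_div_power_Suc_le[OF q(1), of 3] one_div_power_Suc_le[OF q(1), of 2]
        one_div_power_Suc_le[OF q(1), of 1] by (simp_all add: power2_eq_square)
    moreover have "0 < 1 / q" using q0 by simp
    ultimately show "1 / q ^ 4 * (1 + q) + 1 / q ^ 6 * (8 * q\<^sup>2) + q ^ 256 * (1 / q ^ 262) \<le> 1 / q"
      unfolding e by (rule arith)
  qed
  finally show ?thesis by (simp add: G_def q_def)
qed

text \<open>With the chosen exponents the four failure probabilities are at most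
  \<open>2 / q^3\<close>, \<open>3 / q^3\<close>, \<open>1 / q^2\<close> and \<open>1 / q^2\<close>,
  which for \<open>q\<close> at least \<open>4\<close> leaves ample room.\<close>

lemma line_good_measure:
  fixes d k Q :: nat and w :: "nat \<Rightarrow> vec"
  assumes Q: "4 \<le> Q" "d \<le> Q" "k \<le> Q"
  shows "{x \<in> space (round_space d m). \<not> line_good d k w b Q (x 0) (x 1)} \<in> sets (round_space d m)"
    and "emeasure (round_space d m) {x \<in> space (round_space d m). \<not> line_good d k w b Q (x 0) (x 1)}
      \<le> ennreal (1 / 2)"
proof -
  define q where "q = real Q"
  have q: "4 \<le> q" "real k \<le> q" "real d \<le> q" using Q by (simp_all add: q_def)
  have q0: "0 < q" "q \<noteq> 0" "1 \<le> q" using q by simp_all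
  have pos: "0 < 1 / q ^ 47" "0 < 1 / q ^ 29" "0 < 1 / q ^ 24" "0 < 1 / q ^ 7" "0 < 1 / q ^ 4" "0 < q\<^sup>2"
    using q0 by auto
  note G = good_line_measure[OF pos, where d=d and k=k and m=m and w=w and b=b and T="q ^ 13" and N="2 * Q ^ 42",
      folded line_good_def[unfolded q_def[symmetric]]]
  show "{x \<in> space (round_space d m). \<not> line_good d k w b Q (x 0) (x 1)} \<in> sets (round_space d m)"
    unfolding line_good_def q_def[symmetric] by (rule G(1))
  have "2 * real d / (q\<^sup>2)\<^sup>2 + real k * (real (2 * Q ^ 42) + 1) * (1 / q ^ 47 * real d)
      + (real k)\<^sup>2 * (1 / q ^ 29 * real d / (1 / q ^ 24)) + real k * (1 / q ^ 4 * real d) \<le> 1 / 2"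
  proof -
    have a1: "2 * real d / (q\<^sup>2)\<^sup>2 \<le> 2 * (1 / q ^ 3)"
    proof -
      have "2 * real d / (q\<^sup>2)\<^sup>2 \<le> 2 * q / (q\<^sup>2)\<^sup>2" using q q0 by (intro divide_right_mono) auto
      also have "\<dots> = 2 * (1 / q ^ 3)" using q0 by (simp add: field_simps power2_eq_square power3_eq_cube)
      finally show ?thesis .
    qed
    have a2: "real k * (real (2 * Q ^ 42) + 1) * (1 / q ^ 47 * real d) \<le> 3 * (1 / q ^ 3)"
    proof -
      have "real (2 * Q ^ 42) + 1 \<le> 3 * q ^ 42" using q0 by (simp add: q_def[symmetric])
      then have "real k * (real (2 * Q ^ 42) + 1) * (1 / q ^ 47 * real d) \<le> q * (3 * q ^ 42) * (1 / q ^ 47 * q)"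
        using q q0 by (intro mult_mono mult_nonneg_nonneg) auto
      also have "\<dots> = 3 * (q ^ 44 / q ^ (44 + 3))" using power_add[of q 42 2] by (simp add: power2_eq_square)
      also have "\<dots> = 3 * (1 / q ^ 3)" unfolding power_quotient[OF q0(2)] ..
      finally show ?thesis .
    qed
    have a3: "(real k)\<^sup>2 * (1 / q ^ 29 * real d / (1 / q ^ 24)) \<le> 1 / q ^ 2"
    proof -
      have "(real k)\<^sup>2 * (1 / q ^ 29 * real d / (1 / q ^ 24)) \<le> q\<^sup>2 * (1 / q ^ 29 * q / (1 / q ^ 24))"
        using q q0 by (intro mult_mono power_mono divide_right_mono mult_left_mono mult_nonneg_nonneg) auto
      also have "\<dots> = q ^ 27 / q ^ (27 + 2)" using power_add[of q 24 3] by (simp add: power2_eq_square power3_eq_cube)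
      also have "\<dots> = 1 / q ^ 2" unfolding power_quotient[OF q0(2)] ..
      finally show ?thesis .
    qed
    have a4: "real k * (1 / q ^ 4 * real d) \<le> 1 / q ^ 2"
    proof -
      have "real k * (1 / q ^ 4 * real d) \<le> q * (1 / q ^ 4 * q)"
        using q q0 by (intro mult_mono mult_nonneg_nonneg) auto
      also have "\<dots> = q ^ 2 / q ^ (2 + 2)" by (simp add: power2_eq_square)
      also have "\<dots> = 1 / q ^ 2" unfolding power_quotient[OF q0(2)] ..
      finally show ?thesis .
    qed
    have "4 ^ 2 \<le> q ^ 2" "4 ^ 3 \<le> q ^ 3" using q by (simp_all only: power_mono)
    then have "1 / q ^ 2 \<le> 1 / 16" "1 / q ^ 3 \<le> 1 / 64"
      using frac_le[of 1 1 16 "q ^ 2"] frac_le[of 1 1 64 "q ^ 3"] by simp_all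
    then show ?thesis using a1 a2 a3 a4 by linarith
  qed
  then show "emeasure (round_space d m) {x \<in> space (round_space d m). \<not> line_good d k w b Q (x 0) (x 1)}
      \<le> ennreal (1 / 2)"
    unfolding line_good_def q_def[symmetric] by (intro order_trans[OF G(2)] ennreal_leI)
qed

section \<open>Independent rounds\<close>

text \<open>With \<open>H = Q^262\<close>, each batch of \<open>H\<close> tests halves the chance
  that a candidate failing with probability \<open>1 / H\<close> survives.\<close>

lemma one_minus_inverse_power_le_half:
  fixes H :: nat
  assumes "1 \<le> H"
  shows "(1 - 1 / real H) ^ H \<le> 1 / 2"
proof -
  have "(1 - 1 / real H) ^ H \<le> exp (- (1 / real H)) ^ H"
    using assms exp_ge_add_one_self[of "- (1 / real H)"] by (intro power_mono) auto
  also have "\<dots> = exp (- 1)" using assms by (simp add: exp_of_nat_mult[symmetric])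
  also have "\<dots> \<le> 1 / 2"
    using exp_ge_add_one_self[of 1] by (simp add: exp_minus field_simps)
  finally show ?thesis .
qed

text \<open>The index is the order in which the program draws: round by round, vector by vector,
  coordinate by coordinate, with \<open>(m + 2) * d\<close> samples for each round.\<close>

definition round_vec :: "nat \<Rightarrow> nat \<Rightarrow> (nat \<Rightarrow> real) \<Rightarrow> nat \<Rightarrow> nat \<Rightarrow> vec" where
  "round_vec d m \<omega> j l = (\<lambda>i\<in>{..<d}. \<omega> ((j * (m + 2) + l) * d + i))"

definition accepted :: "nat \<Rightarrow> (vec \<Rightarrow> real) \<Rightarrow> nat \<Rightarrow> nat \<Rightarrow> (nat \<Rightarrow> vec) \<Rightarrow> bool" where
  "accepted d F Q m x \<longleftrightarrow> line_short d Q (x 0) (x 1) \<and>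
     (\<forall>i<m. passes d (real Q ^ 4) F (relu_network d (line_net d F Q (x 0) (x 1))) (x (i + 2)))"

text \<open>The failure probability is split evenly. No round is good with probability at most
  \<open>2^-M\<close>, by independence; some round satisfies \<open>S\<close> with probability at
  most \<open>M * 2^(-2 * M)\<close>, by a union bound. The condition on \<open>M\<close> makes each
  at most \<open>\<delta> / 2\<close>.\<close>

lemma rounds_probability:
  fixes d m M :: nat and \<delta> :: real
  assumes d: "1 \<le> d"
    and G: "{x \<in> space (round_space d m). \<not> G x} \<in> sets (round_space d m)"
      "emeasure (round_space d m) {x \<in> space (round_space d m). \<not> G x} \<le> ennreal (1 / 2)"
    and S: "{x \<in> space (round_space d m). S x} \<in> sets (round_space d m)"
      "emeasure (round_space d m) {x \<in> space (round_space d m). S x} \<le> ennreal (1 / 2 ^ (2 * M))"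
    and \<delta>: "2 \<le> \<delta> * 2 ^ M"
  shows "\<exists>E\<in>sets gaussian_sequence. measure gaussian_sequence E \<ge> 1 - \<delta> \<and>
    (\<forall>\<omega>\<in>E. (\<exists>j<M. G (\<lambda>l\<in>{..<m + 2}. round_vec d m \<omega> j l)) \<and>
            (\<forall>j<M. \<not> S (\<lambda>l\<in>{..<m + 2}. round_vec d m \<omega> j l)))"
proof -
  let ?N = "std_normal_vec d" and ?R = "round_space d m"
  let ?V = "\<Pi>\<^sub>M q\<in>(UNIV::nat set). ?N" and ?RR = "\<Pi>\<^sub>M q\<in>(UNIV::nat set). ?R"
  interpret N: prob_space ?N by (rule prob_space_std_normal_vec)
  interpret R: prob_space ?R by (rule prob_space_PiM) (rule N.prob_space_axioms)
  interpret RR: product_prob_space "\<lambda>_::nat. ?R" UNIV ..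
  define f1 :: "(nat \<Rightarrow> real) \<Rightarrow> nat \<Rightarrow> vec" where "f1 \<omega> q = (\<lambda>l\<in>{..<d}. \<omega> (q * d + l))" for \<omega> q
  define f2 :: "(nat \<Rightarrow> vec) \<Rightarrow> nat \<Rightarrow> nat \<Rightarrow> vec" where "f2 x q = (\<lambda>l\<in>{..<m + 2}. x (q * (m + 2) + l))" for x q
  have D1: "distr gaussian_sequence ?V f1 = ?V"
    unfolding gaussian_sequence_def f1_def[abs_def] std_normal_vec_def
    using d by (intro distr_PiM_blocks prob_space_std_normal) auto
  have D2: "distr ?V ?RR f2 = ?RR"
    unfolding f2_def[abs_def] by (intro distr_PiM_blocks N.prob_space_axioms) auto
  have m1: "f1 \<in> measurable gaussian_sequence ?V"
  proof -
    have "(\<lambda>\<omega>. \<lambda>q\<in>UNIV. f1 \<omega> q) \<in> measurable gaussian_sequence ?V"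
      unfolding gaussian_sequence_def f1_def std_normal_vec_def
      by (intro measurable_restrict measurable_component_singleton) auto
    then show ?thesis by (simp only: restrict_UNIV)
  qed
  have m2: "f2 \<in> measurable ?V ?RR"
  proof -
    have "(\<lambda>x. \<lambda>q\<in>UNIV. f2 x q) \<in> measurable ?V ?RR"
      unfolding f2_def by (intro measurable_restrict measurable_component_singleton) auto
    then show ?thesis by (simp only: restrict_UNIV)
  qed
  have m21: "(\<lambda>\<omega>. f2 (f1 \<omega>)) \<in> measurable gaussian_sequence ?RR"
    by (rule measurable_compose[OF m1 m2])
  have D: "distr gaussian_sequence ?RR (\<lambda>\<omega>. f2 (f1 \<omega>)) = ?RR"
    using distr_distr[OF m2 m1] unfolding D1 D2 comp_def by simp
  let ?NG = "{x \<in> space ?R. \<not> G x}" and ?S = "{x \<in> space ?R. S x}"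
  define A where "A = prod_emb UNIV (\<lambda>_. ?R) {..<M} (PiE {..<M} (\<lambda>_. ?NG))"
  define B where "B j = (\<lambda>\<xi>. \<xi> j) -` ?S \<inter> space ?RR" for j :: nat
  have A: "A \<in> sets ?RR" unfolding A_def using G(1) by (intro sets_PiM_I) auto
  have B: "B j \<in> sets ?RR" for j
    unfolding B_def using S(1) by (intro measurable_sets[OF measurable_component_singleton]) auto
  have half: "(1 / 2 :: real) ^ M \<le> \<delta> / 2" using \<delta> by (simp add: power_one_over field_simps)
  have eA: "emeasure ?RR A \<le> ennreal (\<delta> / 2)"
  proof -
    have "emeasure ?RR A = (\<Prod>j\<in>{..<M}. emeasure ?R ?NG)"
      unfolding A_def using G(1) by (intro RR.emeasure_PiM_emb) auto
    also have "\<dots> \<le> (\<Prod>j\<in>{..<M}. ennreal (1 / 2))"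
      using G(2) by (simp add: power_mono)
    also have "\<dots> = ennreal ((1 / 2) ^ M)" by (subst prod_ennreal) auto
    also have "\<dots> \<le> ennreal (\<delta> / 2)" using half by (rule ennreal_leI)
    finally show ?thesis .
  qed
  have eB: "emeasure ?RR (B j) \<le> ennreal (1 / 2 ^ (2 * M))" for j
  proof -
    have "emeasure ?RR (B j) = emeasure (distr ?RR ?R (\<lambda>\<xi>. \<xi> j)) ?S"
      unfolding B_def using S(1) by (intro emeasure_distr[symmetric] measurable_component_singleton) auto
    then show ?thesis using S(2) RR.PiM_component[of j] by simp
  qed
  have eBU: "emeasure ?RR (\<Union>j\<in>{..<M}. B j) \<le> ennreal (\<delta> / 2)"
  proof -
    have "emeasure ?RR (\<Union>j\<in>{..<M}. B j) \<le> (\<Sum>j\<in>{..<M}. emeasure ?RR (B j))"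
      using B by (intro emeasure_subadditive_finite) auto
    also have "\<dots> \<le> (\<Sum>j\<in>{..<M}. ennreal (1 / 2 ^ (2 * M)))" by (intro sum_mono eB)
    also have "\<dots> = ennreal (real M * (1 / 2 ^ (2 * M)))" by (subst sum_const_ennreal) auto
    also have "\<dots> \<le> ennreal (\<delta> / 2)"
    proof (rule ennreal_leI)
      \<comment> \<open>The union over the rounds is paid for by one of the two factors
        \<open>2^-M\<close>; hence the exponent \<open>2 * M\<close> in the hypothesis on
        \<open>S\<close>.\<close>
      have "real M \<le> 2 ^ M" by (rule less_imp_le) (rule of_nat_less_two_power)
      then have "real M * (1 / 2 ^ (2 * M)) \<le> 2 ^ M * (1 / 2 ^ (2 * M))"
        by (intro mult_right_mono) auto
      also have "\<dots> = (1 / 2) ^ M" by (simp add: mult_2 power_add power_one_over)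
      finally show "real M * (1 / 2 ^ (2 * M)) \<le> \<delta> / 2" using half by linarith
    qed
    finally show ?thesis .
  qed
  define E' where "E' = space ?RR - (A \<union> (\<Union>j\<in>{..<M}. B j))"
  have BU: "(\<Union>j\<in>{..<M}. B j) \<in> sets ?RR" using B by auto
  have E': "E' \<in> sets ?RR" unfolding E'_def using A BU by auto
  have \<delta>0: "0 \<le> \<delta>" proof -
    have "0 < \<delta> * 2 ^ M" using \<delta> by simp
    then show ?thesis by (simp add: zero_less_mult_iff)
  qed
  have "measure ?RR (A \<union> (\<Union>j\<in>{..<M}. B j)) \<le> \<delta>"
  proof -
    have "emeasure ?RR (A \<union> (\<Union>j\<in>{..<M}. B j)) \<le> ennreal (\<delta> / 2) + ennreal (\<delta> / 2)"
      using A BU by (intro order_trans[OF emeasure_subadditive] add_mono eA eBU)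
    also have "\<dots> = ennreal \<delta>" using \<delta>0 by (simp add: ennreal_plus[symmetric] del: ennreal_plus)
    finally show ?thesis
      using \<delta>0 by (simp add: measure_def enn2real_leI)
  qed
  then have mE': "1 - \<delta> \<le> measure ?RR E'"
    unfolding E'_def using A BU by (subst RR.P.prob_compl) auto
  let ?E = "(\<lambda>\<omega>. f2 (f1 \<omega>)) -` E' \<inter> space gaussian_sequence"
  show ?thesis
  proof (intro bexI[of _ ?E] conjI ballI)
    show "?E \<in> sets gaussian_sequence" by (rule measurable_sets[OF m21 E'])
    show "1 - \<delta> \<le> measure gaussian_sequence ?E"
      using measure_distr[OF m21 E'] mE' unfolding D by simp
    fix \<omega> assume \<omega>: "\<omega> \<in> ?E"
    then have in_space: "f2 (f1 \<omega>) \<in> space ?RR" by (simp add: E'_def)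
    have eq: "f2 (f1 \<omega>) j = (\<lambda>l\<in>{..<m + 2}. round_vec d m \<omega> j l)" for j
      by (simp add: f1_def f2_def round_vec_def)
    have sp: "f2 (f1 \<omega>) j \<in> space ?R" for j using in_space by (auto simp: space_PiM)
    show "\<exists>j<M. G (\<lambda>l\<in>{..<m + 2}. round_vec d m \<omega> j l)"
    proof (rule ccontr)
      assume "\<not> ?thesis"
      then have "\<And>j. j < M \<Longrightarrow> f2 (f1 \<omega>) j \<in> ?NG" using sp unfolding eq[symmetric] by blast
      then have "f2 (f1 \<omega>) \<in> A" using sp unfolding A_def prod_emb_def by (auto simp: PiE_iff)
      with \<omega> show False by (simp add: E'_def)
    qed
    show "\<forall>j<M. \<not> S (\<lambda>l\<in>{..<m + 2}. round_vec d m \<omega> j l)"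
    proof (intro allI impI notI)
      fix j assume "j < M" "S (\<lambda>l\<in>{..<m + 2}. round_vec d m \<omega> j l)"
      then have "f2 (f1 \<omega>) \<in> B j" using sp in_space unfolding B_def eq[symmetric] by simp
      with \<open>j < M\<close> \<omega> show False by (auto simp: E'_def)
    qed
  qed
qed

text \<open>A good round is accepted outright, since its candidate passes at every point. An
  accepted round need not be good: it only has to avoid the event that a candidate failing with
  probability above \<open>1 / Q^262\<close> survives all tests, and this already bounds its
  expected error.\<close>

lemma accepted_probability:
  fixes d k Q M :: nat and s b :: "nat \<Rightarrow> real" and w :: "nat \<Rightarrow> vec" and R B \<delta> :: real
  assumes Q: "4 \<le> Q" "1 \<le> d" "d \<le> Q" "k \<le> Q" "0 \<le> R" "R \<le> real Q" "B \<le> real Q"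
    and s: "\<And>i. i < k \<Longrightarrow> \<bar>s i\<bar> \<le> 1" and w: "\<And>i. i < k \<Longrightarrow> vnorm d (w i) \<le> R"
    and b: "\<And>i. i < k \<Longrightarrow> \<bar>b i\<bar> \<le> B"
    and \<delta>: "2 \<le> \<delta> * 2 ^ M"
  defines "F \<equiv> neuron_sum d k s w b" and "m \<equiv> 2 * M * Q ^ 262"
  shows "\<exists>E\<in>sets gaussian_sequence. measure gaussian_sequence E \<ge> 1 - \<delta> \<and>
    (\<forall>\<omega>\<in>E. (\<exists>j<M. accepted d F Q m (round_vec d m \<omega> j)) \<and>
      (\<forall>j<M. accepted d F Q m (round_vec d m \<omega> j) \<longrightarrow>
        expected_sq_error d F (relu_network d (line_net d F Q (round_vec d m \<omega> j 0) (round_vec d m \<omega> j 1)))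
          \<le> ennreal (1 / real Q)))"
proof -
  let ?N = "std_normal_vec d" and ?R = "round_space d m"
  interpret N: prob_space ?N by (rule prob_space_std_normal_vec)
  define Ps where "Ps p v y \<longleftrightarrow> passes d (real Q ^ 4) F (relu_network d (line_net d F Q p v)) y" for p v y
  define Bd where "Bd p v \<longleftrightarrow> line_short d Q p v \<and>
      \<not> emeasure ?N {y \<in> space ?N. \<not> Ps p v y} \<le> ennreal (1 / real Q ^ 262)" for p v
  define G where "G x \<longleftrightarrow> line_good d k w b Q (x 0) (x 1)" for x :: "nat \<Rightarrow> vec"
  define S where "S x \<longleftrightarrow> Bd (x 0) (x 1) \<and> (\<forall>i<m. Ps (x 0) (x 1) (x (i + 2)))" for x :: "nat \<Rightarrow> vec"
  have cN: "(\<lambda>y. y j) \<in> borel_measurable ?N" if "j < d" for j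
    using that by (rule measurable_std_normal_vec_component)
  have Ps_meas: "{\<omega> \<in> space K. Ps (p \<omega>) (v \<omega>) (x \<omega>)} \<in> sets K"
    if "\<And>j. j < d \<Longrightarrow> (\<lambda>\<omega>. p \<omega> j) \<in> borel_measurable K" "\<And>j. j < d \<Longrightarrow> (\<lambda>\<omega>. v \<omega> j) \<in> borel_measurable K"
      "\<And>j. j < d \<Longrightarrow> (\<lambda>\<omega>. x \<omega> j) \<in> borel_measurable K"
    for K and p v x :: "'z \<Rightarrow> vec"
    unfolding Ps_def passes_def F_def line_net_def using that
    by (intro borel_measurable_le borel_measurable_times borel_measurable_power borel_measurable_diff
        borel_measurable_add borel_measurable_sum measurable_neuron_sum measurable_scan_net borel_measurable_const) auto
  have sub: "{y \<in> space ?N. Ps p v y} \<in> sets ?N" for p v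
    using Ps_meas[of "\<lambda>_. p" ?N "\<lambda>_. v" "\<lambda>y. y"] cN by simp
  have cR: "(\<lambda>x. x l j) \<in> borel_measurable ?R" if "l < m + 2" "j < d" for l j
    using that by (rule measurable_round_component)
  \<comment> \<open>The failure probability is a measurable function of the line, as the measure of
    the sections of a measurable set in the product of round and test point.\<close>
  have Bd_meas: "{x \<in> space ?R. Bd (x 0) (x 1)} \<in> sets ?R"
  proof -
    have "(\<lambda>x. emeasure ?N {y \<in> space ?N. \<not> Ps (x 0) (x 1) y}) \<in> borel_measurable ?R"
    proof (rule N.measurable_emeasure)
      let ?P = "?R \<Otimes>\<^sub>M ?N"
      have c: "(\<lambda>z. fst z l j) \<in> borel_measurable ?P" if "l < m + 2" "j < d" for l j
        using measurable_compose[OF measurable_fst cR[OF that]] .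
      have "{z \<in> space ?P. Ps (fst z 0) (fst z 1) (snd z)} \<in> sets ?P"
      proof (rule Ps_meas)
        fix j assume j: "j < d"
        show "(\<lambda>z. fst z 0 j) \<in> borel_measurable ?P" by (rule c[OF _ j]) simp
        show "(\<lambda>z. fst z 1 j) \<in> borel_measurable ?P" by (rule c[OF _ j]) simp
        show "(\<lambda>z. snd z j) \<in> borel_measurable ?P"
          using measurable_compose[OF measurable_snd cN[OF j]] .
      qed
      then have "space ?P - {z \<in> space ?P. Ps (fst z 0) (fst z 1) (snd z)} \<in> sets ?P" by blast
      also have "space ?P - {z \<in> space ?P. Ps (fst z 0) (fst z 1) (snd z)}
          = {x \<in> space ?P. snd x \<in> {y \<in> space ?N. \<not> Ps (fst x 0) (fst x 1) y}}"
        by (auto simp: space_pair_measure)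
      finally show "{x \<in> space ?P. snd x \<in> {y \<in> space ?N. \<not> Ps (fst x 0) (fst x 1) y}} \<in> sets ?P" .
    qed auto
    then have 1: "{x \<in> space ?R. \<not> emeasure ?N {y \<in> space ?N. \<not> Ps (x 0) (x 1) y} \<le> ennreal (1 / real Q ^ 262)} \<in> sets ?R"
      unfolding not_le by (intro borel_measurable_less) auto
    have "(\<lambda>x. (\<Sum>j<d. (x 0 j)\<^sup>2) + (\<Sum>j<d. (x 1 j)\<^sup>2)) \<in> borel_measurable ?R"
      by (intro borel_measurable_add borel_measurable_sum borel_measurable_power cR) auto
    then have 2: "{x \<in> space ?R. line_short d Q (x 0) (x 1)} \<in> sets ?R"
      by (intro borel_measurable_le) auto
    have "{x \<in> space ?R. Bd (x 0) (x 1)} = {x \<in> space ?R. line_short d Q (x 0) (x 1)} \<inter>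
      {x \<in> space ?R. \<not> emeasure ?N {y \<in> space ?N. \<not> Ps (x 0) (x 1) y} \<le> ennreal (1 / real Q ^ 262)}"
      by (auto simp: Bd_def)
    then show ?thesis using 1 2 by (simp only: sets.Int)
  qed
  have S_meas: "{x \<in> space ?R. S x} \<in> sets ?R"
  proof -
    have "{x \<in> space ?R. Ps (x 0) (x 1) (x (i + 2))} \<in> sets ?R" if "i < m" for i
      using that by (intro Ps_meas cR) auto
    then have "{x \<in> space ?R. \<forall>i\<in>{..<m}. Ps (x 0) (x 1) (x (i + 2))} \<in> sets ?R"
      by (intro sets.sets_Collect_finite_All) auto
    moreover have "{x \<in> space ?R. S x} = {x \<in> space ?R. Bd (x 0) (x 1)}
        \<inter> {x \<in> space ?R. \<forall>i\<in>{..<m}. Ps (x 0) (x 1) (x (i + 2))}"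
      by (auto simp: S_def)
    ultimately show ?thesis using Bd_meas by (simp only: sets.Int)
  qed
  have H: "1 \<le> Q ^ 262" using Q by simp
  have H': "1 / real Q ^ 262 \<le> 1" 
  proof -
    have "1 \<le> real Q ^ 262" using Q by (intro one_le_power) simp
    then have "1 / real Q ^ 262 \<le> 1 / 1" by (intro frac_le) simp_all
    then show ?thesis by (simp only: div_by_1)
  qed
  have S_le: "emeasure ?R {x \<in> space ?R. S x} \<le> ennreal (1 / 2 ^ (2 * M))"
  proof -
    have "emeasure ?R {x \<in> space ?R. S x} \<le> ennreal (1 - 1 / real Q ^ 262) ^ m"
      unfolding S_def
    proof (rule all_pass_measure_le)
      show "{x \<in> space ?R. Bd (x 0) (x 1) \<and> (\<forall>i<m. Ps (x 0) (x 1) (x (i + 2)))} \<in> sets ?R"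
        using S_meas by (simp only: S_def)
      fix p v
      show "{y \<in> space ?N. Ps p v y} \<in> sets ?N" by (rule sub)
      assume "Bd p v"
      then have lt: "ennreal (1 / real Q ^ 262) < emeasure ?N {y \<in> space ?N. \<not> Ps p v y}"
        by (simp add: Bd_def not_le)
      have compl: "{y \<in> space ?N. \<not> Ps p v y} = space ?N - {y \<in> space ?N. Ps p v y}" by auto
      have "1 / real Q ^ 262 < measure ?N {y \<in> space ?N. \<not> Ps p v y}"
        using lt by (simp add: N.emeasure_eq_measure ennreal_less_iff)
      then have "measure ?N {y \<in> space ?N. Ps p v y} \<le> 1 - 1 / real Q ^ 262"
        unfolding compl using N.prob_compl[OF sub] by simp
      then show "emeasure ?N {y \<in> space ?N. Ps p v y} \<le> ennreal (1 - 1 / real Q ^ 262)"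
        by (simp add: N.emeasure_eq_measure ennreal_leI)
    qed
    also have "\<dots> = ennreal ((1 - 1 / real Q ^ 262) ^ m)" using H' by (simp add: ennreal_power)
    also have "\<dots> \<le> ennreal (1 / 2 ^ (2 * M))"
    proof (rule ennreal_leI)
      \<comment> \<open>Here \<open>m\<close> is read as \<open>2 * M\<close> batches of
        \<open>Q^262\<close> tests, each batch contributing a factor of at most
        \<open>1 / 2\<close>.\<close>
      have "(1 - 1 / real Q ^ 262) ^ m = ((1 - 1 / real (Q ^ 262)) ^ (Q ^ 262)) ^ (2 * M)"
        unfolding m_def power_mult[symmetric] by (simp only: mult.commute of_nat_power)
      also have "\<dots> \<le> (1 / 2) ^ (2 * M)"
        using one_minus_inverse_power_le_half[OF H] H' by (intro power_mono) (auto simp: of_nat_power)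
      finally show "(1 - 1 / real Q ^ 262) ^ m \<le> 1 / 2 ^ (2 * M)" by (simp only: power_one_over)
    qed
    finally show ?thesis .
  qed
  have G: "{x \<in> space ?R. \<not> G x} \<in> sets ?R" "emeasure ?R {x \<in> space ?R. \<not> G x} \<le> ennreal (1 / 2)"
    unfolding G_def by (rule line_good_measure[OF Q(1,3,4)])+
  from rounds_probability[OF Q(2) G S_meas S_le \<delta>]
  obtain E where E: "E \<in> sets gaussian_sequence" "measure gaussian_sequence E \<ge> 1 - \<delta>"
    and ev0: "\<forall>\<omega>\<in>E. (\<exists>j<M. G (\<lambda>l\<in>{..<m + 2}. round_vec d m \<omega> j l)) \<and>
            (\<forall>j<M. \<not> S (\<lambda>l\<in>{..<m + 2}. round_vec d m \<omega> j l))"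
    by (elim bexE conjE)
  have ev: "\<exists>j<M. G (\<lambda>l\<in>{..<m + 2}. round_vec d m \<omega> j l)" if "\<omega> \<in> E" for \<omega>
    using ev0 that by blast
  have ev': "\<not> S (\<lambda>l\<in>{..<m + 2}. round_vec d m \<omega> j l)" if "\<omega> \<in> E" "j < M" for \<omega> j
    using ev0 that by blast
  show ?thesis
  proof (intro bexI[OF _ E(1)] conjI E(2) ballI allI impI)
    fix \<omega> assume \<omega>: "\<omega> \<in> E"
    obtain j where j: "j < M" "line_good d k w b Q (round_vec d m \<omega> j 0) (round_vec d m \<omega> j 1)"
      using ev[OF \<omega>] by (auto simp: G_def)
    have "line_short d Q (round_vec d m \<omega> j 0) (round_vec d m \<omega> j 1)"
      using j(2) unfolding line_good_def good_line_def by (simp add: power_mult[symmetric])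
    moreover have "passes d (real Q ^ 4) F (relu_network d (line_net d F Q (round_vec d m \<omega> j 0) (round_vec d m \<omega> j 1))) x" for x
      unfolding F_def by (rule line_good_passes[OF Q(1,4-7) s w b j(2)])
    ultimately show "\<exists>j<M. accepted d F Q m (round_vec d m \<omega> j)"
      using j(1) unfolding accepted_def by blast
  next
    fix \<omega> j assume \<omega>: "\<omega> \<in> E" and j: "j < M" and acc: "accepted d F Q m (round_vec d m \<omega> j)"
    have short: "line_short d Q (round_vec d m \<omega> j 0) (round_vec d m \<omega> j 1)"
      using acc by (simp add: accepted_def)
    have "\<not> Bd (round_vec d m \<omega> j 0) (round_vec d m \<omega> j 1)"
      using ev'[OF \<omega> j] acc by (auto simp: S_def accepted_def Ps_def)
    then have "emeasure ?N {y \<in> space ?N. \<not> Ps (round_vec d m \<omega> j 0) (round_vec d m \<omega> j 1) y} \<le> ennreal (1 / real Q ^ 262)"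
      using short by (simp add: Bd_def)
    then show "expected_sq_error d F (relu_network d (line_net d F Q (round_vec d m \<omega> j 0) (round_vec d m \<omega> j 1)))
          \<le> ennreal (1 / real Q)"
      unfolding Ps_def F_def
      by (intro line_net_accepted_error[OF Q(1-6) s w short]) auto
  qed
qed

section \<open>Total correctness with time bounds\<close>

lemma nmem_simps [simp]:
  "nmem (tick n s) = nmem s" "nmem (rwrite x i r s) = nmem s"
  "nmem (nwrite x i m s) y = (if y = x then (nmem s x)(i := m) else nmem s y)"
  "nmem (s\<lparr>drawn := a\<rparr>) = nmem s" "nmem (s\<lparr>queries := a\<rparr>) = nmem s" "nmem (s\<lparr>out := l\<rparr>) = nmem s"
  by (auto simp: tick_def nwrite_def rwrite_def)

lemma rmem_simps [simp]:
  "rmem (tick n s) = rmem s" "rmem (nwrite x i m s) = rmem s"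
  "rmem (rwrite x i r s) y = (if y = x then (rmem s x)(i := r) else rmem s y)"
  "rmem (s\<lparr>drawn := a\<rparr>) = rmem s" "rmem (s\<lparr>queries := a\<rparr>) = rmem s" "rmem (s\<lparr>out := l\<rparr>) = rmem s"
  by (auto simp: tick_def nwrite_def rwrite_def)

lemma counter_simps [simp]:
  "drawn (tick n s) = drawn s" "drawn (nwrite x i m s) = drawn s" "drawn (rwrite x i r s) = drawn s"
  "queries (tick n s) = queries s" "queries (nwrite x i m s) = queries s" "queries (rwrite x i r s) = queries s"
  "out (tick n s) = out s" "out (nwrite x i m s) = out s" "out (rwrite x i r s) = out s"
  "steps (tick n s) = steps s + n" "steps (nwrite x i m s) = steps s" "steps (rwrite x i r s) = steps s"
  by (auto simp: tick_def nwrite_def rwrite_def)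

lemma val_tick [simp]: "nval (tick n s) e = nval s e" "rval (tick n s) f = rval s f" "bval (tick n s) b = bval s b"
proof -
  show n: "nval (tick n s) e = nval s e" for e by (induction e) auto
  show r: "rval (tick n s) f = rval s f" for f by (induction f) (auto simp: n)
  show "bval (tick n s) b = bval s b" by (induction b) (auto simp: n r)
qed

section \<open>Frames and time-bounded Hoare triples\<close>

primrec nmod :: "com \<Rightarrow> vname set" where
  "nmod Skip = {}"
| "nmod (NStore x e f) = {x}"
| "nmod (RStore x e f) = {}"
| "nmod (Sample x e) = {}"
| "nmod (Query x e y) = {}"
| "nmod (Emit a y c) = {}"
| "nmod (Seq c1 c2) = nmod c1 \<union> nmod c2"
| "nmod (Cond b c1 c2) = nmod c1 \<union> nmod c2"
| "nmod (While b c) = nmod c"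

primrec rmod :: "com \<Rightarrow> vname set" where
  "rmod Skip = {}"
| "rmod (NStore x e f) = {}"
| "rmod (RStore x e f) = {x}"
| "rmod (Sample x e) = {x}"
| "rmod (Query x e y) = {x}"
| "rmod (Emit a y c) = {}"
| "rmod (Seq c1 c2) = rmod c1 \<union> rmod c2"
| "rmod (Cond b c1 c2) = rmod c1 \<union> rmod c2"
| "rmod (While b c) = rmod c"

primrec emits :: "com \<Rightarrow> bool" where
  "emits Skip = False"
| "emits (NStore x e f) = False"
| "emits (RStore x e f) = False"
| "emits (Sample x e) = False"
| "emits (Query x e y) = False"
| "emits (Emit a y c) = True"
| "emits (Seq c1 c2) = (emits c1 \<or> emits c2)"
| "emits (Cond b c1 c2) = (emits c1 \<or> emits c2)"
| "emits (While b c) = emits c"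

primrec draws :: "com \<Rightarrow> bool" where
  "draws Skip = False"
| "draws (NStore x e f) = False"
| "draws (RStore x e f) = False"
| "draws (Sample x e) = True"
| "draws (Query x e y) = False"
| "draws (Emit a y c) = False"
| "draws (Seq c1 c2) = (draws c1 \<or> draws c2)"
| "draws (Cond b c1 c2) = (draws c1 \<or> draws c2)"
| "draws (While b c) = draws c"

text \<open>What the text of a command shows to be unchanged, at the granularity of whole arrays. It
  holds for every execution, so postconditions need to mention only what a command changes.\<close>

definition frame :: "com \<Rightarrow> state \<Rightarrow> state \<Rightarrow> bool" where
  "frame c s t \<longleftrightarrow> (\<forall>x. x \<notin> nmod c \<longrightarrow> nmem t x = nmem s x) \<and> (\<forall>x. x \<notin> rmod c \<longrightarrow> rmem t x = rmem s x) \<and>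
     (\<not> emits c \<longrightarrow> out t = out s) \<and> (\<not> draws c \<longrightarrow> drawn t = drawn s)"

lemma frameD:
  assumes "frame c s t"
  shows "x \<notin> nmod c \<Longrightarrow> nmem t x = nmem s x" "y \<notin> rmod c \<Longrightarrow> rmem t y = rmem s y"
    "\<not> emits c \<Longrightarrow> out t = out s" "\<not> draws c \<Longrightarrow> drawn t = drawn s"
  using assms by (auto simp: frame_def)

lemma exec_frame: "exec d F \<omega> c s t \<Longrightarrow> frame c s t"
  by (induction rule: exec.induct) (auto simp: frame_def)

text \<open>A query takes at least one step, so one polynomial bounds both counters.\<close>

lemma exec_queries_le_steps: "exec d F \<omega> c s t \<Longrightarrow> queries t + steps s \<le> queries s + steps t"
  by (induction rule: exec.induct) auto

text \<open>Total correctness: execution is deterministic, so the run whose existence is claimed is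
  the only one. The bound \<open>K\<close> is relative to the clock of the initial state.\<close>

definition runs ::
    "nat \<Rightarrow> (vec \<Rightarrow> real) \<Rightarrow> (nat \<Rightarrow> real) \<Rightarrow> com \<Rightarrow> state \<Rightarrow> nat \<Rightarrow> (state \<Rightarrow> bool) \<Rightarrow> bool" where
  "runs d F \<omega> c s K P \<longleftrightarrow> (\<exists>t. exec d F \<omega> c s t \<and> steps t \<le> steps s + K \<and> P t)"

lemma runs_conseq:
  assumes "runs d F \<omega> c s K P" "K \<le> K'" "\<And>t. frame c s t \<Longrightarrow> P t \<Longrightarrow> P' t"
  shows "runs d F \<omega> c s K' P'"
  using assms exec_frame unfolding runs_def by (meson add_left_mono order_trans)

lemma runs_Skip: "P (tick 1 s) \<Longrightarrow> 1 \<le> K \<Longrightarrow> runs d F \<omega> Skip s K P"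
  unfolding runs_def by (rule exI, intro conjI, rule exec.Skip) auto

lemma runs_NStore:
  "P (tick (ncost e + ncost f + 1) (nwrite x (nval s e) (nval s f) s)) \<Longrightarrow> ncost e + ncost f + 1 \<le> K \<Longrightarrow>
   runs d F \<omega> (NStore x e f) s K P"
  unfolding runs_def by (rule exI, intro conjI, rule exec.NStore) auto

lemma runs_RStore:
  "P (tick (ncost e + rcost f + 1) (rwrite x (nval s e) (rval s f) s)) \<Longrightarrow> ncost e + rcost f + 1 \<le> K \<Longrightarrow>
   runs d F \<omega> (RStore x e f) s K P"
  unfolding runs_def by (rule exI, intro conjI, rule exec.RStore) auto

lemma runs_Sample:
  "P (tick (ncost e + 1) (rwrite x (nval s e) (\<omega> (drawn s)) (s\<lparr>drawn := drawn s + 1\<rparr>))) \<Longrightarrow> ncost e + 1 \<le> K \<Longrightarrow>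
   runs d F \<omega> (Sample x e) s K P"
  unfolding runs_def by (rule exI, intro conjI, rule exec.Sample) auto

lemma runs_Query:
  "P (tick (ncost e + d + 1) (rwrite x (nval s e) (F (vec_at d s y)) (s\<lparr>queries := queries s + 1\<rparr>))) \<Longrightarrow>
   ncost e + d + 1 \<le> K \<Longrightarrow> runs d F \<omega> (Query x e y) s K P"
  unfolding runs_def by (rule exI, intro conjI, rule exec.Query) auto

lemma runs_Emit:
  "P (tick (rcost a + rcost c + d + 1) (s\<lparr>out := out s @ [(rval s a, vec_at d s y, rval s c)]\<rparr>)) \<Longrightarrow>
   rcost a + rcost c + d + 1 \<le> K \<Longrightarrow> runs d F \<omega> (Emit a y c) s K P"
  unfolding runs_def by (rule exI, intro conjI, rule exec.Emit) auto

lemma runs_Seq: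
  assumes "runs d F \<omega> c1 s K1 P" "\<And>t. frame c1 s t \<Longrightarrow> P t \<Longrightarrow> runs d F \<omega> c2 t K2 R" "K1 + K2 \<le> K"
  shows "runs d F \<omega> (Seq c1 c2) s K R"
proof -
  obtain t where t: "exec d F \<omega> c1 s t" "steps t \<le> steps s + K1" "P t"
    using assms(1) by (auto simp: runs_def)
  obtain u where u: "exec d F \<omega> c2 t u" "steps u \<le> steps t + K2" "R u"
    using assms(2)[OF exec_frame[OF t(1)] t(3)] by (auto simp: runs_def)
  show ?thesis unfolding runs_def using exec.Seq[OF t(1) u(1)] t u assms(3) by fastforce
qed

lemma runs_Seq_exact:
  assumes "runs d F \<omega> c1 s K1 (\<lambda>t. t = t0)" "runs d F \<omega> c2 t0 K2 R" "K1 + K2 \<le> K"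
  shows "runs d F \<omega> (Seq c1 c2) s K R"
  using assms by (intro runs_Seq[OF assms(1)]) auto

lemma runs_NStore_Seq:
  "runs d F \<omega> c (tick (ncost e + ncost f + 1) (nwrite x (nval s e) (nval s f) s)) (K - (ncost e + ncost f + 1)) R \<Longrightarrow>
   ncost e + ncost f + 1 \<le> K \<Longrightarrow> runs d F \<omega> (Seq (NStore x e f) c) s K R"
  by (erule runs_Seq_exact[rotated]) (auto intro: runs_NStore)

lemma runs_RStore_Seq:
  "runs d F \<omega> c (tick (ncost e + rcost f + 1) (rwrite x (nval s e) (rval s f) s)) (K - (ncost e + rcost f + 1)) R \<Longrightarrow>
   ncost e + rcost f + 1 \<le> K \<Longrightarrow> runs d F \<omega> (Seq (RStore x e f) c) s K R"
  by (erule runs_Seq_exact[rotated]) (auto intro: runs_RStore)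

lemma runs_Query_Seq:
  "runs d F \<omega> c (tick (ncost e + d + 1) (rwrite x (nval s e) (F (vec_at d s y)) (s\<lparr>queries := queries s + 1\<rparr>)))
     (K - (ncost e + d + 1)) R \<Longrightarrow>
   ncost e + d + 1 \<le> K \<Longrightarrow> runs d F \<omega> (Seq (Query x e y) c) s K R"
  by (erule runs_Seq_exact[rotated]) (auto intro: runs_Query)

lemma runs_Cond:
  assumes "bval s b \<Longrightarrow> runs d F \<omega> c1 (tick (bcost b + 1) s) K P"
    "\<not> bval s b \<Longrightarrow> runs d F \<omega> c2 (tick (bcost b + 1) s) K P" "K + bcost b + 1 \<le> K'"
  shows "runs d F \<omega> (Cond b c1 c2) s K' P"
proof (cases "bval s b")
  case True
  then obtain t where "exec d F \<omega> c1 (tick (bcost b + 1) s) t" "steps t \<le> steps s + (bcost b + 1) + K" "P t"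
    using assms(1) by (auto simp: runs_def)
  then show ?thesis unfolding runs_def using exec.CondTrue[OF True] assms(3) by fastforce
next
  case False
  then obtain t where "exec d F \<omega> c2 (tick (bcost b + 1) s) t" "steps t \<le> steps s + (bcost b + 1) + K" "P t"
    using assms(2) by (auto simp: runs_def)
  then show ?thesis unfolding runs_def using exec.CondFalse[OF False] assms(3) by fastforce
qed

text \<open>Evaluating the guard advances the clock before the body starts, so the invariant must
  not depend on the clock; this is \<open>stable\<close>. The variant \<open>f\<close> bounds the
  number of iterations, and the summand \<open>1\<close> pays for the final failing guard.\<close>

lemma runs_While:
  fixes f :: "state \<Rightarrow> nat"
  assumes body: "\<And>t. I t \<Longrightarrow> bval t b \<Longrightarrow> runs d F \<omega> c (tick (bcost b + 1) t) K (\<lambda>u. I u \<and> f u < f t)"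
    and stable: "\<And>t n. I t \<Longrightarrow> I (tick n t)"
  shows "I s \<Longrightarrow> runs d F \<omega> (While b c) s ((f s + 1) * (K + bcost b + 1)) (\<lambda>t. I t \<and> \<not> bval t b)"
proof (induction "f s" arbitrary: s rule: less_induct)
  case less
  show ?case
  proof (cases "bval s b")
    case False
    then have "exec d F \<omega> (While b c) s (tick (bcost b + 1) s)" by (rule exec.WhileFalse)
    with False stable[OF less.prems, of "bcost b + 1"] show ?thesis
      unfolding runs_def by fastforce
  next
    case True
    then obtain t where t: "exec d F \<omega> c (tick (bcost b + 1) s) t" "steps t \<le> steps s + (bcost b + 1) + K"
      "I t" "f t < f s"
      using body[OF less.prems] by (auto simp: runs_def)
    obtain u where u: "exec d F \<omega> (While b c) t u" "steps u \<le> steps t + (f t + 1) * (K + bcost b + 1)"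
      "I u" "\<not> bval u b"
      using less.hyps[OF t(4,3)] by (auto simp: runs_def)
    have "(f t + 1) * (K + bcost b + 1) \<le> f s * (K + bcost b + 1)"
      using t(4) by (intro mult_le_mono1) simp
    then have "steps u \<le> steps s + (f s + 1) * (K + bcost b + 1)"
      using t(2) u(2) by simp
    then show ?thesis unfolding runs_def using exec.WhileTrue[OF True t(1) u(1)] u by auto
  qed
qed

section \<open>Counting loops and vector operations\<close>

abbreviation nvar :: "vname \<Rightarrow> nexp" where "nvar x \<equiv> NLoad x (NConst 0)"
abbreviation rvar :: "vname \<Rightarrow> rexp" where "rvar x \<equiv> RLoad x (NConst 0)"

definition For :: "vname \<Rightarrow> nexp \<Rightarrow> com \<Rightarrow> com" where
  "For i e c = Seq (NStore i (NConst 0) (NConst 0))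
     (While (NLess (nvar i) e) (Seq c (NStore i (NConst 0) (NAdd (nvar i) (NConst 1)))))"

lemma For_simps [simp]:
  "nmod (For i e c) = insert i (nmod c)" "rmod (For i e c) = rmod c"
  "emits (For i e c) = emits c" "draws (For i e c) = draws c"
  by (auto simp: For_def)

lemma frame_tick [simp]: "frame c s (tick n t) = frame c s t"
  by (simp add: frame_def)

text \<open>The bound \<open>e\<close> is evaluated anew before every iteration, so it must have the
  same value in all states within the frame. The constant \<open>13\<close> consists of
  \<open>6\<close> for incrementing the counter, \<open>4\<close> for the guard besides
  \<open>e\<close>, and \<open>3\<close> for the initial store.\<close>

lemma runs_For:
  assumes i: "i \<notin> nmod c"
    and start: "I 0 s"
    and stable: "\<And>j t n m. I j t \<Longrightarrow> I j (tick n t) \<and> I j (nwrite i 0 m t)"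
    and bound: "\<And>t. frame (For i e c) s t \<Longrightarrow> nval t e = n"
    and body: "\<And>j t. j < n \<Longrightarrow> frame (For i e c) s t \<Longrightarrow> I j t \<Longrightarrow> nmem t i 0 = j \<Longrightarrow> runs d F \<omega> c t K (I (Suc j))"
    and K': "(n + 1) * (K + ncost e + 13) \<le> K'"
  shows "runs d F \<omega> (For i e c) s K' (I n)"
  unfolding For_def
proof (rule runs_NStore_Seq)
  let ?s = "tick (ncost (NConst 0) + ncost (NConst 0) + 1) (nwrite i (nval s (NConst 0)) (nval s (NConst 0)) s)"
  let ?b = "NLess (nvar i) e"
  let ?c = "Seq c (NStore i (NConst 0) (NAdd (nvar i) (NConst 1)))"
  let ?I = "\<lambda>t. frame (For i e c) s t \<and> nmem t i 0 \<le> n \<and> I (nmem t i 0) t"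
  define t where t: "t = ?s"
  have It: "?I t"
    using start stable unfolding t by (auto simp: frame_def)
  have 0: "nmem t i 0 = 0" by (simp add: t)
  have "runs d F \<omega> (While ?b ?c) t (((n - nmem t i 0) + 1) * ((K + 6) + bcost ?b + 1)) (\<lambda>t. ?I t \<and> \<not> bval t ?b)"
  proof (rule runs_While[where I="?I" and f="\<lambda>t. n - nmem t i 0"])
    show "?I t" by (rule It)
  next
    fix t assume "?I t" and b: "bval t ?b"
    then have fr: "frame (For i e c) s t" and I: "I (nmem t i 0) t" and lt: "nmem t i 0 < n"
      using bound[of t] by auto
    show "runs d F \<omega> ?c (tick (bcost ?b + 1) t) (K + 6) (\<lambda>u. ?I u \<and> n - nmem u i 0 < n - nmem t i 0)"
    proof (rule runs_Seq[OF body])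
      show "I (nmem t i 0) (tick (bcost ?b + 1) t)" using I stable by blast
      fix u assume u: "frame c (tick (bcost ?b + 1) t) u" "I (Suc (nmem t i 0)) u"
      have ui: "nmem u i = nmem t i" using frameD(1)[OF u(1) i] by simp
      have "frame (For i e c) s u" using fr u(1) by (auto simp: frame_def)
      then show "runs d F \<omega> (NStore i (NConst 0) (NAdd (nvar i) (NConst 1))) u 6
          (\<lambda>u. ?I u \<and> n - nmem u i 0 < n - nmem t i 0)"
        using u(2) stable ui lt by (intro runs_NStore) (auto simp: frame_def)
    qed (use fr lt in auto)
  next
    fix t k assume "?I t" then show "?I (tick k t)" using stable by simp
  qed
  then have "runs d F \<omega> (While ?b ?c) t (K' - (ncost (NConst 0) + ncost (NConst 0) + 1)) (I n)"
  proof (rule runs_conseq)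
    fix u assume u: "?I u \<and> \<not> bval u ?b"
    then have "nmem u i 0 = n" using bound[of u] by auto
    with u show "I n u" by auto
  next
    have "(n + 1) * (K + ncost e + 10) + 3 \<le> K'"
      using K' by (rule order_trans[rotated]) (simp add: algebra_simps)
    then show "(n - nmem t i 0 + 1) * (K + 6 + bcost ?b + 1) \<le> K' - (ncost (NConst 0) + ncost (NConst 0) + 1)"
      by (simp add: 0 algebra_simps)
  qed
  then show "runs d F \<omega> (While ?b ?c) ?s (K' - (ncost (NConst 0) + ncost (NConst 0) + 1)) (I n)"
    unfolding t .
next
  show "ncost (NConst 0) + ncost (NConst 0) + 1 \<le> K'"
    using K' by (rule order_trans[rotated]) (simp add: algebra_simps)
qed

definition Fill :: "vname \<Rightarrow> nexp \<Rightarrow> rexp \<Rightarrow> com" where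
  "Fill x e f = For ''j'' (nvar ''d'') (RStore x (NAdd e (nvar ''j'')) f)"

lemma Fill_simps [simp]:
  "nmod (Fill x e f) = {''j''}" "rmod (Fill x e f) = {x}" "\<not> emits (Fill x e f)" "\<not> draws (Fill x e f)"
  by (auto simp: Fill_def)

text \<open>The second conjunct protects the other rows: a table of vectors is kept in one array,
  row by row with stride \<open>d\<close>.\<close>

lemma runs_Fill:
  assumes d: "nmem s ''d'' 0 = d"
    and e: "\<And>t j. j < d \<Longrightarrow> frame (Fill x e f) s t \<Longrightarrow> nval t e = a"
    and f: "\<And>t j. j < d \<Longrightarrow> frame (Fill x e f) s t \<Longrightarrow> nmem t ''j'' 0 = j \<Longrightarrow> rval t f = g j"
    and K: "(d + 1) * (ncost e + rcost f + 20) \<le> K"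
  shows "runs d F \<omega> (Fill x e f) s K
    (\<lambda>t. (\<forall>j<d. rmem t x (a + j) = g j) \<and> (\<forall>l. l < a \<or> a + d \<le> l \<longrightarrow> rmem t x l = rmem s x l))"
proof -
  define I where "I j t \<longleftrightarrow> (\<forall>i<j. rmem t x (a + i) = g i) \<and> (\<forall>l. l < a \<or> a + d \<le> l \<longrightarrow> rmem t x l = rmem s x l)"
    for j and t :: state
  have "runs d F \<omega> (Fill x e f) s K (I d)"
    unfolding Fill_def
  proof (rule runs_For[where I=I and n=d])
    fix j t assume "j < d" "frame (For ''j'' (nvar ''d'') (RStore x (NAdd e (nvar ''j'')) f)) s t" "I j t" "nmem t ''j'' 0 = j"
    then show "runs d F \<omega> (RStore x (NAdd e (nvar ''j'')) f) t (ncost e + rcost f + 4) (I (Suc j))"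
      using e[of j t] f[of j t] unfolding Fill_def
      by (intro runs_RStore) (auto simp: I_def less_Suc_eq)
  next
    show "(d + 1) * (ncost e + rcost f + 4 + ncost (nvar ''d'') + 13) \<le> K"
      using K by (rule order_trans[rotated]) (intro mult_le_mono; simp)
  qed (use d in \<open>auto simp: I_def frame_def\<close>)
  then show ?thesis by (simp only: I_def[abs_def])
qed

definition SumLoop :: "vname \<Rightarrow> rexp \<Rightarrow> rexp \<Rightarrow> com" where
  "SumLoop x e f = Seq (RStore x (NConst 0) e) (For ''j'' (nvar ''d'') (RStore x (NConst 0) (RAdd (rvar x) f)))"

lemma SumLoop_simps [simp]:
  "nmod (SumLoop x e f) = {''j''}" "rmod (SumLoop x e f) = {x}" "\<not> emits (SumLoop x e f)" "\<not> draws (SumLoop x e f)"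
  by (auto simp: SumLoop_def)

lemma runs_SumLoop:
  assumes d: "nmem s ''d'' 0 = d"
    and f: "\<And>t j. j < d \<Longrightarrow> frame (SumLoop x e f) s t \<Longrightarrow> nmem t ''j'' 0 = j \<Longrightarrow> rval t f = g j"
    and K: "(d + 2) * (rcost e + rcost f + 25) \<le> K"
  shows "runs d F \<omega> (SumLoop x e f) s K (\<lambda>t. rmem t x 0 = rval s e + (\<Sum>j<d. g j))"
  unfolding SumLoop_def
proof (rule runs_RStore_Seq)
  let ?s = "tick (ncost (NConst 0) + rcost e + 1) (rwrite x (nval s (NConst 0)) (rval s e) s)"
  define t where t: "t = ?s"
  have "runs d F \<omega> (For ''j'' (nvar ''d'') (RStore x (NConst 0) (RAdd (rvar x) f))) t ((d + 1) * (rcost f + 23))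
      (\<lambda>t. rmem t x 0 = rval s e + (\<Sum>j<d. g j))"
  proof (rule runs_For[where I="\<lambda>j t. rmem t x 0 = rval s e + (\<Sum>j<j. g j)" and n=d])
    fix j u
    assume u: "j < d" "frame (For ''j'' (nvar ''d'') (RStore x (NConst 0) (RAdd (rvar x) f))) t u"
      "rmem u x 0 = rval s e + (\<Sum>j<j. g j)" "nmem u ''j'' 0 = j"
    have "frame (SumLoop x e f) s u" using u(2) unfolding t by (auto simp: frame_def SumLoop_def)
    then show "runs d F \<omega> (RStore x (NConst 0) (RAdd (rvar x) f)) u (rcost f + 6)
        (\<lambda>t. rmem t x 0 = rval s e + (\<Sum>j<Suc j. g j))"
      using f[of j u] u by (intro runs_RStore) auto
  next
    fix u assume "frame (For ''j'' (nvar ''d'') (RStore x (NConst 0) (RAdd (rvar x) f))) t u"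
    then show "nval u (nvar ''d'') = d" using d by (auto simp: frame_def t)
  next
    show "(d + 1) * (rcost f + 6 + ncost (nvar ''d'') + 13) \<le> (d + 1) * (rcost f + 23)"
      by (intro mult_le_mono) auto
  qed (auto simp: t)
  then have *: "runs d F \<omega> (For ''j'' (nvar ''d'') (RStore x (NConst 0) (RAdd (rvar x) f))) ?s ((d + 1) * (rcost f + 23))
      (\<lambda>t. rmem t x 0 = rval s e + (\<Sum>j<d. g j))" unfolding t .
  have K': "(d + 1) * (rcost f + 23) + (rcost e + 2) \<le> K"
    using K by (rule order_trans[rotated]) (simp add: algebra_simps)
  show "runs d F \<omega> (For ''j'' (nvar ''d'') (RStore x (NConst 0) (RAdd (rvar x) f))) ?s
      (K - (ncost (NConst 0) + rcost e + 1)) (\<lambda>t. rmem t x 0 = rval s e + (\<Sum>j<d. g j))"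
    by (rule runs_conseq[OF *]) (use K' in auto)
  show "ncost (NConst 0) + rcost e + 1 \<le> K" using K' by simp
qed

definition SampleVec :: "vname \<Rightarrow> com" where
  "SampleVec x = For ''j'' (nvar ''d'') (Sample x (nvar ''j''))"

lemma SampleVec_simps [simp]:
  "nmod (SampleVec x) = {''j''}" "rmod (SampleVec x) = {x}" "\<not> emits (SampleVec x)" "draws (SampleVec x)"
  by (auto simp: SampleVec_def)

lemma runs_SampleVec:
  assumes d: "nmem s ''d'' 0 = d" and K: "(d + 1) * 20 \<le> K"
  shows "runs d F \<omega> (SampleVec x) s K
    (\<lambda>t. (\<forall>j<d. rmem t x j = \<omega> (drawn s + j)) \<and> drawn t = drawn s + d)"
proof -
  define I where "I j t \<longleftrightarrow> (\<forall>i<j. rmem t x i = \<omega> (drawn s + i)) \<and> drawn t = drawn s + j" for j and t :: state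
  have "runs d F \<omega> (SampleVec x) s K (I d)"
    unfolding SampleVec_def
  proof (rule runs_For[where I=I and n=d])
    fix j t assume "j < d" "I j t" "nmem t ''j'' 0 = j"
    then show "runs d F \<omega> (Sample x (nvar ''j'')) t 3 (I (Suc j))"
      by (intro runs_Sample) (auto simp: I_def less_Suc_eq)
  next
    show "(d + 1) * (3 + ncost (nvar ''d'') + 13) \<le> K"
      using K by (rule order_trans[rotated]) (intro mult_le_mono; simp)
  qed (use d in \<open>auto simp: I_def frame_def\<close>)
  then show ?thesis by (simp only: I_def[abs_def])
qed

text \<open>The machine has no exponentiation. The exponents are constants, so a power is unrolled
  into an expression of constant cost and recomputed wherever it occurs.\<close>

primrec qpow :: "nat \<Rightarrow> nexp" where
  "qpow 0 = NConst 1"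
| "qpow (Suc n) = NMul (nvar ''Q'') (qpow n)"

lemma qpow_simps [simp]: "nval s (qpow n) = nmem s ''Q'' 0 ^ n" "ncost (qpow n) = 3 * n + 1"
  by (induction n) auto

section \<open>The program\<close>

definition inv_qpow :: "nat \<Rightarrow> rexp" where
  "inv_qpow n = RDiv (RConst 1) (ROfNat (qpow n))"

lemma inv_qpow_simps [simp]:
  "rval s (inv_qpow n) = 1 / real (nmem s ''Q'' 0) ^ n" "rcost (inv_qpow n) = 3 * n + 4"
  by (simp_all add: inv_qpow_def)

text \<open>Coordinate \<open>j\<close> of the grid point with index \<open>e\<close>, computed on
  the fly instead of being stored.\<close>

definition point_exp :: "nexp \<Rightarrow> rexp" where
  "point_exp e = RAdd (RLoad ''p'' (nvar ''j''))
     (RMul (RSub (RMul (ROfNat e) (inv_qpow 29)) (ROfNat (qpow 13))) (RLoad ''v'' (nvar ''j'')))"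

lemma point_exp_simps [simp]:
  "rval s (point_exp e) = rmem s ''p'' (nmem s ''j'' 0)
     + (real (nval s e) * (1 / real (nmem s ''Q'' 0) ^ 29) - real (nmem s ''Q'' 0) ^ 13) * rmem s ''v'' (nmem s ''j'' 0)"
  "rcost (point_exp e) = ncost e + 143"
  by (simp_all add: point_exp_def)

abbreviation entry :: "vname \<Rightarrow> nexp \<Rightarrow> rexp" where
  "entry x e \<equiv> RLoad x (NAdd (NMul e (nvar ''d'')) (nvar ''j''))"

abbreviation num_cells :: nexp where "num_cells \<equiv> NMul (NConst 2) (qpow 42)"

text \<open>A coordinate of the grid point is shifted by \<open>h\<close> in place and shifted back
  after the query; exact arithmetic restores it without error.\<close>

definition GradStep :: com where
  "GradStep = Seq (Fill ''y'' (NConst 0) (point_exp (nvar ''n'')))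
    (Seq (Query ''f'' (nvar ''n'') ''y'')
      (For ''j'' (nvar ''d'')
        (Seq (RStore ''y'' (nvar ''j'') (RAdd (RLoad ''y'' (nvar ''j'')) (inv_qpow 47)))
        (Seq (Query ''t'' (NConst 0) ''y'')
        (Seq (RStore ''y'' (nvar ''j'') (RSub (RLoad ''y'' (nvar ''j'')) (inv_qpow 47)))
          (RStore ''g'' (NAdd (NMul (nvar ''n'') (nvar ''d'')) (nvar ''j''))
            (RDiv (RSub (rvar ''t'') (RLoad ''f'' (nvar ''n''))) (inv_qpow 47))))))))"

lemma GradStep_simps [simp]:
  "nmod GradStep = {''j''}" "rmod GradStep = {''y'', ''f'', ''t'', ''g''}" "\<not> emits GradStep" "\<not> draws GradStep"
  by (auto simp: GradStep_def)

definition TableStep :: com where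
  "TableStep = Seq (SumLoop ''S'' (RConst 0)
       (RMul (RSub (entry ''g'' (NAdd (nvar ''n'') (NConst 1))) (entry ''g'' (nvar ''n''))) (RLoad ''v'' (nvar ''j''))))
    (Seq (RStore ''a'' (nvar ''n'') (rvar ''S''))
    (Seq (Fill ''u'' (NMul (nvar ''n'') (nvar ''d''))
       (RDiv (RSub (entry ''g'' (NAdd (nvar ''n'') (NConst 1))) (entry ''g'' (nvar ''n''))) (RLoad ''a'' (nvar ''n''))))
    (Seq (SumLoop ''S'' (RConst 0) (RMul (entry ''u'' (nvar ''n'')) (point_exp (nvar ''n''))))
      (RStore ''c'' (nvar ''n'') (rvar ''S'')))))"

lemma TableStep_simps [simp]:
  "nmod TableStep = {''j''}" "rmod TableStep = {''S'', ''a'', ''u'', ''c''}" "\<not> emits TableStep" "\<not> draws TableStep"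
  by (auto simp: TableStep_def)

lemma vec_at_eqI: "z \<in> {..<d} \<rightarrow>\<^sub>E UNIV \<Longrightarrow> (\<And>j. j < d \<Longrightarrow> rmem s y j = z j) \<Longrightarrow> vec_at d s y = z"
  by (auto simp: vec_at_def fun_eq_iff PiE_iff extensional_def)

lemma index_less: "l < n \<Longrightarrow> j < d \<Longrightarrow> l * d + j < n * d" for l n j d :: nat
proof -
  assume "l < n" "j < d"
  then have "Suc l * d \<le> n * d" by (intro mult_le_mono1) auto
  with \<open>j < d\<close> show ?thesis by simp
qed

section \<open>Correctness of the program for one line\<close>

text \<open>The line \<open>p\<close>, \<open>v\<close> is fixed on the mathematical side;
  \<open>line_loaded\<close> says that the arrays hold it. This allows program states to be compared
  with the functions of the scan.\<close>

locale scan_program =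
  fixes d Q :: nat and F :: "vec \<Rightarrow> real" and \<omega> :: "nat \<Rightarrow> real" and p v :: vec
begin

abbreviation "T \<equiv> real Q ^ 13"
abbreviation "r \<equiv> 1 / real Q ^ 29"
abbreviation "h \<equiv> 1 / real Q ^ 47"
abbreviation "N \<equiv> 2 * Q ^ 42"
abbreviation "P \<equiv> grid_point d T r p v"
abbreviation "G \<equiv> grid_grad d F T r h p v"
abbreviation "nrn \<equiv> scan_neuron d F N T r h p v"

definition line_loaded :: "state \<Rightarrow> bool" where
  "line_loaded s \<longleftrightarrow> nmem s ''d'' 0 = d \<and> nmem s ''Q'' 0 = Q \<and>
     (\<forall>j<d. rmem s ''p'' j = p j) \<and> (\<forall>j<d. rmem s ''v'' j = v j)"

lemma line_loaded_frame:
  "line_loaded s \<Longrightarrow> frame c s t \<Longrightarrow> ''d'' \<notin> nmod c \<Longrightarrow> ''Q'' \<notin> nmod c \<Longrightarrow> ''p'' \<notin> rmod c \<Longrightarrow> ''v'' \<notin> rmod c \<Longrightarrow>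
   line_loaded t"
  by (simp add: line_loaded_def frame_def)

lemma line_loaded_simps:
  assumes "line_loaded s"
  shows "nmem s ''d'' 0 = d" "nmem s ''Q'' 0 = Q" "j < d \<Longrightarrow> rmem s ''p'' j = p j" "j < d \<Longrightarrow> rmem s ''v'' j = v j"
  using assms by (auto simp: line_loaded_def)

lemma P_apply: "j < d \<Longrightarrow> P n j = p j + (real n * r - T) * v j"
  by (simp add: grid_point_def)

lemma runs_GradStep:
  assumes L: "line_loaded s" and n: "nmem s ''n'' 0 = n" and K: "(d + 2) * (d + 1500) \<le> K"
  shows "runs d F \<omega> GradStep s K
    (\<lambda>t. rmem t ''f'' n = F (P n) \<and> (\<forall>j<d. rmem t ''g'' (n * d + j) = G n j) \<and>
      (\<forall>l. l < n \<longrightarrow> rmem t ''f'' l = rmem s ''f'' l) \<and> (\<forall>l. l < n * d \<longrightarrow> rmem t ''g'' l = rmem s ''g'' l))"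
  unfolding GradStep_def
proof (rule runs_Seq[OF runs_Fill[where a=0 and g="P n" and K="(d + 1) * 170"]])
  note Ls = line_loaded_simps[OF L]
  show "nmem s ''d'' 0 = d" by (rule Ls)
  {
    fix t j assume "j < d" and fr: "frame (Fill ''y'' (NConst 0) (point_exp (nvar ''n''))) s t" and j: "nmem t ''j'' 0 = j"
    note fr' = frameD[OF fr, simplified]
    show "rval t (point_exp (nvar ''n'')) = P n j"
      using \<open>j < d\<close> j n Ls by (simp add: fr' P_apply)
  }
  fix t assume fr: "frame (Fill ''y'' (NConst 0) (point_exp (nvar ''n''))) s t"
    and y: "(\<forall>j<d. rmem t ''y'' (0 + j) = P n j) \<and>
      (\<forall>l. l < 0 \<or> 0 + d \<le> l \<longrightarrow> rmem t ''y'' l = rmem s ''y'' l)"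
  note fr' = frameD[OF fr, simplified]
  have y': "vec_at d t ''y'' = P n" by (rule vec_at_eqI[OF grid_point_ext]) (use y in simp)
  let ?body = "Seq (RStore ''y'' (nvar ''j'') (RAdd (RLoad ''y'' (nvar ''j'')) (inv_qpow 47)))
        (Seq (Query ''t'' (NConst 0) ''y'')
        (Seq (RStore ''y'' (nvar ''j'') (RSub (RLoad ''y'' (nvar ''j'')) (inv_qpow 47)))
          (RStore ''g'' (NAdd (NMul (nvar ''n'') (nvar ''d'')) (nvar ''j''))
            (RDiv (RSub (rvar ''t'') (RLoad ''f'' (nvar ''n''))) (inv_qpow 47)))))"
  let ?I = "\<lambda>j u. rmem u ''f'' n = F (P n) \<and> (\<forall>l. l < n \<longrightarrow> rmem u ''f'' l = rmem s ''f'' l) \<and>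
    (\<forall>i<d. rmem u ''y'' i = P n i) \<and> (\<forall>i<j. rmem u ''g'' (n * d + i) = G n i) \<and>
    (\<forall>l. l < n * d \<longrightarrow> rmem u ''g'' l = rmem s ''g'' l)"
  show "runs d F \<omega> (Seq (Query ''f'' (nvar ''n'') ''y'') (For ''j'' (nvar ''d'') ?body)) t ((d + 1) * (d + 700) + d + 3)
     (\<lambda>t. rmem t ''f'' n = F (P n) \<and> (\<forall>j<d. rmem t ''g'' (n * d + j) = G n j) \<and>
      (\<forall>l. l < n \<longrightarrow> rmem t ''f'' l = rmem s ''f'' l) \<and> (\<forall>l. l < n * d \<longrightarrow> rmem t ''g'' l = rmem s ''g'' l))"
  proof (rule runs_Query_Seq)
    define t1 where t1: "t1 = tick (ncost (nvar ''n'') + d + 1)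
      (rwrite ''f'' (nval t (nvar ''n'')) (F (vec_at d t ''y'')) (t\<lparr>queries := queries t + 1\<rparr>))"
    have "runs d F \<omega> (For ''j'' (nvar ''d'') ?body) t1 ((d + 1) * (d + 700)) (?I d)"
    proof (rule runs_For[where I="?I" and n=d and K="d + 600"])
      show "?I 0 t1" using y n by (auto simp: t1 y' fr')
    next
      fix u assume "frame (For ''j'' (nvar ''d'') ?body) t1 u"
      note fru = frameD[OF this, simplified]
      show "nval u (nvar ''d'') = d" using Ls by (simp add: fru t1 fr')
    next
      fix j u assume j: "j < d" and fr: "frame (For ''j'' (nvar ''d'') ?body) t1 u" and I: "?I j u" and uj: "nmem u ''j'' 0 = j"
      note fru = frameD[OF fr, simplified]
      have c: "nmem u ''d'' 0 = d" "nmem u ''Q'' 0 = Q" "nmem u ''n'' 0 = n"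
        using Ls n by (simp_all add: fru t1 fr')
      \<comment> \<open>The vector handed to the oracle is literally the shifted grid point in
        \<open>diff_quot\<close>, because both are extensional.\<close>
      have upd: "restrict ((rmem u ''y'')(j := P n j + h)) {..<d} = (P n)(j := P n j + h)"
        using I j by (auto simp: fun_eq_iff grid_point_def)
      have "G n j = (F ((P n)(j := P n j + h)) - F (P n)) / h"
        using j by (simp add: grid_grad_def diff_quot_def)
      then show "runs d F \<omega> ?body u (d + 600) (?I (Suc j))"
        using I j
        by (intro runs_RStore_Seq runs_Query_Seq runs_RStore)
          (auto simp: c uj vec_at_def upd less_Suc_eq simp del: restrict_apply)
    next
      show "(d + 1) * (d + 600 + ncost (nvar ''d'') + 13) \<le> (d + 1) * (d + 700)" by (intro mult_le_mono) auto
    qed auto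
    then show "runs d F \<omega> (For ''j'' (nvar ''d'') ?body) (tick (ncost (nvar ''n'') + d + 1)
      (rwrite ''f'' (nval t (nvar ''n'')) (F (vec_at d t ''y'')) (t\<lparr>queries := queries t + 1\<rparr>)))
      ((d + 1) * (d + 700) + d + 3 - (ncost (nvar ''n'') + d + 1))
      (\<lambda>t. rmem t ''f'' n = F (P n) \<and> (\<forall>j<d. rmem t ''g'' (n * d + j) = G n j) \<and>
      (\<forall>l. l < n \<longrightarrow> rmem t ''f'' l = rmem s ''f'' l) \<and> (\<forall>l. l < n * d \<longrightarrow> rmem t ''g'' l = rmem s ''g'' l))"
      unfolding t1[symmetric] by (rule runs_conseq) auto
  qed simp
next
  show "(d + 1) * 170 + ((d + 1) * (d + 700) + d + 3) \<le> K"
    using K by (rule order_trans[rotated]) (simp add: algebra_simps)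
qed (auto simp: mult_le_mono)

definition neuron_at :: "state \<Rightarrow> nat \<Rightarrow> neuron \<Rightarrow> bool" where
  "neuron_at s n z \<longleftrightarrow> rmem s ''a'' n = fst z \<and> (\<forall>j<d. rmem s ''u'' (n * d + j) = fst (snd z) j) \<and>
     rmem s ''c'' n = snd (snd z)"

lemma runs_TableStep:
  assumes L: "line_loaded s" and n: "nmem s ''n'' 0 = n" "n < N"
    and g: "\<And>j. j < d \<Longrightarrow> rmem s ''g'' (n * d + j) = G n j" "\<And>j. j < d \<Longrightarrow> rmem s ''g'' (Suc n * d + j) = G (Suc n) j"
    and K: "(d + 2) * 1000 \<le> K"
  shows "runs d F \<omega> TableStep s K
    (\<lambda>t. neuron_at t n (nrn n) \<and> (\<forall>l<n. \<forall>z. neuron_at s l z \<longrightarrow> neuron_at t l z))"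
  unfolding TableStep_def
proof (rule runs_Seq[OF runs_SumLoop[where g="\<lambda>j. grad_jump d F T r h p v n j * v j" and K="(d + 2) * 60"]])
  note Ls = line_loaded_simps[OF L]
  let ?D = "RSub (entry ''g'' (NAdd (nvar ''n'') (NConst 1))) (entry ''g'' (nvar ''n''))"
  let ?f = "RMul ?D (RLoad ''v'' (nvar ''j''))"
  show "nmem s ''d'' 0 = d" by (rule Ls)
  have Dval: "rval t ?D = grad_jump d F T r h p v n j"
    if "j < d" "nmem t ''j'' 0 = j" "nmem t ''n'' = nmem s ''n''" "nmem t ''d'' = nmem s ''d''" "rmem t ''g'' = rmem s ''g''" for t j
    using that g[of j] n Ls by (simp add: grad_jump_def)
  {
    fix t j assume "j < d" and fr: "frame (SumLoop ''S'' (RConst 0) ?f) s t" and j: "nmem t ''j'' 0 = j"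
    note fr' = frameD[OF fr, simplified]
    have "rval t ?D = grad_jump d F T r h p v n j"
      by (rule Dval[OF \<open>j < d\<close> j]) (simp_all add: fr')
    then show "rval t ?f = grad_jump d F T r h p v n j * v j"
      using j Ls \<open>j < d\<close> by (simp add: fr' del: rval.simps(5))
  }
  fix t assume fr: "frame (SumLoop ''S'' (RConst 0) ?f) s t"
    and S: "rmem t ''S'' 0 = rval s (RConst 0) + (\<Sum>j<d. grad_jump d F T r h p v n j * v j)"
  note fr' = frameD[OF fr, simplified]
  have S': "rmem t ''S'' 0 = jump_slope d F T r h p v n"
    using S by (simp add: jump_slope_def dot_def)
  let ?c2 = "Fill ''u'' (NMul (nvar ''n'') (nvar ''d'')) (RDiv ?D (RLoad ''a'' (nvar ''n'')))"
  let ?f3 = "RMul (entry ''u'' (nvar ''n'')) (point_exp (nvar ''n''))"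
  let ?c3 = "SumLoop ''S'' (RConst 0) ?f3"
  let ?R = "\<lambda>t. neuron_at t n (nrn n) \<and> (\<forall>l<n. \<forall>z. neuron_at s l z \<longrightarrow> neuron_at t l z)"
  define t1 where t1: "t1 = tick (ncost (nvar ''n'') + rcost (rvar ''S'') + 1) (rwrite ''a'' (nval t (nvar ''n'')) (rval t (rvar ''S'')) t)"
  have a1: "rmem t1 ''a'' = (rmem s ''a'')(n := jump_slope d F T r h p v n)"
    using n by (simp add: t1 fr' S')
  have t1s: "nmem t1 x = nmem s x" if "x \<noteq> ''j''" for x using that by (simp add: t1 fr')
  have t1r: "rmem t1 x = rmem s x" if "x \<noteq> ''S''" "x \<noteq> ''a''" for x using that by (simp add: t1 fr')
  have "runs d F \<omega> (Seq ?c2 (Seq ?c3 (RStore ''c'' (nvar ''n'') (rvar ''S'')))) t1 ((d + 2) * 300 + 20) ?R"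
  proof (rule runs_Seq[OF runs_Fill[where a="n * d" and g="kink_dir d F T r h p v n" and K="(d + 1) * 60"]])
    show "nmem t1 ''d'' 0 = d" by (simp add: t1s Ls)
  next
    fix u j assume "frame ?c2 t1 u"
    note fru = frameD[OF this, simplified]
    show "nval u (NMul (nvar ''n'') (nvar ''d'')) = n * d" using n Ls by (simp add: fru t1s)
    assume j: "j < d" "nmem u ''j'' 0 = j"
    have "rval u ?D = grad_jump d F T r h p v n j"
      by (rule Dval[OF j]) (simp_all add: fru t1s t1r)
    then show "rval u (RDiv ?D (RLoad ''a'' (nvar ''n''))) = kink_dir d F T r h p v n j"
      using j n by (simp add: fru t1s a1 kink_dir_def del: rval.simps(5))
  next
    fix u assume fr2: "frame ?c2 t1 u" and u: "(\<forall>j<d. rmem u ''u'' (n * d + j) = kink_dir d F T r h p v n j) \<and>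
          (\<forall>l. l < n * d \<or> n * d + d \<le> l \<longrightarrow> rmem u ''u'' l = rmem t1 ''u'' l)"
    note fru = frameD[OF fr2, simplified]
    show "runs d F \<omega> (Seq ?c3 (RStore ''c'' (nvar ''n'') (rvar ''S''))) u ((d + 2) * 220 + 10) ?R"
    proof (rule runs_Seq[OF runs_SumLoop[where g="\<lambda>j. kink_dir d F T r h p v n j * P n j" and K="(d + 2) * 220"]])
      show "nmem u ''d'' 0 = d" by (simp add: fru t1s Ls)
    next
      fix x j assume j: "j < d" "nmem x ''j'' 0 = j" and "frame ?c3 u x"
      note frx = frameD[OF this(3), simplified]
      show "rval x ?f3 = kink_dir d F T r h p v n j * P n j"
        using j u n Ls by (simp add: frx fru t1s t1r P_apply)
    next
      fix x assume "frame ?c3 u x" and S3: "rmem x ''S'' 0 = rval u (RConst 0) + (\<Sum>j<d. kink_dir d F T r h p v n j * P n j)"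
      note frx = frameD[OF this(1), simplified]
      show "runs d F \<omega> (RStore ''c'' (nvar ''n'') (rvar ''S'')) x 10 ?R"
      proof (rule runs_RStore)
        have "nrn n = (jump_slope d F T r h p v n, kink_dir d F T r h p v n, dot d (kink_dir d F T r h p v n) (P n))"
          using n(2) by (simp add: scan_neuron_def)
        then show "?R (tick (ncost (nvar ''n'') + rcost (rvar ''S'') + 1) (rwrite ''c'' (nval x (nvar ''n'')) (rval x (rvar ''S'')) x))"
          using u n S3 index_less[of _ n]
          by (auto simp: neuron_at_def frx fru t1s t1r a1 dot_def)
      qed simp
    qed (auto simp: mult_le_mono)
  next
    show "(d + 1) * 60 + ((d + 2) * 220 + 10) \<le> (d + 2) * 300 + 20" by simp
  qed (auto simp: mult_le_mono)
  then show "runs d F \<omega> (Seq (RStore ''a'' (nvar ''n'') (rvar ''S'')) (Seq ?c2 (Seq ?c3 (RStore ''c'' (nvar ''n'') (rvar ''S''))))) t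
      ((d + 2) * 300 + 30) ?R"
    unfolding t1 by (intro runs_RStore_Seq) (erule runs_conseq, auto)
next
  show "(d + 2) * 60 + ((d + 2) * 300 + 30) \<le> K"
    using K by (rule order_trans[rotated]) simp
qed (auto simp: mult_le_mono)

end

text \<open>Rows \<open>num_cells\<close> and \<open>num_cells + 1\<close> hold the two opposite
  neurons of the affine part. The cell \<open>f[0]\<close> and the first row of \<open>g\<close>
  belong to the leftmost grid point.\<close>

definition AffineStep :: com where
  "AffineStep = Seq (SumLoop ''S'' (RConst 0) (RMul (RLoad ''g'' (nvar ''j'')) (point_exp (NConst 0))))
    (Seq (RStore ''a'' num_cells (RConst 1))
    (Seq (RStore ''a'' (NAdd num_cells (NConst 1)) (RConst (-1)))
    (Seq (RStore ''c'' num_cells (RSub (rvar ''S'') (rvar ''f'')))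
    (Seq (RStore ''c'' (NAdd num_cells (NConst 1)) (RSub (RConst 0) (RSub (rvar ''S'') (rvar ''f''))))
    (Seq (Fill ''u'' (NMul num_cells (nvar ''d'')) (RLoad ''g'' (nvar ''j'')))
      (Fill ''u'' (NMul (NAdd num_cells (NConst 1)) (nvar ''d'')) (RSub (RConst 0) (RLoad ''g'' (nvar ''j'')))))))))"

lemma AffineStep_simps [simp]:
  "nmod AffineStep = {''j''}" "rmod AffineStep = {''S'', ''a'', ''c'', ''u''}" "\<not> emits AffineStep" "\<not> draws AffineStep"
  by (auto simp: AffineStep_def)

definition BuildNet :: com where
  "BuildNet = Seq (For ''n'' (NAdd num_cells (NConst 1)) GradStep) (Seq (For ''n'' num_cells TableStep) AffineStep)"

lemma BuildNet_simps [simp]: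
  "nmod BuildNet = {''j'', ''n''}" "rmod BuildNet = {''y'', ''f'', ''t'', ''g'', ''S'', ''a'', ''c'', ''u''}"
  "\<not> emits BuildNet" "\<not> draws BuildNet"
  by (auto simp: BuildNet_def)

text \<open>The conditional is the ReLU: a neuron with a nonpositive argument adds nothing to the
  sum.\<close>

definition EvalNet :: com where
  "EvalNet = Seq (RStore ''val'' (NConst 0) (RConst 0))
    (For ''n'' (NAdd num_cells (NConst 2))
      (Seq (SumLoop ''S'' (RSub (RConst 0) (RLoad ''c'' (nvar ''n''))) (RMul (entry ''u'' (nvar ''n'')) (RLoad ''y'' (nvar ''j''))))
        (Cond (RLess (RConst 0) (rvar ''S''))
          (RStore ''val'' (NConst 0) (RAdd (rvar ''val'') (RMul (RLoad ''a'' (nvar ''n'')) (rvar ''S'')))) Skip)))"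

lemma EvalNet_simps [simp]:
  "nmod EvalNet = {''j'', ''n''}" "rmod EvalNet = {''val'', ''S''}" "\<not> emits EvalNet" "\<not> draws EvalNet"
  by (auto simp: EvalNet_def)

definition TestStep :: com where
  "TestStep = Seq (SampleVec ''y'') (Seq (Query ''t'' (NConst 0) ''y'') (Seq EvalNet
    (Seq (SumLoop ''S'' (RConst 1) (RMul (RLoad ''y'' (nvar ''j'')) (RLoad ''y'' (nvar ''j''))))
      (Cond (RLess (rvar ''S'') (RMul (ROfNat (qpow 4))
          (RMul (RSub (rvar ''t'') (rvar ''val'')) (RSub (rvar ''t'') (rvar ''val'')))))
        (NStore ''ok'' (NConst 0) (NConst 0)) Skip))))"

lemma TestStep_simps [simp]:
  "nmod TestStep = {''j'', ''n'', ''ok''}" "rmod TestStep = {''y'', ''t'', ''val'', ''S''}" "\<not> emits TestStep" "draws TestStep"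
  by (auto simp: TestStep_def)

text \<open>\<open>Emit\<close> reads its weight vector from the first \<open>d\<close> cells of an
  array, so each row of the table is first copied to \<open>y\<close>.\<close>

definition EmitNet :: com where
  "EmitNet = For ''n'' (NAdd num_cells (NConst 2))
     (Seq (Fill ''y'' (NConst 0) (entry ''u'' (nvar ''n''))) (Emit (RLoad ''a'' (nvar ''n'')) ''y'' (RLoad ''c'' (nvar ''n''))))"

lemma EmitNet_simps [simp]:
  "nmod EmitNet = {''j'', ''n''}" "rmod EmitNet = {''y''}" "emits EmitNet" "\<not> draws EmitNet"
  by (auto simp: EmitNet_def)

context scan_program
begin

lemma scan_neuron_ext: "fst (snd (nrn n)) \<in> {..<d} \<rightarrow>\<^sub>E UNIV"
  by (simp add: scan_neuron_def kink_dir_def grid_grad_def)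

lemma runs_AffineStep:
  assumes L: "line_loaded s"
    and g: "\<And>j. j < d \<Longrightarrow> rmem s ''g'' j = G 0 j" and f: "rmem s ''f'' 0 = F (P 0)"
    and K: "(d + 2) * 2000 \<le> K"
  shows "runs d F \<omega> AffineStep s K
    (\<lambda>t. neuron_at t N (nrn N) \<and> neuron_at t (Suc N) (nrn (Suc N)) \<and> (\<forall>l<N. \<forall>z. neuron_at s l z \<longrightarrow> neuron_at t l z))"
  unfolding AffineStep_def
proof (rule runs_Seq[OF runs_SumLoop[where g="\<lambda>j. G 0 j * P 0 j" and K="(d + 2) * 200"]])
  note Ls = line_loaded_simps[OF L]
  let ?f = "RMul (RLoad ''g'' (nvar ''j'')) (point_exp (NConst 0))"
  let ?R = "\<lambda>t. neuron_at t N (nrn N) \<and> neuron_at t (Suc N) (nrn (Suc N)) \<and> (\<forall>l<N. \<forall>z. neuron_at s l z \<longrightarrow> neuron_at t l z)"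
  let ?c1 = "Fill ''u'' (NMul num_cells (nvar ''d'')) (RLoad ''g'' (nvar ''j''))"
  let ?c2 = "Fill ''u'' (NMul (NAdd num_cells (NConst 1)) (nvar ''d'')) (RSub (RConst 0) (RLoad ''g'' (nvar ''j'')))"
  show "nmem s ''d'' 0 = d" by (rule Ls)
  {
    fix t j assume j: "j < d" "nmem t ''j'' 0 = j" and fr: "frame (SumLoop ''S'' (RConst 0) ?f) s t"
    note fr' = frameD[OF fr, simplified]
    show "rval t ?f = G 0 j * P 0 j"
      using j Ls g by (simp add: fr' P_apply)
  }
  fix t assume fr: "frame (SumLoop ''S'' (RConst 0) ?f) s t" and S: "rmem t ''S'' 0 = rval s (RConst 0) + (\<Sum>j<d. G 0 j * P 0 j)"
  note fr' = frameD[OF fr, simplified]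
  have off: "rmem t ''S'' 0 - rmem t ''f'' 0 = base_offset d F T r h p v"
    using S f by (simp add: fr' base_offset_def dot_def)
  have main: "runs d F \<omega> (Seq ?c1 ?c2) t1 ((d + 1) * 600) ?R"
    if t1: "nmem t1 = nmem t" "rmem t1 ''g'' = rmem s ''g''" "rmem t1 ''u'' = rmem s ''u''"
      "rmem t1 ''a'' = (rmem s ''a'')(N := 1, Suc N := -1)"
      "rmem t1 ''c'' = (rmem s ''c'')(N := base_offset d F T r h p v, Suc N := - base_offset d F T r h p v)" for t1
  proof (rule runs_Seq[OF runs_Fill[where a="N * d" and g="G 0" and K="(d + 1) * 200"]])
    show "nmem t1 ''d'' 0 = d" by (simp add: t1 fr' Ls)
  next
    fix u j assume "frame ?c1 t1 u"
    note fru = frameD[OF this, simplified]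
    show "nval u (NMul num_cells (nvar ''d'')) = N * d" by (simp add: fru t1 fr' Ls)
    show "rval u (RLoad ''g'' (nvar ''j'')) = G 0 j" if "j < d" "nmem u ''j'' 0 = j"
      using that g by (simp add: fru t1)
  next
    fix u assume "frame ?c1 t1 u" and u: "(\<forall>j<d. rmem u ''u'' (N * d + j) = G 0 j) \<and>
          (\<forall>l. l < N * d \<or> N * d + d \<le> l \<longrightarrow> rmem u ''u'' l = rmem t1 ''u'' l)"
    note fru = frameD[OF this(1), simplified]
    have "runs d F \<omega> ?c2 u ((d + 1) * 300) (\<lambda>t. (\<forall>j<d. rmem t ''u'' (Suc N * d + j) = - G 0 j) \<and>
       (\<forall>l. l < Suc N * d \<or> Suc N * d + d \<le> l \<longrightarrow> rmem t ''u'' l = rmem u ''u'' l))"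
    proof (rule runs_Fill)
      show "nmem u ''d'' 0 = d" by (simp add: fru t1 fr' Ls)
    next
      fix x j assume "frame ?c2 u x"
      note frx = frameD[OF this, simplified]
      show "nval x (NMul (NAdd num_cells (NConst 1)) (nvar ''d'')) = Suc N * d" by (simp add: frx fru t1 fr' Ls)
      show "rval x (RSub (RConst 0) (RLoad ''g'' (nvar ''j''))) = - G 0 j" if "j < d" "nmem x ''j'' 0 = j"
        using that g by (simp add: frx fru t1)
    qed (auto intro!: mult_le_mono)
    then show "runs d F \<omega> ?c2 u ((d + 1) * 300) ?R"
    proof (rule runs_conseq[OF _ order_refl])
      fix x assume "frame ?c2 u x" and x: "(\<forall>j<d. rmem x ''u'' (Suc N * d + j) = - G 0 j) \<and>
       (\<forall>l. l < Suc N * d \<or> Suc N * d + d \<le> l \<longrightarrow> rmem x ''u'' l = rmem u ''u'' l)"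
      note frx = frameD[OF this(1), simplified]
      have a: "nrn N = (1, G 0, base_offset d F T r h p v)"
        "nrn (Suc N) = (-1, (\<lambda>j\<in>{..<d}. - G 0 j), - base_offset d F T r h p v)"
        by (simp_all add: scan_neuron_def)
      have "rmem x ''u'' (l * d + j) = rmem u ''u'' (l * d + j)" if "j < d" "l < Suc N" for l j
        using x index_less[OF that(2,1)] by blast
      moreover have "rmem u ''u'' (l * d + j) = rmem s ''u'' (l * d + j)" if "j < d" "l < N" for l j
        using u index_less[OF that(2,1)] t1 by metis
      ultimately show "?R x" using u x
        by (auto simp: neuron_at_def a frx fru t1)
    qed
  qed (auto intro!: mult_le_mono)
  show "runs d F \<omega> (Seq (RStore ''a'' num_cells (RConst 1))
    (Seq (RStore ''a'' (NAdd num_cells (NConst 1)) (RConst (-1)))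
    (Seq (RStore ''c'' num_cells (RSub (rvar ''S'') (rvar ''f'')))
    (Seq (RStore ''c'' (NAdd num_cells (NConst 1)) (RSub (RConst 0) (RSub (rvar ''S'') (rvar ''f''))))
    (Seq ?c1 ?c2))))) t ((d + 1) * 600 + 1000) ?R"
  proof (intro runs_RStore_Seq, goal_cases)
    case 1
    have N: "nmem t ''Q'' 0 = Q" by (simp add: fr' Ls)
    show ?case
      by (rule runs_conseq[OF main]) (use off N in \<open>auto simp: fr'\<close>)
  qed auto
next
  show "(d + 2) * 200 + ((d + 1) * 600 + 1000) \<le> K"
    using K by (rule order_trans[rotated]) simp
qed (auto intro!: mult_le_mono)

lemma neuron_at_tick [simp]: "neuron_at (tick k s) n z = neuron_at s n z" "neuron_at (nwrite x i k s) n z = neuron_at s n z"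
  by (simp_all add: neuron_at_def)

lemma neuron_at_frame:
  "neuron_at s n z \<Longrightarrow> frame c s t \<Longrightarrow> ''a'' \<notin> rmod c \<Longrightarrow> ''u'' \<notin> rmod c \<Longrightarrow> ''c'' \<notin> rmod c \<Longrightarrow> neuron_at t n z"
  by (simp add: neuron_at_def frame_def)

lemma runs_BuildNet:
  assumes L: "line_loaded s"
    and K: "(N + 2) * ((d + 2) * (d + 1500) + 160) + (N + 1) * ((d + 2) * 1000 + 160) + (d + 2) * 2000 \<le> K"
  shows "runs d F \<omega> BuildNet s K (\<lambda>t. \<forall>n<N + 2. neuron_at t n (nrn n))"
  unfolding BuildNet_def
proof (rule runs_Seq)
  note Ls = line_loaded_simps[OF L]
  let ?I = "\<lambda>n t. \<forall>l<n. rmem t ''f'' l = F (P l) \<and> (\<forall>j<d. rmem t ''g'' (l * d + j) = G l j)"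
  let ?c1 = "For ''n'' (NAdd num_cells (NConst 1)) GradStep" and ?c2 = "For ''n'' num_cells TableStep"
  show "runs d F \<omega> ?c1 s ((N + 2) * ((d + 2) * (d + 1500) + 160)) (?I (N + 1))"
  proof (rule runs_For[where I="?I" and n="N + 1"])
    fix t assume fr: "frame ?c1 s t"
    note fr' = frameD[OF fr, simplified]
    show "nval t (NAdd num_cells (NConst 1)) = N + 1" by (simp add: fr' Ls)
  next
    fix n t assume "n < N + 1" and fr: "frame ?c1 s t" and I: "?I n t" and n: "nmem t ''n'' 0 = n"
    have "line_loaded t" using line_loaded_frame[OF L fr] by simp
    from runs_GradStep[OF this n order_refl]
    show "runs d F \<omega> GradStep t ((d + 2) * (d + 1500)) (?I (Suc n))"
    proof (rule runs_conseq[OF _ order_refl])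
      fix u assume u: "rmem u ''f'' n = F (P n) \<and> (\<forall>j<d. rmem u ''g'' (n * d + j) = G n j) \<and>
        (\<forall>l<n. rmem u ''f'' l = rmem t ''f'' l) \<and> (\<forall>l<n * d. rmem u ''g'' l = rmem t ''g'' l)"
      show "?I (Suc n) u"
      proof (intro allI impI)
        fix l assume l: "l < Suc n"
        show "rmem u ''f'' l = F (P l) \<and> (\<forall>j<d. rmem u ''g'' (l * d + j) = G l j)"
        proof (cases "l = n")
          case False
          with l have "l < n" by simp
          then show ?thesis using I u index_less[of l n] by simp
        qed (use u in simp)
      qed
    qed
  next
    show "(N + 1 + 1) * ((d + 2) * (d + 1500) + ncost (NAdd num_cells (NConst 1)) + 13)
        \<le> (N + 2) * ((d + 2) * (d + 1500) + 160)"
      by (intro mult_le_mono) auto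
  qed auto
  fix t assume fr: "frame ?c1 s t" and I: "?I (N + 1) t"
  have Lt: "line_loaded t" using line_loaded_frame[OF L fr] by simp
  note Lts = line_loaded_simps[OF Lt]
  show "runs d F \<omega> (Seq ?c2 AffineStep) t ((N + 1) * ((d + 2) * 1000 + 160) + (d + 2) * 2000) (\<lambda>t. \<forall>n<N + 2. neuron_at t n (nrn n))"
  proof (rule runs_Seq)
    show "runs d F \<omega> ?c2 t ((N + 1) * ((d + 2) * 1000 + 160)) (\<lambda>t. \<forall>n<N. neuron_at t n (nrn n))"
    proof (rule runs_For[where I="\<lambda>n t. \<forall>l<n. neuron_at t l (nrn l)" and n=N])
      fix u assume "frame ?c2 t u"
      note fr' = frameD[OF this, simplified]
      show "nval u num_cells = N" by (simp add: fr' Lts)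
    next
      fix n u assume n: "n < N" "nmem u ''n'' 0 = n" and fru: "frame ?c2 t u" and J: "\<forall>l<n. neuron_at u l (nrn l)"
      note fr' = frameD[OF fru, simplified]
      have "line_loaded u" using line_loaded_frame[OF Lt fru] by simp
      then have "runs d F \<omega> TableStep u ((d + 2) * 1000) (\<lambda>t. neuron_at t n (nrn n) \<and> (\<forall>l<n. \<forall>z. neuron_at u l z \<longrightarrow> neuron_at t l z))"
        using I n by (intro runs_TableStep) (auto simp: fr')
      then show "runs d F \<omega> TableStep u ((d + 2) * 1000) (\<lambda>t. \<forall>l<Suc n. neuron_at t l (nrn l))"
      proof (rule runs_conseq)
        fix x assume "neuron_at x n (nrn n) \<and> (\<forall>l<n. \<forall>z. neuron_at u l z \<longrightarrow> neuron_at x l z)"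
        with J show "\<forall>l<Suc n. neuron_at x l (nrn l)" unfolding less_Suc_eq by blast
      qed simp
    next
      show "(N + 1) * ((d + 2) * 1000 + ncost num_cells + 13) \<le> (N + 1) * ((d + 2) * 1000 + 160)"
        by (intro mult_le_mono) auto
    qed auto
    fix u assume fru: "frame ?c2 t u" and J: "\<forall>n<N. neuron_at u n (nrn n)"
    note fr' = frameD[OF fru, simplified]
    have "line_loaded u" using line_loaded_frame[OF Lt fru] by simp
    then have "runs d F \<omega> AffineStep u ((d + 2) * 2000)
      (\<lambda>t. neuron_at t N (nrn N) \<and> neuron_at t (Suc N) (nrn (Suc N)) \<and> (\<forall>l<N. \<forall>z. neuron_at u l z \<longrightarrow> neuron_at t l z))"
    proof (rule runs_AffineStep)
      have I0: "rmem t ''f'' 0 = F (P 0) \<and> (\<forall>j<d. rmem t ''g'' (0 * d + j) = G 0 j)"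
        using spec[OF I, of 0] by simp
      then show "rmem u ''f'' 0 = F (P 0)" and "\<And>j. j < d \<Longrightarrow> rmem u ''g'' j = G 0 j" by (auto simp: fr')
    qed simp
    then show "runs d F \<omega> AffineStep u ((d + 2) * 2000) (\<lambda>t. \<forall>n<N + 2. neuron_at t n (nrn n))"
    proof (rule runs_conseq)
      fix x assume x: "neuron_at x N (nrn N) \<and> neuron_at x (Suc N) (nrn (Suc N)) \<and>
          (\<forall>l<N. \<forall>z. neuron_at u l z \<longrightarrow> neuron_at x l z)"
      show "\<forall>n<N + 2. neuron_at x n (nrn n)"
      proof (intro allI impI)
        fix n assume "n < N + 2"
        then consider "n < N" | "n = N" | "n = Suc N" by linarith
        then show "neuron_at x n (nrn n)" using J x by cases blast+
      qed
    qed simp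
  qed simp
qed (use K in simp)

end

lemma runsE:
  assumes "runs d F \<omega> c s K P"
  obtains t where "exec d F \<omega> c s t" "steps t \<le> steps s + K" "frame c s t" "P t"
  using assms exec_frame unfolding runs_def by blast

section \<open>One round: sampling, testing, output\<close>

abbreviation num_tests :: nexp where
  "num_tests \<equiv> NMul (NMul (NConst 2) (nvar ''M'')) (qpow 262)"

text \<open>There is no early exit. A line that is too long is scanned and tested all the same, and
  the tests go on after a failure, so every round draws exactly \<open>(m + 2) * d\<close> samples
  and the next one starts at the position foreseen by \<open>round_vec\<close>.\<close>

definition Round :: com where
  "Round = Seq (SampleVec ''p'') (Seq (SampleVec ''v'')
    (Seq (SumLoop ''S'' (RConst 0) (RAdd (RMul (RLoad ''p'' (nvar ''j'')) (RLoad ''p'' (nvar ''j'')))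
        (RMul (RLoad ''v'' (nvar ''j'')) (RLoad ''v'' (nvar ''j'')))))
    (Seq (NStore ''ok'' (NConst 0) (NConst 1))
    (Seq (Cond (RLess (ROfNat (qpow 4)) (rvar ''S'')) (NStore ''ok'' (NConst 0) (NConst 0)) Skip)
    (Seq BuildNet
    (Seq (For ''i'' num_tests TestStep)
      (Cond (NLess (NConst 0) (nvar ''ok'')) (Seq EmitNet (NStore ''done'' (NConst 0) (NConst 1))) Skip)))))))"

lemma Round_simps [simp]:
  "nmod Round = {''j'', ''n'', ''ok'', ''i'', ''done''}" "emits Round" "draws Round"
  "rmod Round = {''p'', ''v'', ''y'', ''f'', ''t'', ''g'', ''S'', ''a'', ''c'', ''u'', ''val''}"
  by (auto simp: Round_def)

text \<open>The cost expressions are polymorphic: one text serves as a step count over the naturals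
  and as a polynomial over the reals.\<close>

definition build_cost :: "'a::comm_semiring_1 \<Rightarrow> 'a \<Rightarrow> 'a" where
  "build_cost d N = (N + 2) * ((d + 2) * (d + 1500) + 160) + (N + 1) * ((d + 2) * 1000 + 160) + (d + 2) * 2000"

definition test_cost :: "'a::comm_semiring_1 \<Rightarrow> 'a \<Rightarrow> 'a" where
  "test_cost d N = (N + 4) * ((d + 2) * 50 + 170) + (d + 2) * 100 + 100"

definition emit_cost :: "'a::comm_semiring_1 \<Rightarrow> 'a \<Rightarrow> 'a" where
  "emit_cost d N = (N + 3) * ((d + 2) * 60 + 200)"

definition round_cost :: "'a::comm_semiring_1 \<Rightarrow> 'a \<Rightarrow> 'a \<Rightarrow> 'a" where
  "round_cost d N m = (d + 1) * 40 + (d + 2) * 50 + 100 + build_cost d N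
     + (m + 1) * (test_cost d N + 810) + emit_cost d N"

context scan_program
begin

lemma runs_EvalNet:
  assumes d: "nmem s ''d'' 0 = d" "nmem s ''Q'' 0 = Q" and y: "\<And>j. j < d \<Longrightarrow> rmem s ''y'' j = x j"
    and nr: "\<And>n. n < N + 2 \<Longrightarrow> neuron_at s n (nrn n)"
    and K: "(N + 4) * ((d + 2) * 50 + 170) \<le> K"
  shows "runs d F \<omega> EvalNet s K (\<lambda>t. rmem t ''val'' 0 = relu_network d (line_net d F Q p v) x)"
  unfolding EvalNet_def
proof (rule runs_RStore_Seq)
  let ?S = "SumLoop ''S'' (RSub (RConst 0) (RLoad ''c'' (nvar ''n''))) (RMul (entry ''u'' (nvar ''n'')) (RLoad ''y'' (nvar ''j'')))"
  let ?C = "Cond (RLess (RConst 0) (rvar ''S''))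
          (RStore ''val'' (NConst 0) (RAdd (rvar ''val'') (RMul (RLoad ''a'' (nvar ''n'')) (rvar ''S'')))) Skip"
  let ?For = "For ''n'' (NAdd num_cells (NConst 2)) (Seq ?S ?C)"
  let ?s = "tick (ncost (NConst 0) + rcost (RConst 0) + 1) (rwrite ''val'' (nval s (NConst 0)) (rval s (RConst 0)) s)"
  define val where "val n = (\<Sum>l<n. fst (nrn l) * relu (dot d (fst (snd (nrn l))) x - snd (snd (nrn l))))" for n
  have val_eq: "val (N + 2) = relu_network d (line_net d F Q p v) x"
    unfolding val_def relu_network_def line_net_def scan_net_def
    by (simp add: comp_def interv_sum_list_conv_sum_set_nat atLeast0LessThan case_prod_beta')
  have "runs d F \<omega> ?For ?s ((N + 3) * ((d + 2) * 50 + 170)) (\<lambda>t. rmem t ''val'' 0 = val (N + 2))"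
  proof (rule runs_For[where I="\<lambda>n t. rmem t ''val'' 0 = val n" and n="N + 2"])
    show "rmem ?s ''val'' 0 = val 0" by (simp add: val_def)
  next
    fix t assume "frame ?For ?s t"
    note fr = frameD[OF this, simplified]
    show "nval t (NAdd num_cells (NConst 2)) = N + 2" using d by (simp add: fr)
  next
    fix n t assume n: "n < N + 2" "nmem t ''n'' 0 = n" and fr0: "frame ?For ?s t" and I: "rmem t ''val'' 0 = val n"
    note fr = frameD[OF fr0, simplified]
    have nt: "rmem t ''a'' n = fst (nrn n)" "\<And>j. j < d \<Longrightarrow> rmem t ''u'' (n * d + j) = fst (snd (nrn n)) j"
      "rmem t ''c'' n = snd (snd (nrn n))"
      using nr[OF n(1)] by (simp_all add: neuron_at_def fr)
    show "runs d F \<omega> (Seq ?S ?C) t ((d + 2) * 50 + 20) (\<lambda>t. rmem t ''val'' 0 = val (Suc n))"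
    proof (rule runs_Seq[OF runs_SumLoop[where g="\<lambda>j. fst (snd (nrn n)) j * x j" and K="(d + 2) * 50"]])
      show "nmem t ''d'' 0 = d" using d by (simp add: fr)
    next
      fix u j assume j: "j < d" "nmem u ''j'' 0 = j" and "frame ?S t u"
      note fru = frameD[OF this(3), simplified]
      show "rval u (RMul (entry ''u'' (nvar ''n'')) (RLoad ''y'' (nvar ''j''))) = fst (snd (nrn n)) j * x j"
        using j n d nt y by (simp add: fru fr)
    next
      fix u assume "frame ?S t u" and S: "rmem u ''S'' 0 = rval t (RSub (RConst 0) (RLoad ''c'' (nvar ''n'')))
          + (\<Sum>j<d. fst (snd (nrn n)) j * x j)"
      note fru = frameD[OF this(1), simplified]
      have S': "rmem u ''S'' 0 = dot d (fst (snd (nrn n))) x - snd (snd (nrn n))"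
        using S n nt by (simp add: dot_def)
      show "runs d F \<omega> ?C u 20 (\<lambda>t. rmem t ''val'' 0 = val (Suc n))"
      proof (rule runs_Cond)
        assume "bval u (RLess (RConst 0) (rvar ''S''))"
        then show "runs d F \<omega> (RStore ''val'' (NConst 0) (RAdd (rvar ''val'') (RMul (RLoad ''a'' (nvar ''n'')) (rvar ''S''))))
            (tick (bcost (RLess (RConst 0) (rvar ''S'')) + 1) u) 14 (\<lambda>t. rmem t ''val'' 0 = val (Suc n))"
          using I n nt S' by (intro runs_RStore) (auto simp: fru val_def relu_def max_def)
      next
        assume "\<not> bval u (RLess (RConst 0) (rvar ''S''))"
        then show "runs d F \<omega> Skip
            (tick (bcost (RLess (RConst 0) (rvar ''S'')) + 1) u) 14 (\<lambda>t. rmem t ''val'' 0 = val (Suc n))"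
          using I n nt S' by (intro runs_Skip) (auto simp: fru val_def relu_def max_def)
      qed simp
    qed (auto intro!: mult_le_mono)
  next
    show "(N + 2 + 1) * ((d + 2) * 50 + 20 + ncost (NAdd num_cells (NConst 2)) + 13) \<le> (N + 3) * ((d + 2) * 50 + 170)"
      by (intro mult_le_mono) auto
  qed auto
  then show "runs d F \<omega> ?For ?s (K - (ncost (NConst 0) + rcost (RConst 0) + 1))
      (\<lambda>t. rmem t ''val'' 0 = relu_network d (line_net d F Q p v) x)"
  proof (rule runs_conseq)
    have "(N + 3) * ((d + 2) * 50 + 170) + 3 \<le> K"
      using K by (rule order_trans[rotated]) (simp add: algebra_simps)
    then show "(N + 3) * ((d + 2) * 50 + 170) \<le> K - (ncost (NConst 0) + rcost (RConst 0) + 1)" by simp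
  qed (simp only: val_eq)
  show "ncost (NConst 0) + rcost (RConst 0) + 1 \<le> K"
    using K by (rule order_trans[rotated]) (simp add: algebra_simps)
qed

lemma runs_TestStep:
  assumes d: "nmem s ''d'' 0 = d" "nmem s ''Q'' 0 = Q"
    and nr: "\<And>n. n < N + 2 \<Longrightarrow> neuron_at s n (nrn n)"
    and K: "test_cost d N \<le> K"
  shows "runs d F \<omega> TestStep s K (\<lambda>t. drawn t = drawn s + d \<and> nmem t ''ok'' 0 =
    (if passes d (real Q ^ 4) F (relu_network d (line_net d F Q p v)) (\<lambda>j\<in>{..<d}. \<omega> (drawn s + j))
     then nmem s ''ok'' 0 else 0))"
proof -
  define x where "x = (\<lambda>j\<in>{..<d}. \<omega> (drawn s + j))"
  let ?G = "relu_network d (line_net d F Q p v)"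
  obtain t1 where t1: "exec d F \<omega> (SampleVec ''y'') s t1" "steps t1 \<le> steps s + (d + 1) * 20" "frame (SampleVec ''y'') s t1"
    "\<forall>j<d. rmem t1 ''y'' j = \<omega> (drawn s + j)" "drawn t1 = drawn s + d"
    using runs_SampleVec[OF d(1) order_refl] by (rule runsE) auto
  note fr1 = frameD[OF t1(3), simplified]
  obtain t2 where t2: "exec d F \<omega> (Query ''t'' (NConst 0) ''y'') t1 t2" "steps t2 \<le> steps t1 + (d + 2)"
    "frame (Query ''t'' (NConst 0) ''y'') t1 t2" "rmem t2 ''t'' 0 = F x"
  proof -
    have "vec_at d t1 ''y'' = x" using t1(4) by (auto simp: vec_at_def x_def fun_eq_iff)
    then have "runs d F \<omega> (Query ''t'' (NConst 0) ''y'') t1 (d + 2) (\<lambda>t. rmem t ''t'' 0 = F x)"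
      by (intro runs_Query) auto
    then show ?thesis by (rule runsE) (rule that)
  qed
  note fr2 = frameD[OF t2(3), simplified]
  have "runs d F \<omega> EvalNet t2 ((N + 4) * ((d + 2) * 50 + 170)) (\<lambda>t. rmem t ''val'' 0 = ?G x)"
  proof (rule runs_EvalNet)
    show "neuron_at t2 n (nrn n)" if "n < N + 2" for n
      using nr[OF that] by (simp add: neuron_at_def fr2 fr1)
  qed (use d t1(4) in \<open>auto simp: fr2 fr1 x_def\<close>)
  then obtain t3 where t3: "exec d F \<omega> EvalNet t2 t3" "steps t3 \<le> steps t2 + (N + 4) * ((d + 2) * 50 + 170)"
    "frame EvalNet t2 t3" "rmem t3 ''val'' 0 = ?G x"
    by (rule runsE)
  note fr3 = frameD[OF t3(3), simplified]
  let ?f = "RMul (RLoad ''y'' (nvar ''j'')) (RLoad ''y'' (nvar ''j''))"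
  have "runs d F \<omega> (SumLoop ''S'' (RConst 1) ?f) t3 ((d + 2) * 50) (\<lambda>t. rmem t ''S'' 0 = rval t3 (RConst 1) + (\<Sum>j<d. x j * x j))"
  proof (rule runs_SumLoop)
    show "nmem t3 ''d'' 0 = d" using d by (simp add: fr3 fr2 fr1)
    fix u j assume "j < d" "nmem u ''j'' 0 = j" "frame (SumLoop ''S'' (RConst 1) ?f) t3 u"
    note fru = frameD[OF this(3), simplified]
    show "rval u ?f = x j * x j"
      using \<open>j < d\<close> \<open>nmem u ''j'' 0 = j\<close> t1(4) by (simp add: fru fr3 fr2 x_def)
  qed (auto intro!: mult_le_mono)
  then obtain t4 where t4: "exec d F \<omega> (SumLoop ''S'' (RConst 1) ?f) t3 t4" "steps t4 \<le> steps t3 + (d + 2) * 50"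
    "frame (SumLoop ''S'' (RConst 1) ?f) t3 t4" "rmem t4 ''S'' 0 = 1 + (\<Sum>j<d. x j * x j)"
    by (rule runsE) auto
  note fr4 = frameD[OF t4(3), simplified]
  let ?b = "RLess (rvar ''S'') (RMul (ROfNat (qpow 4))
          (RMul (RSub (rvar ''t'') (rvar ''val'')) (RSub (rvar ''t'') (rvar ''val''))))"
  have b: "bval t4 ?b \<longleftrightarrow> \<not> passes d (real Q ^ 4) F ?G x"
    using d t4(4) t3(4) t2(4) by (simp add: fr4 fr3 fr2 fr1 passes_def power2_eq_square not_le)
  have "runs d F \<omega> (Cond ?b (NStore ''ok'' (NConst 0) (NConst 0)) Skip) t4 60
    (\<lambda>t. nmem t ''ok'' 0 = (if passes d (real Q ^ 4) F ?G x then nmem t4 ''ok'' 0 else 0))"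
    by (rule runs_Cond[where K=3]) (use b in \<open>auto intro!: runs_NStore runs_Skip\<close>)
  then obtain t5 where t5: "exec d F \<omega> (Cond ?b (NStore ''ok'' (NConst 0) (NConst 0)) Skip) t4 t5" "steps t5 \<le> steps t4 + 60"
    "frame (Cond ?b (NStore ''ok'' (NConst 0) (NConst 0)) Skip) t4 t5"
    "nmem t5 ''ok'' 0 = (if passes d (real Q ^ 4) F ?G x then nmem t4 ''ok'' 0 else 0)"
    by (rule runsE)
  note fr5 = frameD[OF t5(3), simplified]
  have "exec d F \<omega> TestStep s t5"
    unfolding TestStep_def using t1(1) t2(1) t3(1) t4(1) t5(1) by (intro exec.Seq)
  moreover have "steps t5 \<le> steps s + K"
    using t1(2) t2(2) t3(2) t4(2) t5(2) K by (simp add: test_cost_def)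
  moreover have "drawn t5 = drawn s + d" using t1(5) by (simp add: fr5 fr4 fr3 fr2)
  moreover have "nmem t5 ''ok'' 0 = (if passes d (real Q ^ 4) F ?G x then nmem s ''ok'' 0 else 0)"
    using t5(4) by (simp add: fr4 fr3 fr2 fr1)
  ultimately show ?thesis unfolding runs_def x_def by blast
qed

lemma runs_EmitNet:
  assumes d: "nmem s ''d'' 0 = d" "nmem s ''Q'' 0 = Q"
    and nr: "\<And>n. n < N + 2 \<Longrightarrow> neuron_at s n (nrn n)"
    and K: "emit_cost d N \<le> K"
  shows "runs d F \<omega> EmitNet s K (\<lambda>t. out t = out s @ line_net d F Q p v)"
proof -
  let ?b = "Seq (Fill ''y'' (NConst 0) (entry ''u'' (nvar ''n''))) (Emit (RLoad ''a'' (nvar ''n'')) ''y'' (RLoad ''c'' (nvar ''n'')))"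
  let ?For = "For ''n'' (NAdd num_cells (NConst 2)) ?b"
  have "runs d F \<omega> ?For s K (\<lambda>t. out t = out s @ map nrn [0..<N + 2])"
  proof (rule runs_For[where I="\<lambda>n t. out t = out s @ map nrn [0..<n]" and n="N + 2"])
    fix t assume "frame ?For s t"
    note fr = frameD[OF this, simplified]
    show "nval t (NAdd num_cells (NConst 2)) = N + 2" using d by (simp add: fr)
  next
    fix n t assume n: "n < N + 2" "nmem t ''n'' 0 = n" and "frame ?For s t" and I: "out t = out s @ map nrn [0..<n]"
    note fr = frameD[OF this(3), simplified]
    have nt: "rmem t ''a'' n = fst (nrn n)" "\<And>j. j < d \<Longrightarrow> rmem t ''u'' (n * d + j) = fst (snd (nrn n)) j"
      "rmem t ''c'' n = snd (snd (nrn n))"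
      using nr[OF n(1)] by (simp_all add: neuron_at_def fr)
    show "runs d F \<omega> ?b t ((d + 1) * 50 + d + 20) (\<lambda>t. out t = out s @ map nrn [0..<Suc n])"
    proof (rule runs_Seq[OF runs_Fill[where a=0 and g="fst (snd (nrn n))" and K="(d + 1) * 50"]])
      show "nmem t ''d'' 0 = d" using d by (simp add: fr)
    next
      fix u j assume j: "j < d" "nmem u ''j'' 0 = j" and "frame (Fill ''y'' (NConst 0) (entry ''u'' (nvar ''n''))) t u"
      note fru = frameD[OF this(3), simplified]
      show "rval u (entry ''u'' (nvar ''n'')) = fst (snd (nrn n)) j"
        using j n d nt by (simp add: fru fr)
    next
      fix u assume "frame (Fill ''y'' (NConst 0) (entry ''u'' (nvar ''n''))) t u"
        and y: "(\<forall>j<d. rmem u ''y'' (0 + j) = fst (snd (nrn n)) j) \<and> (\<forall>l. l < 0 \<or> 0 + d \<le> l \<longrightarrow> rmem u ''y'' l = rmem t ''y'' l)"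
      note fru = frameD[OF this(1), simplified]
      have "vec_at d u ''y'' = fst (snd (nrn n))" by (rule vec_at_eqI[OF scan_neuron_ext]) (use y in simp)
      then show "runs d F \<omega> (Emit (RLoad ''a'' (nvar ''n'')) ''y'' (RLoad ''c'' (nvar ''n''))) u (d + 20)
          (\<lambda>t. out t = out s @ map nrn [0..<Suc n])"
        using I n nt by (intro runs_Emit) (auto simp: fru)
    qed (auto intro!: mult_le_mono)
  next
    have "(N + 2 + 1) * ((d + 1) * 50 + d + 20 + ncost (NAdd num_cells (NConst 2)) + 13) \<le> emit_cost d N"
      unfolding emit_cost_def by (intro mult_le_mono) auto
    then show "(N + 2 + 1) * ((d + 1) * 50 + d + 20 + ncost (NAdd num_cells (NConst 2)) + 13) \<le> K"
      using K by (rule order_trans)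
  qed (auto simp: tick_def nwrite_def)
  then show ?thesis by (simp only: EmitNet_def line_net_def scan_net_def)
qed

text \<open>The equation for \<open>drawn s\<close> ties the position in the random sequence to the
  index \<open>j\<close> of \<open>round_vec\<close>; it is reproduced for \<open>Suc j\<close>
  whether or not the round is accepted.\<close>

lemma runs_Round:
  fixes M j :: nat
  defines "m \<equiv> 2 * M * Q ^ 262"
  assumes d: "nmem s ''d'' 0 = d" "nmem s ''Q'' 0 = Q" "nmem s ''M'' 0 = M"
    and drawn: "drawn s = j * (m + 2) * d"
    and pv: "p = round_vec d m \<omega> j 0" "v = round_vec d m \<omega> j 1"
    and K: "round_cost d N m \<le> K"
  shows "runs d F \<omega> Round s K (\<lambda>t. drawn t = Suc j * (m + 2) * d \<and>
    (if accepted d F Q m (round_vec d m \<omega> j) then out t = out s @ line_net d F Q p v \<and> nmem t ''done'' 0 = 1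
     else out t = out s \<and> nmem t ''done'' 0 = nmem s ''done'' 0))"
proof -
  let ?G = "relu_network d (line_net d F Q p v)"
  obtain t1 where t1: "exec d F \<omega> (SampleVec ''p'') s t1" "steps t1 \<le> steps s + (d + 1) * 20" "frame (SampleVec ''p'') s t1"
    "\<forall>i<d. rmem t1 ''p'' i = \<omega> (drawn s + i)" "drawn t1 = drawn s + d"
    using runs_SampleVec[OF d(1) order_refl] by (rule runsE) auto
  note fr1 = frameD[OF t1(3), simplified]
  have d1: "nmem t1 ''d'' 0 = d" using d by (simp add: fr1)
  obtain t2 where t2: "exec d F \<omega> (SampleVec ''v'') t1 t2" "steps t2 \<le> steps t1 + (d + 1) * 20" "frame (SampleVec ''v'') t1 t2"
    "\<forall>i<d. rmem t2 ''v'' i = \<omega> (drawn t1 + i)" "drawn t2 = drawn t1 + d"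
    using runs_SampleVec[OF d1 order_refl] by (rule runsE) auto
  note fr2 = frameD[OF t2(3), simplified]
  have p: "rmem t2 ''p'' i = p i" if "i < d" for i
    using that t1(4) by (simp add: fr2 pv round_vec_def drawn)
  have v: "rmem t2 ''v'' i = v i" if "i < d" for i
    using that t2(4) t1(5) by (simp add: pv round_vec_def drawn algebra_simps)
  have dQ2: "nmem t2 ''d'' 0 = d" "nmem t2 ''Q'' 0 = Q" "nmem t2 ''M'' 0 = M"
    using d by (simp_all add: fr2 fr1)
  let ?f = "RAdd (RMul (RLoad ''p'' (nvar ''j'')) (RLoad ''p'' (nvar ''j'')))
        (RMul (RLoad ''v'' (nvar ''j'')) (RLoad ''v'' (nvar ''j'')))"
  have "runs d F \<omega> (SumLoop ''S'' (RConst 0) ?f) t2 ((d + 2) * 50)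
     (\<lambda>t. rmem t ''S'' 0 = rval t2 (RConst 0) + (\<Sum>i<d. p i * p i + v i * v i))"
  proof (rule runs_SumLoop)
    fix u i assume i: "i < d" "nmem u ''j'' 0 = i" and "frame (SumLoop ''S'' (RConst 0) ?f) t2 u"
    note fru = frameD[OF this(3), simplified]
    show "rval u ?f = p i * p i + v i * v i" using i p v by (simp add: fru)
  qed (auto intro!: mult_le_mono simp: dQ2)
  then obtain t3 where t3: "exec d F \<omega> (SumLoop ''S'' (RConst 0) ?f) t2 t3" "steps t3 \<le> steps t2 + (d + 2) * 50"
    "frame (SumLoop ''S'' (RConst 0) ?f) t2 t3" "rmem t3 ''S'' 0 = (\<Sum>i<d. p i * p i + v i * v i)"
    by (rule runsE) auto
  note fr3 = frameD[OF t3(3), simplified]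
  have "runs d F \<omega> (NStore ''ok'' (NConst 0) (NConst 1)) t3 3 (\<lambda>t. nmem t ''ok'' 0 = 1)"
    by (rule runs_NStore) auto
  then obtain t4 where t4: "exec d F \<omega> (NStore ''ok'' (NConst 0) (NConst 1)) t3 t4" "steps t4 \<le> steps t3 + 3"
    "frame (NStore ''ok'' (NConst 0) (NConst 1)) t3 t4" "nmem t4 ''ok'' 0 = 1"
    by (rule runsE)
  note fr4 = frameD[OF t4(3), simplified]
  let ?b = "RLess (ROfNat (qpow 4)) (rvar ''S'')"
  have b: "bval t4 ?b \<longleftrightarrow> \<not> line_short d Q p v"
    using t3(4) dQ2 by (simp add: fr4 fr3 not_le sum.distrib power2_eq_square)
  have "runs d F \<omega> (Cond ?b (NStore ''ok'' (NConst 0) (NConst 0)) Skip) t4 60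
    (\<lambda>t. nmem t ''ok'' 0 = (if line_short d Q p v then 1 else 0))"
    by (rule runs_Cond[where K=3]) (use b t4(4) in \<open>auto intro!: runs_NStore runs_Skip\<close>)
  then obtain t5 where t5: "exec d F \<omega> (Cond ?b (NStore ''ok'' (NConst 0) (NConst 0)) Skip) t4 t5" "steps t5 \<le> steps t4 + 60"
    "frame (Cond ?b (NStore ''ok'' (NConst 0) (NConst 0)) Skip) t4 t5"
    "nmem t5 ''ok'' 0 = (if line_short d Q p v then 1 else 0)"
    by (rule runsE)
  note fr5 = frameD[OF t5(3), simplified]
  have L: "line_loaded t5"
    using dQ2 p v by (simp add: line_loaded_def fr5 fr4 fr3)
  obtain t6 where t6: "exec d F \<omega> BuildNet t5 t6" "steps t6 \<le> steps t5 + build_cost d N"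
    "frame BuildNet t5 t6" "\<forall>n<N + 2. neuron_at t6 n (nrn n)"
    using runs_BuildNet[OF L, folded build_cost_def, OF order_refl] by (rule runsE)
  note fr6 = frameD[OF t6(3), simplified]
  have dQ6: "nmem t6 ''d'' 0 = d" "nmem t6 ''Q'' 0 = Q" "nmem t6 ''M'' 0 = M"
    using dQ2 by (simp_all add: fr6 fr5 fr4 fr3)
  define X where "X i = round_vec d m \<omega> j (i + 2)" for i
  let ?I = "\<lambda>i t. drawn t = drawn s + (i + 2) * d \<and> nmem t ''ok'' 0 =
    (if line_short d Q p v \<and> (\<forall>l<i. passes d (real Q ^ 4) F ?G (X l)) then 1 else 0)"
  have "runs d F \<omega> (For ''i'' num_tests TestStep) t6 ((m + 1) * (test_cost d N + 810)) (?I m)"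
  proof (rule runs_For[where I="?I" and n=m])
    show "?I 0 t6" using t1(5) t2(5) t5(4) by (simp add: fr6 fr5 fr4 fr3)
  next
    fix u assume "frame (For ''i'' num_tests TestStep) t6 u"
    note fru = frameD[OF this, simplified]
    show "nval u num_tests = m" by (simp add: fru dQ6 m_def)
  next
    fix i u assume i: "i < m" "nmem u ''i'' 0 = i" and fr: "frame (For ''i'' num_tests TestStep) t6 u" and I: "?I i u"
    note fru = frameD[OF fr, simplified]
    have Xi: "(\<lambda>l\<in>{..<d}. \<omega> (drawn u + l)) = X i"
      using I by (auto simp: X_def round_vec_def drawn fun_eq_iff algebra_simps)
    have "runs d F \<omega> TestStep u (test_cost d N) (\<lambda>t. drawn t = drawn u + d \<and> nmem t ''ok'' 0 =
        (if passes d (real Q ^ 4) F ?G (\<lambda>l\<in>{..<d}. \<omega> (drawn u + l)) then nmem u ''ok'' 0 else 0))"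
    proof (rule runs_TestStep)
      show "neuron_at u n (nrn n)" if "n < N + 2" for n
        using t6(4) that by (intro neuron_at_frame[OF _ fr]) auto
    qed (simp_all add: fru dQ6)
    then show "runs d F \<omega> TestStep u (test_cost d N) (?I (Suc i))"
      unfolding Xi by (rule runs_conseq) (use I in \<open>auto simp: less_Suc_eq\<close>)
  next
    show "(m + 1) * (test_cost d N + ncost num_tests + 13) \<le> (m + 1) * (test_cost d N + 810)"
      by (intro mult_le_mono) auto
  qed auto
  then obtain t7 where t7: "exec d F \<omega> (For ''i'' num_tests TestStep) t6 t7"
    "steps t7 \<le> steps t6 + (m + 1) * (test_cost d N + 810)" "frame (For ''i'' num_tests TestStep) t6 t7" "?I m t7"
    by (rule runsE)
  note fr7 = frameD[OF t7(3), simplified]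
  have acc: "accepted d F Q m (round_vec d m \<omega> j) \<longleftrightarrow>
      line_short d Q p v \<and> (\<forall>l<m. passes d (real Q ^ 4) F ?G (X l))"
    by (simp add: accepted_def pv X_def)
  have nr7: "neuron_at t7 n (nrn n)" if "n < N + 2" for n
    using t6(4) that by (intro neuron_at_frame[OF _ t7(3)]) auto
  have out7: "out t7 = out s" by (simp add: fr7 fr6 fr5 fr4 fr3 fr2 fr1)
  have done7: "nmem t7 ''done'' = nmem s ''done''" by (simp add: fr7 fr6 fr5 fr4 fr3 fr2 fr1)
  let ?b = "NLess (NConst 0) (nvar ''ok'')"
  let ?E = "Seq EmitNet (NStore ''done'' (NConst 0) (NConst 1))"
  let ?R = "\<lambda>t. if accepted d F Q m (round_vec d m \<omega> j) then out t = out s @ line_net d F Q p v \<and> nmem t ''done'' 0 = 1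
     else out t = out s \<and> nmem t ''done'' 0 = nmem s ''done'' 0"
  have "runs d F \<omega> (Cond ?b ?E Skip) t7 (emit_cost d N + 30) ?R"
  proof (rule runs_Cond[where K="emit_cost d N + 10"])
    assume "bval t7 ?b"
    then have a: "accepted d F Q m (round_vec d m \<omega> j)" using t7(4) by (auto simp: acc split: if_splits)
    let ?t = "tick (bcost ?b + 1) t7"
    show "runs d F \<omega> ?E ?t (emit_cost d N + 10) ?R"
    proof (rule runs_Seq[OF runs_EmitNet[OF _ _ _ order_refl]])
      show "nmem ?t ''d'' 0 = d" "nmem ?t ''Q'' 0 = Q" using dQ6 by (simp_all add: fr7)
      show "neuron_at ?t n (nrn n)" if "n < N + 2" for n using nr7[OF that] by simp
    next
      fix u :: state assume "out u = out ?t @ line_net d F Q p v"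
      then show "runs d F \<omega> (NStore ''done'' (NConst 0) (NConst 1)) u 5 ?R"
        using a out7 by (intro runs_NStore) auto
    qed simp
  next
    assume "\<not> bval t7 ?b"
    then have "\<not> accepted d F Q m (round_vec d m \<omega> j)" using t7(4) by (auto simp: acc split: if_splits)
    then show "runs d F \<omega> Skip (tick (bcost ?b + 1) t7) (emit_cost d N + 10) ?R"
      using out7 done7 by (intro runs_Skip) auto
  qed simp
  then obtain t8 where t8: "exec d F \<omega> (Cond ?b ?E Skip) t7 t8" "steps t8 \<le> steps t7 + (emit_cost d N + 30)"
     "frame (Cond ?b ?E Skip) t7 t8" "?R t8"
    by (rule runsE)
  note fr8 = frameD[OF t8(3), simplified]
  have "exec d F \<omega> Round s t8"
    unfolding Round_def using t1(1) t2(1) t3(1) t4(1) t5(1) t6(1) t7(1) t8(1) by (intro exec.Seq)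
  moreover have "steps t8 \<le> steps s + K"
    using t1(2) t2(2) t3(2) t4(2) t5(2) t6(2) t7(2) t8(2) K by (simp add: round_cost_def)
  moreover have "drawn t8 = Suc j * (m + 2) * d"
    using t7(4) by (simp add: fr8 drawn algebra_simps)
  ultimately show ?thesis using t8(4) unfolding runs_def by blast
qed

end

text \<open>Once a candidate has been written, the remaining iterations skip, so that the output is
  a single network.\<close>

definition Rounds :: com where
  "Rounds = For ''r'' (nvar ''M'') (Cond (NLess (nvar ''done'') (NConst 1)) Round Skip)"

text \<open>For a random sequence without an accepted round only termination in time is claimed; the
  worst-case bound rests on that. The invariant follows the sample count as long as nothing has been
  accepted and drops it afterwards.\<close>

lemma runs_Rounds:
  fixes d Q M :: nat and F :: "vec \<Rightarrow> real"
  defines "m \<equiv> 2 * M * Q ^ 262"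
  assumes d: "nmem s ''d'' 0 = d" "nmem s ''Q'' 0 = Q" "nmem s ''M'' 0 = M" "nmem s ''done'' 0 = 0"
    and s: "drawn s = 0" "out s = []"
    and K: "(M + 1) * (round_cost d (2 * Q ^ 42) m + 40) \<le> K"
  shows "runs d F \<omega> Rounds s K (\<lambda>t. (\<exists>j<M. accepted d F Q m (round_vec d m \<omega> j)) \<longrightarrow>
    (\<exists>j<M. accepted d F Q m (round_vec d m \<omega> j) \<and>
       out t = line_net d F Q (round_vec d m \<omega> j 0) (round_vec d m \<omega> j 1)))"
proof -
  let ?acc = "\<lambda>j. accepted d F Q m (round_vec d m \<omega> j)"
  let ?I = "\<lambda>n t. (nmem t ''done'' 0 = 0 \<and> out t = [] \<and> drawn t = n * (m + 2) * d \<and> (\<forall>j<n. \<not> ?acc j)) \<or>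
    (nmem t ''done'' 0 = 1 \<and> (\<exists>j<n. ?acc j \<and> out t = line_net d F Q (round_vec d m \<omega> j 0) (round_vec d m \<omega> j 1)))"
  let ?C = "Cond (NLess (nvar ''done'') (NConst 1)) Round Skip"
  have "runs d F \<omega> Rounds s K (?I M)"
    unfolding Rounds_def
  proof (rule runs_For[where I="?I" and n=M])
    show "?I 0 s" using d s by simp
  next
    fix t assume "frame (For ''r'' (nvar ''M'') ?C) s t"
    note fr = frameD[OF this, simplified]
    show "nval t (nvar ''M'') = M" using d by (simp add: fr)
  next
    fix j t assume j: "j < M" "nmem t ''r'' 0 = j" and "frame (For ''r'' (nvar ''M'') ?C) s t" and I: "?I j t"
    note fr = frameD[OF this(3), simplified]
    have dQ: "nmem t ''d'' 0 = d" "nmem t ''Q'' 0 = Q" "nmem t ''M'' 0 = M" using d by (simp_all add: fr)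
    show "runs d F \<omega> ?C t (round_cost d (2 * Q ^ 42) m + 20) (?I (Suc j))"
    proof (rule runs_Cond[where K="round_cost d (2 * Q ^ 42) m + 1"])
      let ?t = "tick (bcost (NLess (nvar ''done'') (NConst 1)) + 1) t"
      assume "bval t (NLess (nvar ''done'') (NConst 1))"
      then have I': "nmem t ''done'' 0 = 0" "out t = []" "drawn t = j * (m + 2) * d" "\<forall>l<j. \<not> ?acc l"
        using I by auto
      have "runs d F \<omega> Round ?t (round_cost d (2 * Q ^ 42) m) (\<lambda>u. drawn u = Suc j * (m + 2) * d \<and>
        (if ?acc j then out u = out ?t @ line_net d F Q (round_vec d m \<omega> j 0) (round_vec d m \<omega> j 1) \<and> nmem u ''done'' 0 = 1
         else out u = out ?t \<and> nmem u ''done'' 0 = nmem ?t ''done'' 0))"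
        unfolding m_def
        by (rule scan_program.runs_Round) (use dQ I'(3) in \<open>auto simp: m_def\<close>)
      then show "runs d F \<omega> Round ?t (round_cost d (2 * Q ^ 42) m + 1) (?I (Suc j))"
      proof (rule runs_conseq)
        fix u assume "drawn u = Suc j * (m + 2) * d \<and>
        (if ?acc j then out u = out ?t @ line_net d F Q (round_vec d m \<omega> j 0) (round_vec d m \<omega> j 1) \<and> nmem u ''done'' 0 = 1
         else out u = out ?t \<and> nmem u ''done'' 0 = nmem ?t ''done'' 0)"
        then show "?I (Suc j) u" using I' by (cases "?acc j") (auto simp: less_Suc_eq)
      qed simp
    next
      assume "\<not> bval t (NLess (nvar ''done'') (NConst 1))"
      then have "nmem t ''done'' 0 = 1" "\<exists>l<j. ?acc l \<and> out t = line_net d F Q (round_vec d m \<omega> l 0) (round_vec d m \<omega> l 1)"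
        using I by auto
      then show "runs d F \<omega> Skip (tick (bcost (NLess (nvar ''done'') (NConst 1)) + 1) t) (round_cost d (2 * Q ^ 42) m + 1) (?I (Suc j))"
        by (intro runs_Skip) (auto intro: less_SucI)
    qed simp
  next
    have "(M + 1) * (round_cost d (2 * Q ^ 42) m + 20 + ncost (nvar ''M'') + 13) \<le> (M + 1) * (round_cost d (2 * Q ^ 42) m + 40)"
      by (intro mult_le_mono) auto
    then show "(M + 1) * (round_cost d (2 * Q ^ 42) m + 20 + ncost (nvar ''M'') + 13) \<le> K" using K by (rule order_trans)
  qed (auto simp: tick_def nwrite_def)
  then show ?thesis by (rule runs_conseq) auto
qed

section \<open>Finding the parameters by counting\<close>

definition IncQ :: com where
  "IncQ = NStore ''Q'' (NConst 0) (NAdd (nvar ''Q'') (NConst 1))"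

definition Double :: com where
  "Double = Seq (RStore ''x'' (NConst 0) (RAdd (rvar ''x'') (rvar ''x'')))
     (NStore ''M'' (NConst 0) (NAdd (nvar ''M'') (NConst 1)))"

lemma IncQ_simps [simp]:
  "nmod IncQ = {''Q''}" "rmod IncQ = {}" "\<not> emits IncQ" "\<not> draws IncQ"
  by (auto simp: IncQ_def)

lemma Double_simps [simp]:
  "nmod Double = {''M''}" "rmod Double = {''x''}" "\<not> emits Double" "\<not> draws Double"
  by (auto simp: Double_def)

text \<open>Reals cannot be rounded to naturals on this machine, so \<open>Q\<close> and the number \<open>M\<close> of rounds are
  found by counting.\<close>

definition Init :: com where
  "Init = Seq (NStore ''Q'' (NConst 0) (NAdd (NAdd (nvar ''d'') (nvar ''k'')) (NConst 4)))
    (Seq (While (RLess (ROfNat (nvar ''Q'')) (rvar ''R'')) IncQ)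
    (Seq (While (RLess (ROfNat (nvar ''Q'')) (rvar ''B'')) IncQ)
    (Seq (While (RLess (RMul (ROfNat (nvar ''Q'')) (rvar ''eps'')) (RConst 1)) IncQ)
    (Seq (RStore ''x'' (NConst 0) (rvar ''delta''))
      (While (RLess (rvar ''x'') (RConst 2)) Double)))))"

definition Learner :: com where
  "Learner = Seq Init Rounds"

primrec interacts :: "com \<Rightarrow> bool" where
  "interacts Skip = False"
| "interacts (NStore x e f) = False"
| "interacts (RStore x e f) = False"
| "interacts (Sample x e) = True"
| "interacts (Query x e y) = True"
| "interacts (Emit a y c) = False"
| "interacts (Seq c1 c2) = (interacts c1 \<or> interacts c2)"
| "interacts (Cond b c1 c2) = (interacts c1 \<or> interacts c2)"
| "interacts (While b c) = interacts c"

text \<open>Applied to \<open>Init\<close>, it shows that \<open>Q\<close> and \<open>M\<close>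
  depend neither on the oracle nor on the randomness. They must be fixed before an event of random
  sequences is chosen for them.\<close>

lemma exec_noninteractive: "exec d F \<omega> c s t \<Longrightarrow> \<not> interacts c \<Longrightarrow> exec d F' \<omega>' c s t"
proof (induction rule: exec.induct)
  case (Skip s) show ?case by (rule exec.Skip)
next
  case (NStore x e f s) show ?case by (rule exec.NStore)
next
  case (RStore x e f s) show ?case by (rule exec.RStore)
next
  case (Emit a y c s) show ?case by (rule exec.Emit)
next
  case (WhileFalse s b c) then show ?case by (intro exec.WhileFalse)
next
  case (CondTrue s b c1 t c2) then show ?case by (intro exec.CondTrue) simp_all
next
  case (CondFalse s b c2 t c1) then show ?case by (intro exec.CondFalse) simp_all
next
  case (WhileTrue s b c t u) then show ?case by (auto intro: exec.WhileTrue)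
qed (auto intro: exec.Seq)

text \<open>The guard enters only through its threshold \<open>y\<close>, which covers all three
  loops, in particular \<open>Q * eps < 1\<close> with \<open>y = 1 / \<epsilon>\<close>. An
  increment happens only below \<open>y\<close>, so \<open>Q\<close> never passes
  \<open>y + 1\<close> unless it starts there.\<close>

lemma runs_IncQ:
  assumes b: "\<And>t. frame (While b IncQ) s t \<Longrightarrow> bval t b \<longleftrightarrow> real (nmem t ''Q'' 0) < y"
    and y: "0 \<le> y" and cost: "bcost b \<le> 10" and K: "(nat \<lceil>y\<rceil> + 1) * 17 \<le> K"
  shows "runs d F \<omega> (While b IncQ) s K (\<lambda>t. nmem s ''Q'' 0 \<le> nmem t ''Q'' 0 \<and> y \<le> real (nmem t ''Q'' 0) \<and>
      real (nmem t ''Q'' 0) \<le> real (nmem s ''Q'' 0) + y + 1)"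
proof -
  let ?I = "\<lambda>t. frame (While b IncQ) s t \<and> nmem s ''Q'' 0 \<le> nmem t ''Q'' 0 \<and>
      real (nmem t ''Q'' 0) \<le> real (nmem s ''Q'' 0) + y + 1"
  let ?f = "\<lambda>t. nat \<lceil>y\<rceil> - nmem t ''Q'' 0"
  have "runs d F \<omega> (While b IncQ) s ((?f s + 1) * (6 + bcost b + 1)) (\<lambda>t. ?I t \<and> \<not> bval t b)"
  proof (rule runs_While[where I="?I" and f="?f"])
    show "?I s" using y by (simp add: frame_def)
  next
    fix t assume I: "?I t" and "bval t b"
    then have lt: "real (nmem t ''Q'' 0) < y" using b by blast
    then have "nmem t ''Q'' 0 < nat \<lceil>y\<rceil>" by linarith
    then show "runs d F \<omega> IncQ (tick (bcost b + 1) t) 6 (\<lambda>u. ?I u \<and> ?f u < ?f t)"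
      unfolding IncQ_def using I lt
      by (intro runs_NStore) (auto simp: frame_def IncQ_def)
  qed auto
  then show ?thesis
  proof (rule runs_conseq)
    have "(?f s + 1) * (6 + bcost b + 1) \<le> (nat \<lceil>y\<rceil> + 1) * 17" using cost by (intro mult_le_mono) auto
    then show "(?f s + 1) * (6 + bcost b + 1) \<le> K" using K by (rule order_trans)
  qed (use b in auto)
qed

text \<open>Before the last doubling the value is below \<open>2\<close>, hence
  \<open>\<delta> * 2 ^ M < 4\<close> throughout. Taking logarithms, \<open>ln 2 \<ge> 1 / 2\<close>
  gives \<open>M \<le> 2 * ln (1 / \<delta>) + 2\<close>.\<close>

lemma runs_Double:
  assumes x: "rmem s ''x'' 0 = \<delta>" "nmem s ''M'' 0 = 0" and \<delta>: "0 < \<delta>" "\<delta> < 1"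
    and K: "(nat \<lceil>2 * ln (1 / \<delta>) + 2\<rceil> + 2) * 20 \<le> K"
  shows "runs d F \<omega> (While (RLess (rvar ''x'') (RConst 2)) Double) s K
    (\<lambda>t. 2 \<le> \<delta> * 2 ^ nmem t ''M'' 0 \<and> nmem t ''M'' 0 \<le> nat \<lceil>2 * ln (1 / \<delta>) + 2\<rceil>)"
proof -
  let ?Z = "nat \<lceil>2 * ln (1 / \<delta>) + 2\<rceil>"
  have bound: "n \<le> ?Z" if "\<delta> * 2 ^ n < 4" for n
  proof -
    have "2 ^ n < 4 / \<delta>" using that \<delta> by (simp add: field_simps)
    then have "ln (2 ^ n) < ln (4 / \<delta>)" using \<delta> by (subst ln_less_cancel_iff) auto
    then have *: "real n * ln 2 < 2 * ln 2 + ln (1 / \<delta>)"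
      using \<delta> ln_realpow[of 2 2] by (simp add: ln_realpow ln_div)
    have l2: "1 / 2 \<le> ln (2 :: real)" using ln2_ge_two_thirds by simp
    have "0 \<le> ln (1 / \<delta>)" using \<delta> by simp
    have "real n \<le> 2 * ln (1 / \<delta>) + 2"
    proof (rule ccontr)
      assume "\<not> real n \<le> 2 * ln (1 / \<delta>) + 2"
      then have "2 * ln (1 / \<delta>) < real n - 2" by simp
      moreover have "(real n - 2) * (1 / 2) \<le> (real n - 2) * ln 2"
        using calculation l2 \<open>0 \<le> ln (1 / \<delta>)\<close> by (intro mult_left_mono) auto
      ultimately show False using * by (simp add: algebra_simps)
    qed
    then show ?thesis by linarith
  qed
  let ?I = "\<lambda>t. rmem t ''x'' 0 = \<delta> * 2 ^ nmem t ''M'' 0 \<and> \<delta> * 2 ^ nmem t ''M'' 0 < 4"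
  let ?f = "\<lambda>t. ?Z + 1 - nmem t ''M'' 0"
  let ?b = "RLess (rvar ''x'') (RConst 2)"
  have "runs d F \<omega> (While ?b Double) s ((?f s + 1) * (13 + bcost ?b + 1)) (\<lambda>t. ?I t \<and> \<not> bval t ?b)"
  proof (rule runs_While[where I="?I" and f="?f"])
    show "?I s" using x \<delta> by simp
  next
    fix t assume I: "?I t" and b: "bval t ?b"
    then have "nmem t ''M'' 0 \<le> ?Z" using bound by blast
    then show "runs d F \<omega> Double (tick (bcost ?b + 1) t) 13 (\<lambda>u. ?I u \<and> ?f u < ?f t)"
      unfolding Double_def using I b
      by (intro runs_RStore_Seq runs_NStore) auto
  qed auto
  then show ?thesis
  proof (rule runs_conseq)
    have "(?f s + 1) * (13 + bcost ?b + 1) \<le> (?Z + 2) * 20" using x by (intro mult_le_mono) auto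
    then show "(?f s + 1) * (13 + bcost ?b + 1) \<le> K" using K by (rule order_trans)
  qed (use bound in auto)
qed

section \<open>Polynomial running time\<close>

text \<open>Here \<open>z\<close> stands for an upper bound of both \<open>d\<close> and
  \<open>Q\<close>, and \<open>y\<close> for one of \<open>M\<close>. The first line pays for
  \<open>Init\<close>, the second for the rounds.\<close>

definition total_cost :: "'a::comm_semiring_1 \<Rightarrow> 'a \<Rightarrow> 'a" where
  "total_cost z y = 100 + (z + 1) * 60 + (y + 2) * 20
     + (y + 1) * (round_cost z (2 * z ^ 42) (2 * y * z ^ 262) + 40)"

lemma round_cost_mono:
  fixes d :: "'a::linordered_semidom"
  assumes "0 \<le> d" "d \<le> d'" "0 \<le> N" "N \<le> N'" "0 \<le> m" "m \<le> m'"
  shows "round_cost d N m \<le> round_cost d' N' m'"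
  unfolding round_cost_def build_cost_def test_cost_def emit_cost_def
  by (intro add_mono mult_mono' order_refl assms add_nonneg_nonneg mult_nonneg_nonneg zero_le_numeral zero_le_one)

lemma round_cost_nonneg:
  fixes d :: "'a::linordered_semidom"
  assumes "0 \<le> d" "0 \<le> N" "0 \<le> m"
  shows "0 \<le> round_cost d N m"
  unfolding round_cost_def build_cost_def test_cost_def emit_cost_def
  by (intro assms add_nonneg_nonneg mult_nonneg_nonneg zero_le_numeral zero_le_one)

lemma total_cost_mono:
  fixes z :: "'a::linordered_semidom"
  assumes "0 \<le> z" "z \<le> z'" "0 \<le> y" "y \<le> y'"
  shows "total_cost z y \<le> total_cost z' y'"
  unfolding total_cost_def
  by (intro add_mono mult_mono' order_refl round_cost_mono round_cost_nonneg power_mono assms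
      add_nonneg_nonneg mult_nonneg_nonneg zero_le_power zero_le_numeral zero_le_one)

lemma of_nat_total_cost: "real (total_cost z y) = total_cost (real z) (real y)"
  by (simp only: total_cost_def round_cost_def build_cost_def test_cost_def emit_cost_def
      of_nat_add of_nat_mult of_nat_power of_nat_numeral of_nat_1)

text \<open>Every query passes a restricted vector, so the values of the oracle outside the
  extensional vectors are never seen.\<close>

lemma exec_oracle_cong:
  assumes "\<And>x. x \<in> {..<d} \<rightarrow>\<^sub>E UNIV \<Longrightarrow> F x = F' x"
  shows "exec d F \<omega> c s t \<Longrightarrow> exec d F' \<omega> c s t"
proof (induction rule: exec.induct)
  case (Query x e y s)
  have "F (vec_at d s y) = F' (vec_at d s y)" by (rule assms) (simp add: vec_at_def)
  then show ?case using exec.Query[of d F' \<omega> x e y s] by simp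
next
  case (Skip s) show ?case by (rule exec.Skip)
next
  case (NStore x e f s) show ?case by (rule exec.NStore)
next
  case (RStore x e f s) show ?case by (rule exec.RStore)
next
  case (Emit a y c s) show ?case by (rule exec.Emit)
next
  case (WhileFalse s b c) then show ?case by (intro exec.WhileFalse)
next
  case (CondTrue s b c1 t c2) then show ?case by (intro exec.CondTrue) simp_all
next
  case (CondFalse s b c2 t c1) then show ?case by (intro exec.CondFalse) simp_all
next
  case (WhileTrue s b c t u) then show ?case by (auto intro: exec.WhileTrue)
next
  case (Sample x e s) show ?case by (rule exec.Sample)
qed (auto intro: exec.Seq)

lemma runs_Init:
  fixes d k :: nat and R B \<epsilon> \<delta> :: real
  assumes pos: "0 < R" "0 < B" "0 < \<epsilon>" "0 < \<delta>" "\<delta> < 1"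
  defines "s \<equiv> init_state d k R B \<epsilon> \<delta>"
  shows "runs d F \<omega> Init s (50 + (nat \<lceil>R\<rceil> + 1) * 17 + (nat \<lceil>B\<rceil> + 1) * 17 + (nat \<lceil>1 / \<epsilon>\<rceil> + 1) * 17
      + (nat \<lceil>2 * ln (1 / \<delta>) + 2\<rceil> + 2) * 20)
    (\<lambda>t. d + k + 4 \<le> nmem t ''Q'' 0 \<and> R \<le> real (nmem t ''Q'' 0) \<and> B \<le> real (nmem t ''Q'' 0) \<and> 1 / \<epsilon> \<le> real (nmem t ''Q'' 0) \<and>
      real (nmem t ''Q'' 0) \<le> real d + real k + R + B + 1 / \<epsilon> + 7 \<and>
      2 \<le> \<delta> * 2 ^ nmem t ''M'' 0 \<and> nmem t ''M'' 0 \<le> nat \<lceil>2 * ln (1 / \<delta>) + 2\<rceil>)"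
proof -
  let ?w1 = "While (RLess (ROfNat (nvar ''Q'')) (rvar ''R'')) IncQ"
  let ?w2 = "While (RLess (ROfNat (nvar ''Q'')) (rvar ''B'')) IncQ"
  let ?w3 = "While (RLess (RMul (ROfNat (nvar ''Q'')) (rvar ''eps'')) (RConst 1)) IncQ"
  let ?w4 = "While (RLess (rvar ''x'') (RConst 2)) Double"
  have s: "nmem s ''d'' 0 = d" "nmem s ''k'' 0 = k" "nmem s ''M'' 0 = 0"
    "rmem s ''R'' 0 = R" "rmem s ''B'' 0 = B" "rmem s ''eps'' 0 = \<epsilon>" "rmem s ''delta'' 0 = \<delta>"
    by (simp_all add: s_def init_state_def)
  let ?c0 = "NStore ''Q'' (NConst 0) (NAdd (NAdd (nvar ''d'') (nvar ''k'')) (NConst 4))"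
  have "runs d F \<omega> ?c0 s 20 (\<lambda>t. nmem t ''Q'' 0 = d + k + 4)"
    by (rule runs_NStore) (auto simp: s)
  then obtain t0 where t0: "exec d F \<omega> ?c0 s t0" "steps t0 \<le> steps s + 20" "frame ?c0 s t0" "nmem t0 ''Q'' 0 = d + k + 4"
    by (rule runsE)
  note fr0 = frameD[OF t0(3), simplified]
  have "runs d F \<omega> ?w1 t0 ((nat \<lceil>R\<rceil> + 1) * 17) (\<lambda>t. nmem t0 ''Q'' 0 \<le> nmem t ''Q'' 0 \<and> R \<le> real (nmem t ''Q'' 0) \<and>
      real (nmem t ''Q'' 0) \<le> real (nmem t0 ''Q'' 0) + R + 1)"
    using pos s by (intro runs_IncQ) (auto simp: frame_def fr0)
  then obtain t1 where t1: "exec d F \<omega> ?w1 t0 t1" "steps t1 \<le> steps t0 + (nat \<lceil>R\<rceil> + 1) * 17" "frame ?w1 t0 t1"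
    "nmem t0 ''Q'' 0 \<le> nmem t1 ''Q'' 0 \<and> R \<le> real (nmem t1 ''Q'' 0) \<and> real (nmem t1 ''Q'' 0) \<le> real (nmem t0 ''Q'' 0) + R + 1"
    by (rule runsE)
  note fr1 = frameD[OF t1(3), simplified]
  have "runs d F \<omega> ?w2 t1 ((nat \<lceil>B\<rceil> + 1) * 17) (\<lambda>t. nmem t1 ''Q'' 0 \<le> nmem t ''Q'' 0 \<and> B \<le> real (nmem t ''Q'' 0) \<and>
      real (nmem t ''Q'' 0) \<le> real (nmem t1 ''Q'' 0) + B + 1)"
    using pos s by (intro runs_IncQ) (auto simp: frame_def fr0 fr1)
  then obtain t2 where t2: "exec d F \<omega> ?w2 t1 t2" "steps t2 \<le> steps t1 + (nat \<lceil>B\<rceil> + 1) * 17" "frame ?w2 t1 t2"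
    "nmem t1 ''Q'' 0 \<le> nmem t2 ''Q'' 0 \<and> B \<le> real (nmem t2 ''Q'' 0) \<and> real (nmem t2 ''Q'' 0) \<le> real (nmem t1 ''Q'' 0) + B + 1"
    by (rule runsE)
  note fr2 = frameD[OF t2(3), simplified]
  have "runs d F \<omega> ?w3 t2 ((nat \<lceil>1 / \<epsilon>\<rceil> + 1) * 17) (\<lambda>t. nmem t2 ''Q'' 0 \<le> nmem t ''Q'' 0 \<and> 1 / \<epsilon> \<le> real (nmem t ''Q'' 0) \<and>
      real (nmem t ''Q'' 0) \<le> real (nmem t2 ''Q'' 0) + 1 / \<epsilon> + 1)"
    using pos s by (intro runs_IncQ) (auto simp: frame_def fr0 fr1 fr2 pos_less_divide_eq)
  then obtain t3 where t3: "exec d F \<omega> ?w3 t2 t3" "steps t3 \<le> steps t2 + (nat \<lceil>1 / \<epsilon>\<rceil> + 1) * 17" "frame ?w3 t2 t3"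
    "nmem t2 ''Q'' 0 \<le> nmem t3 ''Q'' 0 \<and> 1 / \<epsilon> \<le> real (nmem t3 ''Q'' 0) \<and> real (nmem t3 ''Q'' 0) \<le> real (nmem t2 ''Q'' 0) + 1 / \<epsilon> + 1"
    by (rule runsE)
  note fr3 = frameD[OF t3(3), simplified]
  let ?c4 = "RStore ''x'' (NConst 0) (rvar ''delta'')"
  have "runs d F \<omega> ?c4 t3 5 (\<lambda>t. rmem t ''x'' 0 = \<delta>)"
    by (rule runs_RStore) (auto simp: s fr0 fr1 fr2 fr3)
  then obtain t4 where t4: "exec d F \<omega> ?c4 t3 t4" "steps t4 \<le> steps t3 + 5" "frame ?c4 t3 t4" "rmem t4 ''x'' 0 = \<delta>"
    by (rule runsE)
  note fr4 = frameD[OF t4(3), simplified]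
  have "nmem t4 ''M'' 0 = 0" by (simp add: fr4 fr3 fr2 fr1 fr0 s)
  from runs_Double[OF t4(4) this pos(4,5) order_refl]
  obtain t5 where t5: "exec d F \<omega> ?w4 t4 t5" "steps t5 \<le> steps t4 + (nat \<lceil>2 * ln (1 / \<delta>) + 2\<rceil> + 2) * 20" "frame ?w4 t4 t5"
    "2 \<le> \<delta> * 2 ^ nmem t5 ''M'' 0 \<and> nmem t5 ''M'' 0 \<le> nat \<lceil>2 * ln (1 / \<delta>) + 2\<rceil>"
    by (rule runsE)
  note fr5 = frameD[OF t5(3), simplified]
  have Q: "nmem t5 ''Q'' 0 = nmem t3 ''Q'' 0" by (simp add: fr5 fr4)
  have "exec d F \<omega> Init s t5"
    unfolding Init_def using t0(1) t1(1) t2(1) t3(1) t4(1) t5(1) by (intro exec.Seq)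
  moreover have "steps t5 \<le> steps s + (50 + (nat \<lceil>R\<rceil> + 1) * 17 + (nat \<lceil>B\<rceil> + 1) * 17 + (nat \<lceil>1 / \<epsilon>\<rceil> + 1) * 17
      + (nat \<lceil>2 * ln (1 / \<delta>) + 2\<rceil> + 2) * 20)"
    using t0(2) t1(2) t2(2) t3(2) t4(2) t5(2) by linarith
  moreover have "d + k + 4 \<le> nmem t5 ''Q'' 0" "R \<le> real (nmem t5 ''Q'' 0)" "B \<le> real (nmem t5 ''Q'' 0)" "1 / \<epsilon> \<le> real (nmem t5 ''Q'' 0)"
      "real (nmem t5 ''Q'' 0) \<le> real d + real k + R + B + 1 / \<epsilon> + 7"
    using t0(4) t1(4) t2(4) t3(4) unfolding Q by auto
  ultimately show ?thesis unfolding runs_def using t5(4) by blast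
qed

text \<open>The order of the quantifiers matters: \<open>Q\<close> and \<open>M\<close> are obtained
  before the oracle and the random sequence. In the cost bound, \<open>8\<close> and
  \<open>3\<close> are the constants \<open>7\<close> and \<open>2\<close> of
  \<open>runs_Init\<close> plus one for rounding up.\<close>

lemma Learner_correct:
  fixes d k :: nat and R B \<epsilon> \<delta> :: real
  assumes pos: "0 < R" "0 < B" "0 < \<epsilon>" "0 < \<delta>" "\<delta> < 1"
  defines "s \<equiv> init_state d k R B \<epsilon> \<delta>"
  obtains Q M m where "4 \<le> Q" "d \<le> Q" "k \<le> Q" "R \<le> real Q" "B \<le> real Q" "1 / \<epsilon> \<le> real Q" "2 \<le> \<delta> * 2 ^ M"
    "m = 2 * M * Q ^ 262"
    "\<forall>F \<omega>. \<exists>t. exec d F \<omega> Learner s t \<and>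
      real (steps t) \<le> total_cost (real d + real k + R + B + 1 / \<epsilon> + 8) (2 * ln (1 / \<delta>) + 3) \<and>
      ((\<exists>j<M. accepted d F Q m (round_vec d m \<omega> j)) \<longrightarrow>
       (\<exists>j<M. accepted d F Q m (round_vec d m \<omega> j) \<and>
         out t = line_net d F Q (round_vec d m \<omega> j 0) (round_vec d m \<omega> j 1)))"
proof -
  define q where "q = real d + real k + R + B + 1 / \<epsilon> + 7"
  define Z where "Z = nat \<lceil>q\<rceil>"
  define Y where "Y = nat \<lceil>2 * ln (1 / \<delta>) + 2\<rceil>"
  have ln0: "0 \<le> ln (1 / \<delta>)" using pos by simp
  have e0: "0 < 1 / \<epsilon>" using pos by simp
  have le: "R \<le> q" "B \<le> q" "1 / \<epsilon> \<le> q" "real d \<le> q" "0 \<le> q" using pos e0 by (simp_all add: q_def)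
  have Z: "nat \<lceil>R\<rceil> \<le> Z" "nat \<lceil>B\<rceil> \<le> Z" "nat \<lceil>1 / \<epsilon>\<rceil> \<le> Z"
    unfolding Z_def by (intro nat_mono ceiling_mono le)+
  have qZ: "q \<le> real Z" unfolding Z_def by linarith
  then have dZ: "d \<le> Z" using le(4) by linarith
  have Zq: "real Z \<le> real d + real k + R + B + 1 / \<epsilon> + 8"
    unfolding Z_def using le(5) by (simp add: q_def) linarith
  have Yq: "real Y \<le> 2 * ln (1 / \<delta>) + 3" unfolding Y_def using ln0 by linarith
  \<comment> \<open>\<open>Init\<close> is run once with a dummy oracle and a dummy random sequence;
    the run is replayed below for the actual ones.\<close>
  obtain t0 where t0: "exec d (\<lambda>_. 0) (\<lambda>_. 0) Init s t0"
    "steps t0 \<le> steps s + (50 + (nat \<lceil>R\<rceil> + 1) * 17 + (nat \<lceil>B\<rceil> + 1) * 17 + (nat \<lceil>1 / \<epsilon>\<rceil> + 1) * 17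
      + (nat \<lceil>2 * ln (1 / \<delta>) + 2\<rceil> + 2) * 20)" "frame Init s t0"
    "d + k + 4 \<le> nmem t0 ''Q'' 0 \<and> R \<le> real (nmem t0 ''Q'' 0) \<and> B \<le> real (nmem t0 ''Q'' 0) \<and> 1 / \<epsilon> \<le> real (nmem t0 ''Q'' 0) \<and>
      real (nmem t0 ''Q'' 0) \<le> real d + real k + R + B + 1 / \<epsilon> + 7 \<and>
      2 \<le> \<delta> * 2 ^ nmem t0 ''M'' 0 \<and> nmem t0 ''M'' 0 \<le> nat \<lceil>2 * ln (1 / \<delta>) + 2\<rceil>"
    using runs_Init[OF pos, of d "\<lambda>_. 0" "\<lambda>_. 0" k, folded s_def] by (rule runsE)
  define Q where "Q = nmem t0 ''Q'' 0"
  define M where "M = nmem t0 ''M'' 0"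
  define m where "m = 2 * M * Q ^ 262"
  have QZ: "Q \<le> Z" using t0(4) qZ unfolding Q_def q_def by linarith
  have MY: "M \<le> Y" using t0(4) unfolding M_def Y_def by blast
  have noint: "\<not> interacts Init" by (simp add: Init_def IncQ_def Double_def)
  have mods: "nmod Init = {''Q'', ''M''}" "\<not> emits Init" "\<not> draws Init" by (auto simp: Init_def)
  note fr = frameD(1)[OF t0(3), unfolded mods] frameD(3)[OF t0(3) mods(2)] frameD(4)[OF t0(3) mods(3)]
  have st: "nmem t0 ''d'' 0 = d" "nmem t0 ''done'' 0 = 0" "drawn t0 = 0" "out t0 = []" "steps s = 0"
    by (simp_all add: fr s_def init_state_def)
  have run: "\<exists>t. exec d F \<omega> Learner s t \<and>
      real (steps t) \<le> total_cost (real d + real k + R + B + 1 / \<epsilon> + 8) (2 * ln (1 / \<delta>) + 3) \<and>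
      ((\<exists>j<M. accepted d F Q m (round_vec d m \<omega> j)) \<longrightarrow>
       (\<exists>j<M. accepted d F Q m (round_vec d m \<omega> j) \<and>
         out t = line_net d F Q (round_vec d m \<omega> j 0) (round_vec d m \<omega> j 1)))" for F \<omega>
  proof -
    obtain t where t: "exec d F \<omega> Rounds t0 t" "steps t \<le> steps t0 + (M + 1) * (round_cost d (2 * Q ^ 42) m + 40)"
      "(\<exists>j<M. accepted d F Q m (round_vec d m \<omega> j)) \<longrightarrow>
       (\<exists>j<M. accepted d F Q m (round_vec d m \<omega> j) \<and>
         out t = line_net d F Q (round_vec d m \<omega> j 0) (round_vec d m \<omega> j 1))"
      using runs_Rounds[OF st(1) Q_def[symmetric] M_def[symmetric] st(2-4) order_refl, folded m_def]
      by (rule runsE)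
    have "exec d F \<omega> Learner s t"
      unfolding Learner_def using exec_noninteractive[OF t0(1) noint] t(1) by (rule exec.Seq)
    moreover have "steps t \<le> total_cost Z Y"
    proof -
      have "round_cost d (2 * Q ^ 42) m \<le> round_cost Z (2 * Z ^ 42) (2 * Y * Z ^ 262)"
        unfolding m_def using dZ QZ MY by (intro round_cost_mono mult_le_mono power_mono) auto
      then have W: "(M + 1) * (round_cost d (2 * Q ^ 42) m + 40) \<le> (Y + 1) * (round_cost Z (2 * Z ^ 42) (2 * Y * Z ^ 262) + 40)"
        using MY by (intro mult_le_mono) auto
      \<comment> \<open>The three counting loops take \<open>17\<close> steps per iteration,
        \<open>51 * Z + 51\<close> altogether, which fits into the \<open>60 * (Z + 1)\<close> of
        \<open>total_cost\<close>. Variables replace the large cost terms to keep the arithmetic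
        linear.\<close>
      have arith: "a \<le> 100 + (Z + 1) * 60 + c + w'"
        if "a \<le> b + w" "b \<le> 0 + (50 + (x + 1) * 17 + (y + 1) * 17 + (z + 1) * 17 + c)"
          "x \<le> Z" "y \<le> Z" "z \<le> Z" "w \<le> w'" for a b c w w' x y z Z :: nat
      proof -
        have "b \<le> 101 + 51 * Z + c" using that(2-5) by simp
        then show ?thesis using that(1,6) by simp
      qed
      show ?thesis
        using arith[OF t(2) t0(2)[unfolded st(5)] Z W] by (simp only: total_cost_def Y_def)
    qed
    then have "real (steps t) \<le> total_cost (real Z) (real Y)"
      unfolding of_nat_total_cost[symmetric] by (rule of_nat_mono)
    then have "real (steps t) \<le> total_cost (real d + real k + R + B + 1 / \<epsilon> + 8) (2 * ln (1 / \<delta>) + 3)"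
      by (rule order_trans) (intro total_cost_mono Zq Yq, auto)
    ultimately show ?thesis using t(3) by blast
  qed
  show thesis
    by (rule that[OF _ _ _ _ _ _ _ m_def allI[OF allI[OF run]]]) (use t0(4) in \<open>auto simp: Q_def M_def\<close>)
qed

lemma real_polynomial_function_round_cost:
  assumes "real_polynomial_function f" "real_polynomial_function g" "real_polynomial_function h"
  shows "real_polynomial_function (\<lambda>x. round_cost (f x) (g x) (h x))"
proof -
  note intros = assms real_polynomial_function.intros(2-4)
  have "real_polynomial_function (\<lambda>x. build_cost (f x) (g x))"
    unfolding build_cost_def by (intro intros)
  moreover have "real_polynomial_function (\<lambda>x. test_cost (f x) (g x))"
    unfolding test_cost_def by (intro intros)
  moreover have "real_polynomial_function (\<lambda>x. emit_cost (f x) (g x))"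
    unfolding emit_cost_def by (intro intros)
  ultimately show ?thesis
    unfolding round_cost_def by (intro intros)
qed

lemma real_polynomial_function_total_cost:
  assumes "real_polynomial_function f" "real_polynomial_function g"
  shows "real_polynomial_function (\<lambda>x. total_cost (f x) (g x))"
  unfolding total_cost_def
  by (intro assms real_polynomial_function_round_cost real_polynomial_function.intros(2-4)
      real_polynomial_function_power)

text \<open>The variables \<open>e\<close> and \<open>l\<close> stand for
  \<open>1 / \<epsilon>\<close> and \<open>ln (1 / \<delta>)\<close>. Projections are bounded
  linear, which makes them the base case of polynomial functions on tuples.\<close>

lemma real_polynomial_total_cost:
  "real_polynomial_function (\<lambda>(d :: real, B, R, k, e, l). total_cost (d + k + R + B + e + 8) (2 * l + 3) :: real)"
proof -
  let ?z = "\<lambda>x :: real \<times> real \<times> real \<times> real \<times> real \<times> real.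
    fst x + fst (snd (snd (snd x))) + fst (snd (snd x)) + fst (snd x) + fst (snd (snd (snd (snd x)))) + 8"
  let ?y = "\<lambda>x :: real \<times> real \<times> real \<times> real \<times> real \<times> real. 2 * snd (snd (snd (snd (snd x)))) + 3"
  have lin: "real_polynomial_function (\<lambda>x :: real \<times> real \<times> real \<times> real \<times> real \<times> real. fst x)"
    "real_polynomial_function (\<lambda>x :: real \<times> real \<times> real \<times> real \<times> real \<times> real. fst (snd x))"
    "real_polynomial_function (\<lambda>x :: real \<times> real \<times> real \<times> real \<times> real \<times> real. fst (snd (snd x)))"
    "real_polynomial_function (\<lambda>x :: real \<times> real \<times> real \<times> real \<times> real \<times> real. fst (snd (snd (snd x))))"
    "real_polynomial_function (\<lambda>x :: real \<times> real \<times> real \<times> real \<times> real \<times> real. fst (snd (snd (snd (snd x)))))"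
    "real_polynomial_function (\<lambda>x :: real \<times> real \<times> real \<times> real \<times> real \<times> real. snd (snd (snd (snd (snd x)))))"
    by (rule real_polynomial_function.intros(1),
        intro bounded_linear_fst_comp bounded_linear_snd_comp bounded_linear_ident)+
  have z: "real_polynomial_function ?z"
    by (intro real_polynomial_function.intros(2-4) lin)
  have y: "real_polynomial_function ?y"
    by (intro real_polynomial_function.intros(2-4) lin)
  have "real_polynomial_function (\<lambda>x. total_cost (?z x) (?y x))"
    by (rule real_polynomial_function_total_cost[OF z y])
  then show ?thesis by (simp add: case_prod_beta')
qed

theorem theorem1p1:
  shows "\<exists>(alg :: com) (p :: real \<times> real \<times> real \<times> real \<times> real \<times> real \<Rightarrow> real).
    real_polynomial_function p \<and>
    (\<forall>(d::nat) (k::nat) (R::real) (B::real) (\<epsilon>::real) (\<delta>::real) (F :: vec \<Rightarrow> real).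
       d \<ge> 1 \<longrightarrow> k \<ge> 1 \<longrightarrow> R > 0 \<longrightarrow> B > 0 \<longrightarrow> \<epsilon> > 0 \<longrightarrow> 0 < \<delta> \<longrightarrow> \<delta> < 1 \<longrightarrow>
       signed_relu_sum d k R B F \<longrightarrow>
       (\<forall>\<omega>. \<exists>t. exec d F \<omega> alg (init_state d k R B \<epsilon> \<delta>) t \<and>
          real (queries t) \<le> p (real d, B, R, real k, 1 / \<epsilon>, ln (1 / \<delta>)) \<and>
          real (steps t) \<le> p (real d, B, R, real k, 1 / \<epsilon>, ln (1 / \<delta>))) \<and>
       (\<exists>E \<in> sets gaussian_sequence.
          measure gaussian_sequence E \<ge> 1 - \<delta> \<and>
          (\<forall>\<omega>\<in>E. \<exists>t. exec d F \<omega> alg (init_state d k R B \<epsilon> \<delta>) t \<and>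
             expected_sq_error d F (relu_network d (out t)) \<le> ennreal \<epsilon>)))"
proof (intro exI[of _ Learner] exI[of _ "\<lambda>(d, B, R, k, e, l). total_cost (d + k + R + B + e + 8) (2 * l + 3)"]
    conjI real_polynomial_total_cost allI impI)
  fix d k :: nat and R B \<epsilon> \<delta> :: real and F :: "vec \<Rightarrow> real"
  assume d: "1 \<le> d" and pos: "0 < R" "0 < B" "0 < \<epsilon>" "0 < \<delta>" "\<delta> < 1" and F: "signed_relu_sum d k R B F"
  let ?s = "init_state d k R B \<epsilon> \<delta>"
  obtain Q M m where Q: "4 \<le> Q" "d \<le> Q" "k \<le> Q" "R \<le> real Q" "B \<le> real Q" "1 / \<epsilon> \<le> real Q" "2 \<le> \<delta> * 2 ^ M"
    and m: "m = 2 * M * Q ^ 262"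
    and run: "\<forall>F \<omega>. \<exists>t. exec d F \<omega> Learner ?s t \<and>
      real (steps t) \<le> total_cost (real d + real k + R + B + 1 / \<epsilon> + 8) (2 * ln (1 / \<delta>) + 3) \<and>
      ((\<exists>j<M. accepted d F Q m (round_vec d m \<omega> j)) \<longrightarrow>
       (\<exists>j<M. accepted d F Q m (round_vec d m \<omega> j) \<and>
         out t = line_net d F Q (round_vec d m \<omega> j 0) (round_vec d m \<omega> j 1)))"
    by (rule Learner_correct[OF pos, of d k])
  {
    fix \<omega>
    obtain t where t: "exec d F \<omega> Learner ?s t"
      "real (steps t) \<le> total_cost (real d + real k + R + B + 1 / \<epsilon> + 8) (2 * ln (1 / \<delta>) + 3)"
      using run by blast
    \<comment> \<open>Both counters start at \<open>0\<close>, and each query costs at least one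
      step.\<close>
    have "queries t \<le> steps t" using exec_queries_le_steps[OF t(1)] by (simp add: init_state_def)
    with t show "\<exists>t. exec d F \<omega> Learner ?s t \<and>
        real (queries t) \<le> (case (real d, B, R, real k, 1 / \<epsilon>, ln (1 / \<delta>)) of
          (d, B, R, k, e, l) \<Rightarrow> total_cost (d + k + R + B + e + 8) (2 * l + 3)) \<and>
        real (steps t) \<le> (case (real d, B, R, real k, 1 / \<epsilon>, ln (1 / \<delta>)) of
          (d, B, R, k, e, l) \<Rightarrow> total_cost (d + k + R + B + e + 8) (2 * l + 3))"
      by (intro exI[of _ t]) simp
  }
  from F[unfolded signed_relu_sum_def]
  obtain s w b where swb: "\<forall>i<k. s i \<in> {-1, 1} \<and> vnorm d (w i) \<le> R \<and> \<bar>b i\<bar> \<le> B"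
    and F0: "\<forall>x \<in> {..<d} \<rightarrow>\<^sub>E UNIV. F x = (\<Sum>i<k. s i * relu (dot d (w i) x - b i))"
    by (elim exE conjE)
  have Feq: "F x = neuron_sum d k s w b x" if "x \<in> {..<d} \<rightarrow>\<^sub>E UNIV" for x
    unfolding neuron_sum_def by (rule bspec[OF F0 that])
  let ?F = "neuron_sum d k s w b"
  have s1: "\<bar>s i\<bar> \<le> 1" and w1: "vnorm d (w i) \<le> R" and b1: "\<bar>b i\<bar> \<le> B" if "i < k" for i
    using swb[rule_format, OF that] by auto
  \<comment> \<open>The Gaussian measure lives on the extensional vectors, where the oracle and the
    neuron sum agree.\<close>
  have err: "expected_sq_error d F G = expected_sq_error d ?F G" for G
    unfolding expected_sq_error_def using Feq by (intro nn_integral_cong) (simp add: space_std_normal_vec)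
  have "\<exists>E\<in>sets gaussian_sequence. measure gaussian_sequence E \<ge> 1 - \<delta> \<and>
    (\<forall>\<omega>\<in>E. (\<exists>j<M. accepted d ?F Q m (round_vec d m \<omega> j)) \<and>
      (\<forall>j<M. accepted d ?F Q m (round_vec d m \<omega> j) \<longrightarrow>
        expected_sq_error d ?F (relu_network d (line_net d ?F Q (round_vec d m \<omega> j 0) (round_vec d m \<omega> j 1)))
          \<le> ennreal (1 / real Q)))"
    unfolding m
    by (rule accepted_probability[OF Q(1) d Q(2,3) less_imp_le[OF pos(1)] Q(4,5) _ _ _ Q(7)])
      (rule s1 w1 b1; assumption)+
  then obtain E where E: "E \<in> sets gaussian_sequence" "1 - \<delta> \<le> measure gaussian_sequence E"
    and ev: "\<forall>\<omega>\<in>E. (\<exists>j<M. accepted d ?F Q m (round_vec d m \<omega> j)) \<and>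
      (\<forall>j<M. accepted d ?F Q m (round_vec d m \<omega> j) \<longrightarrow>
        expected_sq_error d ?F (relu_network d (line_net d ?F Q (round_vec d m \<omega> j 0) (round_vec d m \<omega> j 1)))
          \<le> ennreal (1 / real Q))"
    by (elim bexE conjE)
  \<comment> \<open>The learner is accurate up to \<open>1 / Q\<close>, and \<open>Init\<close> has
    raised \<open>Q\<close> to at least \<open>1 / \<epsilon>\<close>.\<close>
  have Qe: "1 / real Q \<le> \<epsilon>" using Q(1,6) pos by (simp add: field_simps)
  show "\<exists>E\<in>sets gaussian_sequence. 1 - \<delta> \<le> measure gaussian_sequence E \<and>
      (\<forall>\<omega>\<in>E. \<exists>t. exec d F \<omega> Learner ?s t \<and> expected_sq_error d F (relu_network d (out t)) \<le> ennreal \<epsilon>)"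
  proof (intro bexI[OF _ E(1)] conjI E(2) ballI)
    fix \<omega> assume "\<omega> \<in> E"
    note ev\<omega> = bspec[OF ev this]
    from spec[OF spec[OF run, of ?F], of \<omega>]
    obtain t where t: "exec d ?F \<omega> Learner ?s t"
      and imp: "(\<exists>j<M. accepted d ?F Q m (round_vec d m \<omega> j)) \<longrightarrow>
        (\<exists>j<M. accepted d ?F Q m (round_vec d m \<omega> j) \<and>
         out t = line_net d ?F Q (round_vec d m \<omega> j 0) (round_vec d m \<omega> j 1))"
      by (elim exE conjE)
    from mp[OF imp conjunct1[OF ev\<omega>]] obtain j where "j < M" "accepted d ?F Q m (round_vec d m \<omega> j)"
      and out: "out t = line_net d ?F Q (round_vec d m \<omega> j 0) (round_vec d m \<omega> j 1)"
      by (elim exE conjE)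
    then have "expected_sq_error d ?F (relu_network d (out t)) \<le> ennreal (1 / real Q)"
      unfolding out by (intro conjunct2[OF ev\<omega>, rule_format])
    also have "\<dots> \<le> ennreal \<epsilon>" using Qe by (rule ennreal_leI)
    finally have "expected_sq_error d F (relu_network d (out t)) \<le> ennreal \<epsilon>" by (simp add: err)
    \<comment> \<open>The run obtained for the total neuron sum is also a run for the given
      oracle.\<close>
    moreover have "exec d F \<omega> Learner ?s t" by (rule exec_oracle_cong[OF _ t]) (simp add: Feq)
    ultimately show "\<exists>t. exec d F \<omega> Learner ?s t \<and> expected_sq_error d F (relu_network d (out t)) \<le> ennreal \<epsilon>"
      by blast
  qed
qed

end
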